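(* Let $q=2^{2e+1}$ with $e\ge1$, and let $U$ be a Buekenhout-Tits unital in $\mathrm{PG}(2,q^2)$. For every point $P\notin(\ell_\infty\cup U)$ and every line $\ell$, the feet $\tau_P(U)$ of $P$ meet $\ell$ in at most four points. Moreover, for each $k\in\{0,1,2,3,4\}$ there exist a line $\ell$ and a point $P\notin(\ell_\infty\cup U)$ such that $|\ell\cap\tau_P(U)|=k$.
   Context: A unital in $\mathrm{PG}(2,q^2)$ is a set $U$ of $q^3+1$ points such that every line meets $U$ in $1$ (tangent line) or $q+1$ points. Each point $P\notin U$ lies on exactly $q+1$ tangent lines to $U$; the feet of $P$, denoted $\tau_P(U)$, are the $q+1$ points of $U$ whose tangent lines contain $P$. André/Bruck-Bose (ABB) construction: fix a hyperplane $\Sigma$ of $\mathrm{PG}(4,q)$ and a Desarguesian line spread $\mathcal{S}$ of $\Sigma\cong\mathrm{PG}(3,q)$. The plane $\mathrm{PG}(2,q^2)$ is modelled as follows: the points are the points of $\mathrm{PG}(4,q)\setminus\Sigma$ together with the lines of $\mathcal{S}$ (the latter being the points of a line $\ell_\infty$); the lines are $\ell_\infty$ and the planes of $\mathrm{PG}(4,q)$ not contained in $\Sigma$ that meet $\Sigma$ in a line of $\mathcal{S}$. Let $\sigma=2^{e+1}$. A Tits ovoid of $\mathrm{PG}(3,q)$ is a point set projectively equivalent to $\{(0,0,0,1)\}\cup\{(1,s,t,s^{\sigma+2}+t^\sigma+st):s,t\in\mathbb{F}_q\}$. An ovoidal cone with vertex $V$ and base an ovoid $\mathcal{O}$ (in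 a hyperplane not through $V$) is the union of the lines joining $V$ to the points of $\mathcal{O}$. A Buekenhout-Tits unital is a unital arising via the ABB construction from an ovoidal cone $\mathcal{C}$ with base a Tits ovoid such that $\mathcal{C}\cap\Sigma$ is a line of $\mathcal{S}$: its points are those of $\mathcal{C}\setminus\Sigma$ together with the point of $\ell_\infty$ corresponding to $\mathcal{C}\cap\Sigma$. The line $\ell_\infty$ in the statement is the line at infinity of this construction; it is the tangent line to $U$ at that point. *)

theory Defs
  imports "HOL-Analysis.Analysis"
begin

text \<open>Points of a projective space over the field \<open>'k\<close> are one-dimensional subspaces of
  \<open>'k ^ 'n\<close> and, more generally, subspaces of the projective space are vector subspaces, whose
  vector space dimension is one more than the projective dimension. Incidence is
  inclusion; the lines collected in \<open>pg_lines\<close> are given as sets of points.\<close>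

definition pg_points :: "('k::field ^ 'n) set set" where
  "pg_points = {p. vec.subspace p \<and> vec.dim p = 1}"

definition points_on :: "('k::field ^ 'n) set \<Rightarrow> ('k ^ 'n) set set" where
  "points_on W = {p \<in> pg_points. p \<subseteq> W}"

definition pg_lines :: "('k::field ^ 'n) set set set" where
  "pg_lines = {points_on L | L. vec.subspace L \<and> vec.dim L = 2}"

definition hyperplane_in_PG4 :: "('k::field ^ 5) set \<Rightarrow> bool" where
  "hyperplane_in_PG4 \<Sigma> \<longleftrightarrow> vec.subspace \<Sigma> \<and> vec.dim \<Sigma> = 4"


definition unital :: "nat \<Rightarrow> ('k::field ^ 3) set set \<Rightarrow> bool" where
  "unital q U \<longleftrightarrow> U \<subseteq> pg_points \<and> card U = q ^ 3 + 1 \<and>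
     (\<forall>l\<in>pg_lines. card (l \<inter> U) = 1 \<or> card (l \<inter> U) = q + 1)"

definition tangent_line :: "('k::field ^ 3) set set \<Rightarrow> ('k ^ 3) set set \<Rightarrow> bool" where
  "tangent_line U l \<longleftrightarrow> l \<in> pg_lines \<and> card (l \<inter> U) = 1"

definition feet :: "('k::field ^ 3) set set \<Rightarrow> ('k ^ 3) set \<Rightarrow> ('k ^ 3) set set" where
  "feet U P = {X \<in> U. \<exists>l. tangent_line U l \<and> X \<in> l \<and> P \<in> l}"


definition line_spread :: "('a::field ^ 5) set \<Rightarrow> ('a ^ 5) set set \<Rightarrow> bool" where
  "line_spread \<Sigma> S \<longleftrightarrow>
     (\<forall>L\<in>S. vec.subspace L \<and> vec.dim L = 2 \<and> L \<subseteq> \<Sigma>) \<and>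
     (\<forall>p\<in>points_on \<Sigma>. \<exists>!L. L \<in> S \<and> p \<subseteq> L)"

text \<open>A line spread of \<open>\<Sigma>\<close>, of projective dimension 3 over \<open>'a\<close>, is Desarguesian if it arises by
  field reduction: under an identification \<open>\<phi>\<close> of \<open>\<Sigma>\<close> with the plane \<open>'b ^ 2\<close> over the quadratic
  extension field \<open>'b\<close>, which is linear over \<open>'a\<close> (embedded in \<open>'b\<close> by \<open>\<iota>\<close>), its elements are
  the one-dimensional subspaces over \<open>'b\<close>.\<close>

definition desarguesian_spread ::
    "'b::field itself \<Rightarrow> ('a::field ^ 5) set \<Rightarrow> ('a ^ 5) set set \<Rightarrow> bool" where
  "desarguesian_spread TYPE('b) \<Sigma> S \<longleftrightarrow> line_spread \<Sigma> S \<and>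
     (\<exists>(\<iota> :: 'a \<Rightarrow> 'b) (\<phi> :: 'a ^ 5 \<Rightarrow> 'b ^ 2).
        \<iota> 1 = 1 \<and> (\<forall>x y. \<iota> (x + y) = \<iota> x + \<iota> y) \<and> (\<forall>x y. \<iota> (x * y) = \<iota> x * \<iota> y) \<and>
        bij_betw \<phi> \<Sigma> UNIV \<and>
        (\<forall>v\<in>\<Sigma>. \<forall>w\<in>\<Sigma>. \<phi> (v + w) = \<phi> v + \<phi> w) \<and>
        (\<forall>c. \<forall>v\<in>\<Sigma>. \<phi> (c *s v) = \<iota> c *s \<phi> v) \<and>
        S = {{v \<in> \<Sigma>. \<phi> v \<in> W} | W. W \<in> pg_points})"


text \<open>The Andre/Bruck--Bose plane. Its points are subspaces of \<open>'a ^ 5\<close>, of dimension 1 for those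
  off the line at infinity and of dimension 2 for those on it. As a set of points, the line at
  infinity is the spread \<open>S\<close> itself.\<close>

definition abb_points :: "('a::field ^ 5) set \<Rightarrow> ('a ^ 5) set set \<Rightarrow> ('a ^ 5) set set" where
  "abb_points \<Sigma> S = (pg_points - points_on \<Sigma>) \<union> S"

definition abb_lines :: "('a::field ^ 5) set \<Rightarrow> ('a ^ 5) set set \<Rightarrow> ('a ^ 5) set set set" where
  "abb_lines \<Sigma> S = insert S
     {{p \<in> abb_points \<Sigma> S. p \<subseteq> E} | E.
        vec.subspace E \<and> vec.dim E = 3 \<and> \<not> E \<subseteq> \<Sigma> \<and> E \<inter> \<Sigma> \<in> S}"

text \<open>An identification of \<open>PG(2,q\<^sup>2)\<close> with the Andre/Bruck--Bose plane, that is, a bijection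
  between the points that maps lines to lines in both directions.\<close>

definition abb_model ::
    "('a::field ^ 5) set \<Rightarrow> ('a ^ 5) set set \<Rightarrow> (('b::field ^ 3) set \<Rightarrow> ('a ^ 5) set) \<Rightarrow> bool" where
  "abb_model \<Sigma> S \<psi> \<longleftrightarrow> bij_betw \<psi> pg_points (abb_points \<Sigma> S) \<and>
     (\<lambda>l. \<psi> ` l) ` pg_lines = abb_lines \<Sigma> S"


definition standard_tits_ovoid :: "nat \<Rightarrow> ('a::field ^ 4) set set" where
  "standard_tits_ovoid \<sigma> =
     insert (vec.span {vector [0, 0, 0, 1]})
       {vec.span {vector [1, s, t, s ^ (\<sigma> + 2) + t ^ \<sigma> + s * t]} | s t. True}"

text \<open>A Tits ovoid in a hyperplane \<open>H\<close> of \<open>PG(4,q)\<close>, by transport along a projectivity from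
  \<open>PG(3,q)\<close> to \<open>H\<close>. The polynomial above has coefficients in the prime field, so allowing
  semilinear maps would not give more ovoids.\<close>

definition tits_ovoid_in :: "nat \<Rightarrow> ('a::field ^ 5) set \<Rightarrow> ('a ^ 5) set set \<Rightarrow> bool" where
  "tits_ovoid_in \<sigma> H \<O> \<longleftrightarrow>
     (\<exists>f. Vector_Spaces.linear (*s) (*s) f \<and> inj f \<and> range f = H \<and>
          \<O> = (\<lambda>p. f ` p) ` standard_tits_ovoid \<sigma>)"

definition ovoidal_cone :: "('a::field ^ 5) set \<Rightarrow> ('a ^ 5) set set \<Rightarrow> ('a ^ 5) set set" where
  "ovoidal_cone V \<O> = (\<Union>X\<in>\<O>. points_on (vec.span (V \<union> X)))"

definition tits_cone :: "nat \<Rightarrow> ('a::field ^ 5) set set \<Rightarrow> bool" where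
  "tits_cone \<sigma> C \<longleftrightarrow>
     (\<exists>V H \<O>. V \<in> pg_points \<and> hyperplane_in_PG4 H \<and> \<not> V \<subseteq> H \<and>
        tits_ovoid_in \<sigma> H \<O> \<and> C = ovoidal_cone V \<O>)"

text \<open>Here \<open>'a\<close> is the field of order \<open>q = 2 ^ (2 * e + 1)\<close>, \<open>'b\<close> the field of order \<open>q\<^sup>2\<close>, and
  \<open>linf\<close> is the line at infinity of the construction.\<close>

definition buekenhout_tits_unital ::
    "'a::field itself \<Rightarrow> nat \<Rightarrow> ('b::field ^ 3) set set \<Rightarrow> ('b ^ 3) set set \<Rightarrow> bool" where
  "buekenhout_tits_unital TYPE('a) e linf U \<longleftrightarrow>
     unital CARD('a) U \<and> linf \<in> pg_lines \<and>
     (\<exists>(\<Sigma> :: ('a ^ 5) set) S (\<psi> :: ('b ^ 3) set \<Rightarrow> ('a ^ 5) set) C.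
        hyperplane_in_PG4 \<Sigma> \<and> desarguesian_spread TYPE('b) \<Sigma> S \<and>
        abb_model \<Sigma> S \<psi> \<and> \<psi> ` linf = S \<and>
        tits_cone (2 ^ (e + 1)) C \<and>
        (\<exists>L\<in>S. C \<inter> points_on \<Sigma> = points_on L \<and>
               \<psi> ` U = insert L (C - points_on \<Sigma>)))"

end

theory Submission
  imports Defs
begin

text \<open>
  Since the Suzuki group is transitive on the Tits ovoid, the hyperplane at infinity may be taken to
  project from the vertex of the cone to the tangent plane at \<open>(0, 0, 0, 1)\<close>. In suitable affine
  coordinates \<open>(x, y)\<close> with \<open>x = s \<alpha> + t \<beta>\<close> the unital then is \<open>y + y\<^sup>q = f(s, t)\<close>, with \<open>f\<close> the Tits
  polynomial, and its tangent at \<open>(x, y)\<close> has slope \<open>x\<^sup>q / D\<close> with a constant \<open>D\<close>. Hence the feet of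
  \<open>P\<close> correspond to the points \<open>(s, t)\<close> of an oval, the section of the ovoid by the polar plane of \<open>P\<close>.

  A line whose slope is not the special value \<open>x\<^sub>P\<^sup>q / D\<close> cuts out collinear points of this oval,
  hence at most two. A line of the special slope cuts out the points that the oval \<open>f(u, v) = c\<close> shares
  with a conic \<open>Q(u, v) = k\<close> given by a norm form. Applying \<open>\<sigma>\<close> to \<open>Q(u, v) = k\<close> and eliminating
  \<open>u\<^sup>\<sigma>\<close> and \<open>v\<^sup>\<sigma>\<close> by means of \<open>f(u, v) = c\<close> shows that they lie on a second conic, so there are at
  most four. By moving \<open>P\<close> and rescaling, \<open>Q\<close> can be made any anisotropic form \<open>u\<^sup>2 + b u v + v\<^sup>2\<close> with
  \<open>c = k = 1\<close>. For \<open>b = 1\<close> there are exactly the solutions \<open>(1, 0)\<close>, \<open>(0, 1)\<close>, \<open>(1, 1)\<close>, and a count of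
  absolute traces provides a \<open>b\<close> with four solutions.
\<close>

section \<open>Finite fields of characteristic two\<close>

text \<open>The special slope comes from a cancellation. For a foot with first coordinate xP + w,
  lying on the line of slope n reads nm w + (conj(xP) + n D) w = const. The trace annihilates the
  norm and leaves a linear equation, unless the coefficient of w is 0; then only the norm remains.
  The second locus has degree two because, with p = c + u v, both u^\<sigma> p and v^\<sigma> p are
  squares of linear polynomials. The transformed conic equation, multiplied by p^2, is therefore a
  square, and its root can be taken. For the examples the norm form is given by the plane and only P
  is free. Its first coordinate shears (u, v) and so changes the coefficient of u^2. This reaches
  every anisotropic form up to scaling, because the elements x^2 + x form a subgroup of index two.
  For the form u^2 + b u v + v^2 and c = 1 the two conics combine to a product of two linear
  conditions on u + v. One is u + v = 1, with the points (1, 0) and (0, 1); the other admits two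
  further points on the oval under a trace condition. That condition must hold together with the one
  making the form anisotropic, and the count of traces shows that both can be met at once.\<close>

lemma finite_field_power_card:
  fixes x :: "'f::{field,finite}"
  shows "x ^ CARD('f) = x"
proof (cases "x = 0")
  case False
  let ?A = "UNIV - {0::'f}"
  have bij: "bij_betw ((*) x) ?A ?A"
    by (rule bij_betw_byWitness[where f' = "\<lambda>y. y / x"]) (use False in auto)
  have "(\<Prod>y\<in>?A. y) = (\<Prod>y\<in>?A. x * y)"
    using prod.reindex_bij_betw[OF bij, of "\<lambda>y. y"] by simp
  also have "\<dots> = x ^ card ?A * (\<Prod>y\<in>?A. y)"
    by (simp add: prod.distrib)
  finally have "x ^ card ?A = 1" by simp
  moreover have "CARD('f) = Suc (card ?A)"
    by (metis card_Suc_Diff1 finite iso_tuple_UNIV_I)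
  ultimately show ?thesis by (metis mult.right_neutral power_Suc)
qed simp

text \<open>Translation by 1 permutes the field, so adding \<open>CARD('f)\<close> ones to the sum
  of all elements does not change it.\<close>

lemma finite_field_two_eq_0:
  assumes "CARD('f::{field,finite}) = 2 ^ n"
  shows "(2::'f) = 0"
proof -
  have "(\<Sum>y\<in>UNIV. y + 1) = (\<Sum>y\<in>UNIV. y::'f)"
    by (rule sum.reindex_bij_witness[where i = "\<lambda>y. y - 1" and j = "\<lambda>y. y + 1"]) auto
  then have "of_nat CARD('f) = (0::'f)"
    by (simp add: sum.distrib)
  then show ?thesis using assms by simp
qed

locale char2 =
  fixes tp :: "'f::field itself"
  assumes two_eq_0: "(2::'f) = 0"
begin

lemma add_self: "x + x = (0::'f)"
  using two_eq_0 by (metis mult_2 mult_zero_left)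

lemma add_self_left: "x + (x + y) = (y::'f)"
  by (simp add: add_self flip: add.assoc)

lemma minus_eq: "- x = (x::'f)"
  using add_self by (metis add_eq_0_iff)

lemma diff_eq: "x - y = (x + y::'f)"
  by (metis minus_eq diff_conv_add_uminus)

lemma add_eq_0: "x + y = 0 \<longleftrightarrow> x = (y::'f)"
  by (metis minus_eq add_eq_0_iff)

lemma numeral_Bit0_eq: "numeral (num.Bit0 n) = (0::'f)"
  by (simp only: numeral_Bit0 add_self)

lemma numeral_Bit1_eq: "numeral (num.Bit1 n) = (1::'f)"
  by (simp only: numeral_Bit1 add_self add_0)

text \<open>Normal form of polynomials in characteristic two: the AC rules bring equal monomials
  together, \<open>add_self\<close> and \<open>add_self_left\<close> cancel them, and numerals are
  reduced modulo 2.\<close>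

lemmas expand = distrib_left distrib_right mult.assoc mult.commute mult.left_commute
  add.assoc add.commute add.left_commute power2_eq_square add_self add_self_left minus_eq diff_eq
  numeral_Bit0_eq numeral_Bit1_eq

lemma square_add: "(x + y)\<^sup>2 = x\<^sup>2 + (y\<^sup>2::'f)"
  by (simp add: expand)

lemma frobenius_add: "(x + y) ^ (2 ^ i) = x ^ (2 ^ i) + (y ^ (2 ^ i)::'f)"
proof (induction i)
  case (Suc i)
  have "z ^ (2 ^ Suc i) = (z ^ (2 ^ i))\<^sup>2" for z :: 'f
    by (simp add: mult.commute flip: power_mult)
  then show ?case by (simp only: Suc square_add)
qed simp

lemma frobenius_sum: "(\<Sum>j\<in>A. g j) ^ (2 ^ i) = (\<Sum>j\<in>A. g j ^ (2 ^ i)::'f)"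
  by (induction A rule: infinite_finite_induct) (auto simp: frobenius_add)

lemma frobenius_inj: "x ^ (2 ^ i) = (y::'f) ^ (2 ^ i) \<longleftrightarrow> x = y"
proof
  assume "x ^ (2 ^ i) = y ^ (2 ^ i)"
  then have "(x + y) ^ (2 ^ i) = 0" by (simp add: frobenius_add add_self)
  then show "x = y" by (simp add: add_eq_0)
qed simp

lemma square_inj: "x\<^sup>2 = (y::'f)\<^sup>2 \<longleftrightarrow> x = y"
  using frobenius_inj[of x 1 y] by simp

end

section \<open>The Tits polynomial\<close>

locale tits_field =
  fixes tp :: "'a::{field,finite} itself" and e :: nat
  assumes e_pos: "e \<ge> 1" and card_field: "CARD('a) = 2 ^ (2 * e + 1)"
begin

sublocale char2 tp
  by unfold_locales (rule finite_field_two_eq_0[OF card_field])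

text \<open>\<open>S\<close> is the Tits endomorphism \<open>x \<mapsto> x ^ \<sigma>\<close>, whose square is the Frobenius map, and
  \<open>R\<close> is its inverse.\<close>

definition S :: "'a \<Rightarrow> 'a" where "S x = x ^ (2 ^ (e + 1))"
definition R :: "'a \<Rightarrow> 'a" where "R x = x ^ (2 ^ e)"

lemma power_q: "(x::'a) ^ (2 ^ (2 * e + 1)) = x"
  using finite_field_power_card[of x] by (simp only: card_field)

lemma S_add [simp]: "S (x + y) = S x + S y"
  unfolding S_def by (rule frobenius_add)
lemma S_mult [simp]: "S (x * y) = S x * S y"
  unfolding S_def by (rule power_mult_distrib)
lemma R_mult [simp]: "R (x * y) = R x * R y"
  unfolding R_def by (rule power_mult_distrib)
lemma S_divide [simp]: "S (x / y) = S x / S y"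
  unfolding S_def by (rule power_divide)
lemma S_0 [simp]: "S 0 = 0" and S_1 [simp]: "S 1 = 1" and R_0 [simp]: "R 0 = 0" and R_1 [simp]: "R 1 = 1"
  by (auto simp: S_def R_def)
lemma S_eq_0 [simp]: "S x = 0 \<longleftrightarrow> x = 0" and R_eq_0 [simp]: "R x = 0 \<longleftrightarrow> x = 0"
  by (auto simp: S_def R_def)
lemma S_S [simp]: "S (S x) = x * x"
proof -
  have "(2::nat) ^ (e + 1) * 2 ^ (e + 1) = 2 ^ (2 * e + 1) * 2"
    by (simp add: power_add mult_2, simp add: algebra_simps)
  then have "S (S x) = (x ^ (2 ^ (2 * e + 1))) ^ 2"
    unfolding S_def power_mult[symmetric] by (rule arg_cong)
  then show ?thesis by (simp only: power_q power2_eq_square)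
qed
lemma R_R: "R x * R x = S x"
  by (simp add: S_def R_def mult_2 power_add)
lemma S_R [simp]: "S (R x) = x" and R_S [simp]: "R (S x) = x"
proof -
  have *: "(2::nat) ^ e * 2 ^ (e + 1) = 2 ^ (2 * e + 1)" "(2::nat) ^ (e + 1) * 2 ^ e = 2 ^ (2 * e + 1)"
    by (simp add: power_add mult_2, simp add: algebra_simps)+
  show "S (R x) = x" "R (S x) = x"
    unfolding S_def R_def power_mult[symmetric] * by (rule power_q)+
qed
lemma S_inj: "S x = S y \<longleftrightarrow> x = y"
  by (metis R_S)

lemma card_field_ge: "CARD('a) \<ge> 8"
proof -
  have "(2::nat) ^ 3 \<le> 2 ^ (2 * e + 1)"
    by (rule power_increasing) (use e_pos in auto)
  then show ?thesis using card_field by simp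
qed

lemma ex_not_0_1: "\<exists>x::'a. x \<noteq> 0 \<and> x \<noteq> 1"
proof (rule ccontr)
  assume "\<not> ?thesis"
  then have "UNIV \<subseteq> {0, 1::'a}" by blast
  then have "CARD('a) \<le> card {0, 1::'a}" by (rule card_mono[rotated]) simp
  also have "\<dots> \<le> 2" by (simp add: card_insert_if)
  finally show False using card_field_ge by simp
qed

definition f :: "'a \<Rightarrow> 'a \<Rightarrow> 'a" where "f s t = S s * s\<^sup>2 + S t + s * t"

lemma f_eq: "f s t = s ^ (2 ^ (e + 1) + 2) + t ^ (2 ^ (e + 1)) + s * t"
  by (simp add: f_def S_def power_add power2_eq_square)

lemma f_0 [simp]: "f 0 0 = 0"
  by (simp add: f_def)

text \<open>Subtracting the tangent plane at \<open>(s0, t0)\<close> turns \<open>f\<close> into \<open>f\<close> itself in new coordinates: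
  this is the action of the Suzuki group element moving that point of the ovoid to the origin.\<close>

lemma f_translate: "f s t + f s0 t0 + t0 * s + s0 * t = f (s + s0) (t + t0 + S s0 * (s + s0))"
  by (simp add: f_def expand)

text \<open>If S w = w + 1, then S (S w) = w, whereas S (S w) = w^2; so w is 0 or 1, and S fixes
  both.\<close>

lemma S_ne_add_1: "S w + w + 1 \<noteq> 0"
proof
  assume *: "S w + w + 1 = 0"
  then have 1: "S w = w + 1" unfolding add.assoc add_eq_0 .
  have "S (S w) = w + 1 + 1" unfolding 1 S_add S_1 ..
  then have "w * w = w" by (simp add: add.assoc add_self)
  then have "w = 0 \<or> w = 1" by simp
  then show False using * by (auto simp: add_self)
qed

text \<open>\<open>f\<close> is homogeneous if u has weight 1 and v weight \<sigma> + 1, so v = w u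
  S u leaves a polynomial in w alone, which \<open>S_ne_add_1\<close> shows to have no zero.
  Geometrically, the plane z = 0 is tangent at the origin.\<close>

lemma f_eq_0_iff: "f u v = 0 \<longleftrightarrow> u = 0 \<and> v = 0"
proof
  assume *: "f u v = 0"
  show "u = 0 \<and> v = 0"
  proof (cases "u = 0")
    case True
    then show ?thesis using * by (simp add: f_def)
  next
    case False
    define w where "w = v / (u * S u)"
    have v: "v = w * (u * S u)" using False by (simp add: w_def)
    have "f u v = (S u * u\<^sup>2) * (S w + w + 1)"
      by (simp add: v f_def expand)
    then show ?thesis using * False S_ne_add_1[of w] by simp
  qed
qed simp

text \<open>A plane through the origin other than the tangent plane meets the ovoid again. The
  witness solves S v = b v at u = 0 if b \<noteq> 0, and S u u = a at v = 0 otherwise.\<close>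

lemma f_eq_linear:
  assumes "a \<noteq> 0 \<or> b \<noteq> 0"
  obtains u v where "u \<noteq> 0 \<or> v \<noteq> 0" "f u v = a * u + b * v"
proof (cases "b = 0")
  case False
  then show ?thesis
    by (intro that[of 0 "S b * b"]) (auto simp: f_def)
next
  case True
  then have "a \<noteq> 0" using assms by simp
  with True show ?thesis
    by (intro that[of "S a / a" 0]) (auto simp: f_def field_simps power2_eq_square)
qed

text \<open>The elimination behind the second conic. The first identity results from applying S to
  \<open>f u v\<close>, as S (S x) = x^2; the second follows by substituting it into S v = (f u v +
  u v) + S u u^2.\<close>

lemma S_relation1: "S u * (f u v + u * v) = v\<^sup>2 + S (f u v)"
  and S_relation2: "S v * (f u v + u * v) = (f u v)\<^sup>2 + S (f u v) * u\<^sup>2"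
  by (simp_all add: f_def expand)

text \<open>The reversal of coordinates of \<open>PG(3,q)\<close> preserves the standard Tits ovoid.\<close>

lemma f_swap:
  assumes "f u v \<noteq> 0"
  shows "f (v / f u v) (u / f u v) = 1 / f u v"
proof -
  define c where "c = f u v"
  have c: "c \<noteq> 0" using assms by (simp add: c_def)
  have *: "S v * v\<^sup>2 + S u * c\<^sup>2 + u * v * S c = c * S c"
    by (simp add: c_def f_def expand)
  have "f (v / c) (u / c) = (S v * v\<^sup>2 + S u * c\<^sup>2 + u * v * S c) / (c\<^sup>2 * S c)"
    using c by (simp add: f_def field_simps power2_eq_square)
  also have "\<dots> = 1 / c"
    unfolding * using c by (simp add: field_simps power2_eq_square)
  finally show ?thesis by (simp add: c_def)
qed

text \<open>The points (x u, x v, x E) lie on a line through the origin. The reversal takes such a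
  point of the ovoid to the one over (v / E, u / E), which does not depend on x, with third
  coordinate 1 / (x E); hence x is determined.\<close>

lemma f_ray_unique:
  assumes "u \<noteq> 0 \<or> v \<noteq> 0" and "x \<noteq> 0" "y \<noteq> 0"
    and "f (x * u) (x * v) = x * E" and "f (y * u) (y * v) = y * E"
  shows "x = y"
proof -
  have "f (x * u) (x * v) \<noteq> 0"
    using assms by (auto simp: f_eq_0_iff)
  then have E: "E \<noteq> 0" using assms by auto
  have *: "f (v / E) (u / E) = 1 / (z * E)" if "z \<noteq> 0" "f (z * u) (z * v) = z * E" for z
    using f_swap[of "z * u" "z * v"] that E by (simp add: field_simps)
  show ?thesis
    using *[of x] *[of y] assms E by auto
qed

text \<open>\<open>f_translate\<close> moves the base point (s0, t0) to the origin, where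
  \<open>f_ray_unique\<close> applies; so no three points of the ovoid are collinear.\<close>

lemma collinear_unique:
  assumes uv: "u \<noteq> 0 \<or> v \<noteq> 0" and xy: "x \<noteq> 0" "y \<noteq> 0"
    and x: "f (s0 + x * u) (t0 + x * v) = f s0 t0 + x * E"
    and y: "f (s0 + y * u) (t0 + y * v) = f s0 t0 + y * E"
  shows "x = y"
proof (rule f_ray_unique[of u "v + S s0 * u"])
  show "u \<noteq> 0 \<or> v + S s0 * u \<noteq> 0" using uv by auto
  have *: "f (z * u) (z * (v + S s0 * u)) = z * (E + t0 * u + s0 * v)"
    if "f (s0 + z * u) (t0 + z * v) = f s0 t0 + z * E" for z
  proof -
    have "f (z * u) (z * (v + S s0 * u)) =
        f (s0 + z * u) (t0 + z * v) + f s0 t0 + t0 * (s0 + z * u) + s0 * (t0 + z * v)"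
      by (subst f_translate) (simp add: expand)
    also have "\<dots> = z * (E + t0 * u + s0 * v)"
      unfolding that by (simp add: expand)
    finally show ?thesis .
  qed
  show "f (x * u) (x * (v + S s0 * u)) = x * (E + t0 * u + s0 * v)"
    "f (y * u) (y * (v + S s0 * u)) = y * (E + t0 * u + s0 * v)"
    using *[OF x] *[OF y] by auto
qed (use xy in auto)

text \<open>A vertical and a non-vertical plane of affine space meet in a line, so three solutions
  would be three collinear points of the ovoid.\<close>

lemma card_line_plane_section:
  assumes lm: "l \<noteq> 0 \<or> m \<noteq> 0"
  shows "card {(s, t). l * s + m * t = n \<and> f s t = p * s + r * t + c} \<le> 2" (is "card ?A \<le> 2")
proof (rule ccontr)
  assume "\<not> ?thesis"
  then have "3 \<le> card ?A" by linarith
  then obtain T where T: "T \<subseteq> ?A" "card T = 3"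
    by (meson obtain_subset_with_card_n)
  then obtain P0 P1 P2 where P: "T = {P0, P1, P2}" "P0 \<noteq> P1" "P0 \<noteq> P2" "P1 \<noteq> P2"
    by (auto simp: card_3_iff)
  obtain s0 t0 where P0: "P0 = (s0, t0)" by fastforce
  have h0: "l * s0 + m * t0 = n" "f s0 t0 = p * s0 + r * t0 + c"
    using T P P0 by auto
  have dir: "\<exists>x. x \<noteq> 0 \<and> Q = (s0 + x * m, t0 + x * l) \<and>
      f (s0 + x * m) (t0 + x * l) = f s0 t0 + x * (p * m + r * l)"
    if Q: "Q \<in> ?A" "Q \<noteq> P0" for Q
  proof -
    obtain s t where st: "Q = (s, t)" by fastforce
    have h: "l * s + m * t = n" "f s t = p * s + r * t + c" using Q st by auto
    have d: "l * (s + s0) = m * (t + t0)"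
    proof -
      have "l * (s + s0) + m * (t + t0) = (l * s + m * t) + (l * s0 + m * t0)"
        by (simp add: algebra_simps)
      also have "\<dots> = 0" by (simp add: h h0 add_self)
      finally show ?thesis by (simp add: add_eq_0)
    qed
    \<comment> \<open>Parameter along the direction (m, l) of the line, read off from a coordinate
      in which this direction does not vanish.\<close>
    define x where "x = (if m = 0 then (t + t0) / l else (s + s0) / m)"
    have x1: "x * m = s + s0"
      using d lm by (cases "m = 0") (auto simp: x_def)
    have x2: "x * l = t + t0"
    proof (cases "m = 0")
      case False
      have "x * l * m = (t + t0) * m"
        using x1 d by (metis mult.assoc mult.commute)
      then show ?thesis using False by simp
    qed (use lm in \<open>auto simp: x_def\<close>)
    have s: "s = s0 + x * m" and t: "t = t0 + x * l"
      unfolding x1 x2 by (simp_all add: expand)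
    have "x \<noteq> 0" using Q st P0 s t by auto
    moreover have "f s t = f s0 t0 + x * (p * m + r * l)"
      unfolding h(2) h0(2) by (simp add: s t expand)
    ultimately show ?thesis using st s t by metis
  qed
  obtain x where x: "x \<noteq> 0" "P1 = (s0 + x * m, t0 + x * l)"
    "f (s0 + x * m) (t0 + x * l) = f s0 t0 + x * (p * m + r * l)"
    using dir[of P1] P T by auto
  obtain y where y: "y \<noteq> 0" "P2 = (s0 + y * m, t0 + y * l)"
    "f (s0 + y * m) (t0 + y * l) = f s0 t0 + y * (p * m + r * l)"
    using dir[of P2] P T by auto
  have "x = y"
    by (rule collinear_unique[OF _ x(1) y(1) x(3) y(3)]) (use lm in auto)
  then show False using x y P by auto
qed

section \<open>Plane sections of the ovoid and conics\<close>

text \<open>Apply S to the conic equation and multiply by the square of p = c + u v. Since S u p and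
  S v p are the squares of v + R c and c + R c u, every term becomes a square, and taking the root
  brings the degree back to two.\<close>

lemma conic_of_intersection:
  assumes Q: "a * u\<^sup>2 + b * (u * v) + d * v\<^sup>2 = 1" and c: "f u v = c"
  shows "R a * (v\<^sup>2 + S c) + R b * ((v + R c) * (c + R c * u)) + R d * (c\<^sup>2 + S c * u\<^sup>2) = c + u * v"
proof -
  define U where "U = S u"
  define V where "V = S v"
  define p where "p = c + u * v"
  have U: "U * p = v\<^sup>2 + S c" and V: "V * p = c\<^sup>2 + S c * u\<^sup>2"
    using S_relation1[of u v] S_relation2[of v u] c by (simp_all add: U_def V_def p_def)
  have "S (a * u\<^sup>2 + b * (u * v) + d * v\<^sup>2) = S 1"
    by (simp only: Q)
  then have SQ: "S a * U\<^sup>2 + S b * (U * V) + S d * V\<^sup>2 = 1"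
    by (simp add: U_def V_def power2_eq_square)
  have sq: "(v + R c)\<^sup>2 = v\<^sup>2 + S c" "(c + R c * u)\<^sup>2 = c\<^sup>2 + S c * u\<^sup>2"
    by (simp_all only: square_add power_mult_distrib) (simp_all add: R_R power2_eq_square)
  have RR: "(R x)\<^sup>2 = S x" for x
    by (simp add: power2_eq_square R_R)
  have "(R a * (v\<^sup>2 + S c) + R b * ((v + R c) * (c + R c * u)) + R d * (c\<^sup>2 + S c * u\<^sup>2))\<^sup>2
      = S a * (U * p)\<^sup>2 + S b * ((U * p) * (V * p)) + S d * (V * p)\<^sup>2"
    by (simp only: square_add power_mult_distrib sq RR U V)
  also have "\<dots> = p\<^sup>2 * (S a * U\<^sup>2 + S b * (U * V) + S d * V\<^sup>2)"
    by (simp add: algebra_simps power2_eq_square)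
  also have "\<dots> = p\<^sup>2" by (simp only: SQ mult_1_right)
  finally show ?thesis by (simp add: square_inj p_def)
qed

text \<open>Homogenising the previous conic with the first one and squaring gives a binary quartic form
  in \<open>u, v\<close>. Its odd coefficients are multiples of \<open>b\<close>, so it does not vanish identically.\<close>

lemma card_conic_inter_oval_normalized:
  assumes b: "b \<noteq> 0" and c: "c \<noteq> 0"
  shows "card {(u, v). a * u\<^sup>2 + b * (u * v) + d * v\<^sup>2 = 1 \<and> f u v = c} \<le> 4" (is "card ?A \<le> 4")
proof -
  \<comment> \<open>\<open>K\<close> is the constant term of the second conic, \<open>l0\<close> and
    \<open>l1\<close> are its linear coefficients, and \<open>M0\<close>, \<open>M1\<close>,
    \<open>M2\<close> the quadratic ones after \<open>K\<close> has been replaced by K Q.\<close>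
  define K where "K = R a * S c + R b * (R c * c) + R d * c\<^sup>2 + c"
  define M0 where "M0 = R d * S c + K * a"
  define M1 where "M1 = R b * R c + 1 + K * b"
  define M2 where "M2 = R a + K * d"
  define l0 where "l0 = R b * S c"
  define l1 where "l1 = R b * c"
  have l: "l0 \<noteq> 0" "l1 \<noteq> 0" using b c by (auto simp: l0_def l1_def)
  \<comment> \<open>The coefficient of v^4, that is, the value of the quartic form at (0, 1); it
    decides whether a common point can have u = 0.\<close>
  define k where "k = M2\<^sup>2 + l1\<^sup>2 * d"
  define p where "p = [:M0\<^sup>2 + l0\<^sup>2 * a, l0\<^sup>2 * b, M1\<^sup>2 + l0\<^sup>2 * d + l1\<^sup>2 * a, l1\<^sup>2 * b, k:]"
  have p0: "p \<noteq> 0" using l b by (simp add: p_def)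
  have quartic: "(M0\<^sup>2 + l0\<^sup>2 * a) * u^4 + l0\<^sup>2 * b * (u^3 * v) + (M1\<^sup>2 + l0\<^sup>2 * d + l1\<^sup>2 * a) * (u^2 * v^2)
      + l1\<^sup>2 * b * (u * v^3) + k * v^4 = 0" if A: "(u, v) \<in> ?A" for u v
  proof -
    define Q where "Q = a * u\<^sup>2 + b * (u * v) + d * v\<^sup>2"
    have Q: "Q = 1" and fc: "f u v = c" using A by (auto simp: Q_def)
    have "R a * (v\<^sup>2 + S c) + R b * ((v + R c) * (c + R c * u)) + R d * (c\<^sup>2 + S c * u\<^sup>2) = c + u * v"
      using conic_of_intersection A by auto
    then have "R a * (v\<^sup>2 + S c) + R b * ((v + R c) * (c + R c * u)) + R d * (c\<^sup>2 + S c * u\<^sup>2) + (c + u * v) = 0"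
      by (simp only: add_eq_0)
    moreover have "R a * (v\<^sup>2 + S c) + R b * ((v + R c) * (c + R c * u)) + R d * (c\<^sup>2 + S c * u\<^sup>2) + (c + u * v)
      = (R d * S c * u\<^sup>2 + (R b * R c + 1) * (u * v) + R a * v\<^sup>2 + K * 1) + (l0 * u + l1 * v)"
      by (simp add: K_def l0_def l1_def expand flip: R_R)
    moreover have "R d * S c * u\<^sup>2 + (R b * R c + 1) * (u * v) + R a * v\<^sup>2 + K * Q
      = M0 * u\<^sup>2 + M1 * (u * v) + M2 * v\<^sup>2"
      by (simp add: Q_def M0_def M1_def M2_def algebra_simps)
    ultimately have "M0 * u\<^sup>2 + M1 * (u * v) + M2 * v\<^sup>2 = l0 * u + l1 * v"
      by (simp only: Q add_eq_0)
    then have "(M0 * u\<^sup>2 + M1 * (u * v) + M2 * v\<^sup>2)\<^sup>2 + (l0 * u + l1 * v)\<^sup>2 * Q = 0"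
      by (simp only: add_eq_0 Q mult_1_right)
    moreover have "(M0 * u\<^sup>2 + M1 * (u * v) + M2 * v\<^sup>2)\<^sup>2 + (l0 * u + l1 * v)\<^sup>2 * Q =
      (M0\<^sup>2 + l0\<^sup>2 * a) * u^4 + l0\<^sup>2 * b * (u^3 * v) + (M1\<^sup>2 + l0\<^sup>2 * d + l1\<^sup>2 * a) * (u^2 * v^2)
        + l1\<^sup>2 * b * (u * v^3) + k * v^4"
      by (simp add: Q_def k_def expand power3_eq_cube power4_eq_xxxx)
    ultimately show ?thesis by simp
  qed
  define Z where "Z = {z. poly p z = 0}"
  have finZ: "finite Z" unfolding Z_def by (rule poly_roots_finite[OF p0])
  have cardZ: "card Z \<le> degree p" unfolding Z_def by (rule card_poly_roots_bound[OF p0])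
  have deg: "degree p \<le> 4" "k = 0 \<Longrightarrow> degree p \<le> 3" by (simp_all add: p_def)
  define A1 where "A1 = {(u, v) \<in> ?A. u \<noteq> 0}"
  have root: "v / u \<in> Z" if "(u, v) \<in> A1" for u v
  proof -
    have u: "u \<noteq> 0" and A: "(u, v) \<in> ?A" using that by (auto simp: A1_def)
    define z where "z = v / u"
    have v: "v = z * u" using u by (simp add: z_def)
    have "u^4 * poly p z = 0"
      using quartic[OF A] unfolding v
      by (simp add: p_def algebra_simps power2_eq_square power3_eq_cube power4_eq_xxxx)
    then show ?thesis using u by (simp add: Z_def z_def)
  qed
  \<comment> \<open>For a given ratio v / u the conic equation fixes u^2, and squaring is
    injective.\<close>
  have inj: "inj_on (\<lambda>(u, v). v / u) A1"
  proof (rule inj_onI, clarsimp)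
    fix u v u' v' assume uv: "(u, v) \<in> A1" "(u', v') \<in> A1" and eq: "v / u = v' / u'"
    define z where "z = v / u"
    have nz: "u \<noteq> 0" "u' \<noteq> 0" using uv by (auto simp: A1_def)
    have v: "v = z * u" "v' = z * u'" using nz eq by (simp_all add: z_def nonzero_eq_divide_eq)
    have "(a + b * z + d * z\<^sup>2) * u\<^sup>2 = 1" "(a + b * z + d * z\<^sup>2) * u'\<^sup>2 = 1"
      using uv by (auto simp: A1_def v algebra_simps power2_eq_square)
    then have "u\<^sup>2 = u'\<^sup>2"
      by (metis mult_left_cancel mult_zero_left zero_neq_one)
    then show "u = u' \<and> v = v'" by (simp add: square_inj v)
  qed
  have card1: "card A1 \<le> card Z"
    by (rule card_inj_on_le[OF inj _ finZ]) (use root in auto)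
  have finA: "finite ?A" by (rule finite_subset[of _ UNIV]) auto
  \<comment> \<open>If the coefficient of v^4 vanishes, the degree in v / u drops to three, which
    leaves room for the one possible point with u = 0.\<close>
  show ?thesis
  proof (cases "k = 0")
    case True
    have "?A \<subseteq> A1 \<union> {(u::'a, v). u = 0 \<and> d * v\<^sup>2 = 1}" by (auto simp: A1_def)
    then have "card ?A \<le> card (A1 \<union> {(u::'a, v). u = 0 \<and> d * v\<^sup>2 = 1})"
      by (rule card_mono[rotated]) simp
    also have "\<dots> \<le> card A1 + card {(u::'a, v). u = 0 \<and> d * v\<^sup>2 = 1}"
      by (rule card_Un_le)
    also have "card {(u::'a, v). u = 0 \<and> d * v\<^sup>2 = 1} \<le> 1"
    proof -
      have "v = w" if "d * v\<^sup>2 = 1" "d * w\<^sup>2 = 1" for v w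
        using that by (metis mult_left_cancel mult_zero_left zero_neq_one square_inj)
      then show ?thesis by (subst One_nat_def, subst card_le_Suc0_iff_eq) auto
    qed
    finally show ?thesis using card1 cardZ deg(2)[OF True] by linarith
  next
    case False
    have "?A \<subseteq> A1"
    proof clarify
      fix u v assume A: "a * u\<^sup>2 + b * (u * v) + d * v\<^sup>2 = 1" "c = f u v"
      have "u \<noteq> 0"
      proof
        assume u: "u = 0"
        then have "k * v^4 = 0" using quartic[of u v] A by simp
        then have "v = 0" using False by simp
        then show False using u A by simp
      qed
      then show "(u, v) \<in> A1" using A by (simp add: A1_def)
    qed
    then have "card ?A \<le> card A1" by (rule card_mono[rotated]) simp
    then show ?thesis using card1 cardZ deg(1) by linarith
  qed
qed

lemma card_conic_inter_oval:
  assumes D: "D \<noteq> 0" and c: "c \<noteq> 0" and k: "k \<noteq> 0"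
  shows "card {(u, v). A * u\<^sup>2 + D * (u * v) + B * v\<^sup>2 = k \<and> f u v = c} \<le> 4"
proof -
  have "A * u\<^sup>2 + D * (u * v) + B * v\<^sup>2 = k \<longleftrightarrow> A/k * u\<^sup>2 + D/k * (u * v) + B/k * v\<^sup>2 = 1" for u v
    using k by (simp add: field_simps)
  then show ?thesis
    using card_conic_inter_oval_normalized[of "D/k" c "A/k" "B/k"] D k c by simp
qed

section \<open>Conics meeting the oval in three and in four points\<close>

definition Tr :: "'a \<Rightarrow> 'a" where "Tr x = (\<Sum>i<2*e+1. x ^ (2 ^ i))"

lemma Tr_add: "Tr (x + y) = Tr x + Tr y"
  by (simp add: Tr_def frobenius_add sum.distrib)

lemma Tr_0 [simp]: "Tr 0 = 0"
  by (simp add: Tr_def zero_power)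

text \<open>The degree 2 e + 1 over the prime field is odd. In particular x^2 + x = 1 has no
  solution.\<close>

lemma Tr_1 [simp]: "Tr 1 = 1"
  by (simp add: Tr_def add_self mult_2)

lemma Tr_frobenius [simp]: "Tr (x\<^sup>2) = Tr x"
proof -
  have "Tr (x\<^sup>2) = (\<Sum>i<2*e+1. x ^ (2 ^ Suc i))"
    by (simp add: Tr_def mult.commute flip: power_mult)
  also have "\<dots> + x = (\<Sum>i<Suc (2*e+1). x ^ (2 ^ i))"
    by (subst sum.lessThan_Suc_shift) simp
  also have "\<dots> = Tr x + x"
    using power_q[of x] by (simp add: Tr_def)
  finally show ?thesis by simp
qed

lemma Tr_square: "(Tr x)\<^sup>2 = Tr x"
proof -
  have "(Tr x)\<^sup>2 = Tr (x\<^sup>2)"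
    using frobenius_sum[of "\<lambda>i. x ^ 2 ^ i" "{..<2*e+1}" 1]
    by (simp add: Tr_def mult.commute flip: power_mult)
  then show ?thesis by simp
qed

lemma Tr_cases: "Tr x = 0 \<or> Tr x = 1"
  using Tr_square[of x] by (simp add: power2_eq_square)

lemma Tr_S [simp]: "Tr (S x) = Tr x"
proof -
  have "Tr (x ^ (2 ^ i)) = Tr x" for i
  proof (induction i)
    case (Suc i)
    have "x ^ (2 ^ Suc i) = (x ^ (2 ^ i))\<^sup>2" by (simp add: mult.commute flip: power_mult)
    then show ?case by (simp only: Tr_frobenius Suc)
  qed simp
  from this[of "e + 1"] show ?thesis by (simp only: S_def)
qed

lemma card_Tr_0: "2 * card {x. Tr x = 0} = CARD('a)"
proof -
  have "bij_betw (\<lambda>x. x + 1) {x. Tr x = 0} {x. Tr x = 1}"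
    by (rule bij_betw_byWitness[where f' = "\<lambda>x. x + 1"]) (auto simp: Tr_add add_self add.assoc)
  then have "card {x. Tr x = 0} = card {x. Tr x = 1}" by (rule bij_betw_same_card)
  moreover have "card ({x. Tr x = 0} \<union> {x. Tr x = 1}) = card {x. Tr x = 0} + card {x. Tr x = 1}"
    by (rule card_Un_disjoint) auto
  moreover have "{x. Tr x = 0} \<union> {x. Tr x = 1} = UNIV" using Tr_cases by auto
  ultimately show ?thesis by simp
qed

lemma no_artin_schreier_root: "Tr t \<noteq> 0 \<Longrightarrow> x\<^sup>2 + x \<noteq> t"
  by (auto simp: Tr_add add_self)

text \<open>The map x \<mapsto> x^2 + x is additive with fibres of at most two elements, so its
  image has index at most two and s, t lie in the same coset.\<close>

lemma artin_schreier_sum: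
  fixes s t :: 'a
  assumes s: "\<And>x. x\<^sup>2 + x \<noteq> s" and t: "\<And>x. x\<^sup>2 + x \<noteq> t"
  obtains x where "x\<^sup>2 + x = s + t"
proof -
  define I where "I = range (\<lambda>x::'a. x\<^sup>2 + x)"
  have fib: "card {x. x\<^sup>2 + x = y} \<le> 2" for y :: 'a
  proof -
    have "card {x. poly [:y, 1, 1:] x = 0} \<le> degree [:y, 1, 1:]"
      by (rule card_poly_roots_bound) simp
    moreover have "{x. x\<^sup>2 + x = y} = {x. poly [:y, 1, 1:] x = 0}"
      by (subst add_eq_0[symmetric]) (simp add: power2_eq_square algebra_simps)
    ultimately show ?thesis by simp
  qed
  have "CARD('a) = (\<Sum>y\<in>I. card {x. x\<^sup>2 + x = y})"
    unfolding I_def by (subst card_eq_sum, subst sum.image_gen[where g = "\<lambda>x. x\<^sup>2 + x"]) auto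
  also have "\<dots> \<le> (\<Sum>y\<in>I. 2)" by (rule sum_mono) (rule fib)
  finally have I: "CARD('a) \<le> 2 * card I" by simp
  define J where "J = (+) s ` I"
  have "card J = card I" unfolding J_def by (rule card_image) simp
  moreover have "card (I \<union> J) = card I + card J"
  proof (rule card_Un_disjoint)
    show "I \<inter> J = {}"
    proof (rule ccontr)
      assume "I \<inter> J \<noteq> {}"
      then obtain x y where "x\<^sup>2 + x = s + (y\<^sup>2 + y)" by (auto simp: I_def J_def)
      then have "(x\<^sup>2 + x) + (y\<^sup>2 + y) = s" by (simp add: add.assoc add_self)
      then have "(x + y)\<^sup>2 + (x + y) = s" by (simp add: square_add algebra_simps)
      then show False using s by blast
    qed
  qed auto
  moreover have "card (I \<union> J) \<le> CARD('a)" by (rule card_mono) auto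
  ultimately have "card (I \<union> J) = CARD('a)" using I by linarith
  then have "I \<union> J = UNIV" by (metis card_subset_eq finite subset_UNIV)
  moreover have "t \<notin> I" using t by (auto simp: I_def)
  ultimately have "t \<in> J" by blast
  then obtain x where "t = s + (x\<^sup>2 + x)" by (auto simp: I_def J_def)
  then have "x\<^sup>2 + x = s + t" by (simp add: add_self_left)
  then show ?thesis by (rule that)
qed

section \<open>Sums of power maps over the nonzero elements\<close>

lemma sum_nonzero_multiplicative:
  fixes g :: "'a \<Rightarrow> 'a"
  assumes mult: "\<And>x y. g (x * y) = g x * g y" and h: "h \<noteq> 0" "g h \<noteq> 1"
  shows "(\<Sum>x\<in>UNIV - {0}. g x) = 0"
proof -
  have "(\<Sum>x\<in>UNIV - {0}. g x) = (\<Sum>x\<in>UNIV - {0}. g (h * x))"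
    by (rule sum.reindex_bij_witness[where i = "\<lambda>x. h * x" and j = "\<lambda>x. x / h"]) (use h in auto)
  also have "\<dots> = g h * (\<Sum>x\<in>UNIV - {0}. g x)"
    by (simp add: mult sum_distrib_left)
  finally show ?thesis using h(2) by simp
qed

text \<open>Expanding the trace gives sums of multiplicative maps, each 0 unless the map is trivial.
  A trivial one would make inversion a Frobenius power, hence additive; then 1 / (h + 1) = 1 / h +
  1, so h^2 + h = 1, which is impossible.\<close>

lemma sum_inverse_Tr: "(\<Sum>x\<in>UNIV - {0}. Tr (1 / x) / x) = 0"
proof -
  have "(\<Sum>x\<in>UNIV - {0::'a}. (1 / x) ^ (2 ^ i) / x) = 0" for i
  proof -
    obtain h :: 'a where h: "h \<noteq> 0" "h \<noteq> 1" using ex_not_0_1 by blast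
    have "\<exists>h::'a. h \<noteq> 0 \<and> (1 / h) ^ (2 ^ i) / h \<noteq> 1"
    proof (rule ccontr)
      assume "\<not> ?thesis"
      then have "(1 / x) ^ (2 ^ i) / x = 1" if "x \<noteq> 0" for x :: 'a
        using that by blast
      then have inv: "(1 / x) ^ (2 ^ i) = x" if "x \<noteq> 0" for x :: 'a
        using that by (metis nonzero_divide_eq_eq mult_1)
      have *: "x ^ (2 ^ i) = 1 / x" if "x \<noteq> 0" for x :: 'a
        using inv[OF that] that by (simp add: power_divide field_simps)
      have h1: "h + 1 \<noteq> 0" using h by (simp add: add_eq_0)
      have "1 / (h + 1) = 1 / h + 1"
        using *[OF h1] *[OF h(1)] by (simp add: frobenius_add)
      then have "h = (h + 1) * (h + 1)" using h(1) h1 by (simp add: field_simps)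
      then have "h = h\<^sup>2 + 1" by (simp add: expand)
      then have "h\<^sup>2 + h = 1" by (metis add_self_left add.commute)
      then show False using no_artin_schreier_root[of 1 h] by simp
    qed
    then obtain k :: 'a where k: "k \<noteq> 0" "(1 / k) ^ (2 ^ i) / k \<noteq> 1" by blast
    show ?thesis
      by (rule sum_nonzero_multiplicative[where g = "\<lambda>x. (1 / x) ^ (2 ^ i) / x", OF _ k])
        (simp add: power_divide power_mult_distrib)
  qed
  moreover have "(\<Sum>x\<in>UNIV - {0}. Tr (1 / x) / x)
      = (\<Sum>i<2*e+1. \<Sum>x\<in>UNIV - {0::'a}. (1 / x) ^ (2 ^ i) / x)"
    by (subst sum.swap) (simp only: Tr_def sum_divide_distrib)
  ultimately show ?thesis by simp
qed

text \<open>Again every summand of the trace gives a multiplicative map. If one were trivial, then x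
  \<mapsto> S x x would respect the addition of 1; the cross term S x + x would vanish, so S would
  be the identity and x^2 = x for all x.\<close>

lemma sum_Tr_S: "(\<Sum>x\<in>UNIV - {0}. Tr (S x * x) / x) = 0"
proof -
  have "(\<Sum>x\<in>UNIV - {0::'a}. (S x * x) ^ (2 ^ i) / x) = 0" for i
  proof -
    obtain h :: 'a where h: "h \<noteq> 0" "h \<noteq> 1" using ex_not_0_1 by blast
    have "\<exists>h::'a. h \<noteq> 0 \<and> (S h * h) ^ (2 ^ i) / h \<noteq> 1"
    proof (rule ccontr)
      assume "\<not> ?thesis"
      then have "(S x * x) ^ (2 ^ i) = x" if "x \<noteq> 0" for x
        using that by (auto simp: field_simps)
      then have *: "(S x * x) ^ (2 ^ i) = x" for x
        by (cases "x = 0") (auto simp: zero_power)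
      have "(S (x + 1) * (x + 1)) ^ (2 ^ i) = (S x * x + 1) ^ (2 ^ i)" for x
        by (simp only: * frobenius_add power_one)
      then have "S (x + 1) * (x + 1) = S x * x + 1" for x
        by (simp only: frobenius_inj)
      moreover have "S x + x = S (x + 1) * (x + 1) + (S x * x + 1)" for x
        by (simp add: expand)
      ultimately have S: "S x = x" for x
        by (metis add_self add_eq_0)
      have "h * h = h" using S_S[of h] by (simp only: S)
      then show False using h by simp
    qed
    then obtain k where "k \<noteq> 0" "(S k * k) ^ (2 ^ i) / k \<noteq> 1" by blast
    then show ?thesis
      by (intro sum_nonzero_multiplicative[where h = k]) (auto simp: power_mult_distrib)
  qed
  moreover have "(\<Sum>x\<in>UNIV - {0}. Tr (S x * x) / x)
      = (\<Sum>i<2*e+1. \<Sum>x\<in>UNIV - {0::'a}. (S x * x) ^ (2 ^ i) / x)"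
    by (subst sum.swap) (simp only: Tr_def sum_divide_distrib)
  ultimately show ?thesis by simp
qed

text \<open>Counting shows that otherwise \<open>Tr (1 / g) + Tr (S g * g) = 1\<close> for all \<open>g \<noteq> 0, 1\<close>; the two
  weighted sums above exclude this.\<close>

lemma ex_common_Tr_0:
  obtains g where "g \<noteq> 0" "g \<noteq> 1" "Tr (1 / g) = 0" "Tr (S g * g) = 0"
proof (rule ccontr)
  assume no: "\<not> thesis"
  define Z1 where "Z1 = {g. Tr (1 / g) = 0}"
  define Z2 where "Z2 = {g. Tr (S g * g) = 0}"
  \<comment> \<open>By the convention 1 / 0 = 0 the element 0 belongs to \<open>Z1\<close>, and
    inversion permutes the whole field.\<close>
  have "bij_betw (\<lambda>g. 1 / g) Z1 {x. Tr x = 0}"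
    by (rule bij_betw_byWitness[where f' = "\<lambda>g. 1 / g"]) (auto simp: Z1_def)
  then have c1: "2 * card Z1 = CARD('a)" using card_Tr_0 by (simp add: bij_betw_same_card)
  \<comment> \<open>The exponent \<sigma> + 1 is inverted by \<sigma> - 1, because \<sigma>^2 acts
    as squaring and thus \<sigma>^2 - 1 as the identity.\<close>
  have "bij_betw (\<lambda>g. S g * g) Z2 {x. Tr x = 0}"
    by (rule bij_betw_byWitness[where f' = "\<lambda>x. S x / x"]) (auto simp: Z2_def)
  then have c2: "2 * card Z2 = CARD('a)" using card_Tr_0 by (simp add: bij_betw_same_card)
  have "Z1 \<inter> Z2 = {0}"
    using no that by (fastforce simp: Z1_def Z2_def)
  then have "card (Z1 \<union> Z2) = card Z1 + card Z2 - 1"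
    using card_Un_Int[of Z1 Z2] by simp
  moreover have "card (UNIV - {1::'a}) = CARD('a) - 1" by simp
  ultimately have "card (Z1 \<union> Z2) = card (UNIV - {1::'a})"
    using c1 c2 by linarith
  \<comment> \<open>Each set is half of the field and they share only 0, so the union misses one
    element; it is 1, since Tr 1 = 1.\<close>
  moreover have "Z1 \<union> Z2 \<subseteq> UNIV - {1}" by (auto simp: Z1_def Z2_def)
  ultimately have U: "Z1 \<union> Z2 = UNIV - {1}"
    by (intro card_subset_eq) auto
  have val: "Tr (1 / x) + Tr (S x * x) + 1 = (if x = 1 then 1 else 0)" if "x \<noteq> 0" for x
  proof (cases "x = 1")
    case False
    then have "x \<in> Z1 \<union> Z2" "x \<notin> Z1 \<inter> Z2" using U \<open>Z1 \<inter> Z2 = {0}\<close> that by auto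
    then show ?thesis using Tr_cases[of "1 / x"] Tr_cases[of "S x * x"] False
      by (auto simp: Z1_def Z2_def add_self)
  qed (simp add: add_self)
  obtain h :: 'a where h: "h \<noteq> 0" "h \<noteq> 1" using ex_not_0_1 by blast
  \<comment> \<open>The weight 1 / x makes the constant 1 contribute 0 as well. Without it the
    constant would contribute q - 1 = 1, in agreement with the single term at x = 1.\<close>
  have "(\<Sum>x\<in>UNIV - {0::'a}. 1 / x) = 0"
    by (rule sum_nonzero_multiplicative[where h = h]) (use h in auto)
  then have "(\<Sum>x\<in>UNIV - {0}. (Tr (1 / x) + Tr (S x * x) + 1) / x) = 0"
    using sum_inverse_Tr sum_Tr_S by (simp add: add_divide_distrib sum.distrib)
  moreover have "(\<Sum>x\<in>UNIV - {0}. (Tr (1 / x) + Tr (S x * x) + 1) / x)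
      = (\<Sum>x\<in>UNIV - {0::'a}. if x = 1 then 1 else 0)"
    by (rule sum.cong) (auto simp: val)
  ultimately show False by simp
qed

text \<open>The hypotheses make S n = n^2 + X^2 + X and S X polynomials in n and X, so clearing the
  denominator S n n^2 leaves a polynomial identity. They are invariant under X \<mapsto> X + 1,
  which swaps the two coordinates.\<close>

lemma f_eq_1_of_param:
  assumes n: "n = w + R w + w * R w" "n \<noteq> 0"
    and X1: "X\<^sup>2 + X = w * (1 + w) * (1 + S w)"
    and X2: "S X = X\<^sup>2 + n\<^sup>2 + 1"
  shows "f ((X + 1) / n) (X / n) = 1"
proof -
  define t where "t = w * (1 + w) * (1 + S w)"
  have n2: "n\<^sup>2 = w\<^sup>2 + S w + w\<^sup>2 * S w"
    unfolding n(1) by (simp only: square_add power_mult_distrib) (simp add: power2_eq_square R_R)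
  have "S n = S w + w + S w * w" by (simp add: n)
  also have "\<dots> = n\<^sup>2 + t" unfolding n2 t_def by (simp add: expand)
  finally have Sn: "S n = n\<^sup>2 + (X\<^sup>2 + X)" by (simp only: t_def X1)
  have "S n \<noteq> 0" using n(2) by (simp only: S_eq_0 not_False_eq_True)
  have "f ((X + 1) / n) (X / n) * (S n * n\<^sup>2) =
      (S X + 1) * (X + 1)\<^sup>2 + S X * n\<^sup>2 + (X + 1) * X * S n"
    using n(2) \<open>S n \<noteq> 0\<close> by (simp add: f_def field_simps power2_eq_square)
  also have "\<dots> = S n * n\<^sup>2"
    unfolding X2 Sn by (simp add: expand)
  finally show ?thesis using n(2) \<open>S n \<noteq> 0\<close> by simp
qed

text \<open>Oval and conic are symmetric in \<open>u\<close> and \<open>v\<close>. The equations determine \<open>u + v = 1 / n\<close> and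
  \<open>u * v\<close>; here \<open>X = v / (u + v)\<close> is an explicit solution of the resulting Artin--Schreier equation,
  and the trace condition decides which ordering of the two solutions lies on the oval.\<close>

lemma oval_points_on_conic:
  assumes w: "w \<noteq> 0" "w \<noteq> 1" "Tr (S w * w) = 1"
  obtains u v where "u \<noteq> v" "u \<noteq> 0" "v \<noteq> 0" "f u v = 1" "f v u = 1"
    "u\<^sup>2 + (1 + w) / w * (u * v) + v\<^sup>2 = 1"
proof -
  define y where "y = S w * w"
  \<comment> \<open>The first e + 1 of the 2 e + 1 terms of the trace of y. Thus Y^2 + Y telescopes
    to y + S y, while S Y supplies the other terms and repeats y, so that S Y + Y = Tr y +
    y.\<close>
  define Y where "Y = (\<Sum>i<e+1. y ^ (2 ^ i))"
  define X where "X = w + Y"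
  \<comment> \<open>Put b = (1 + w) / w. Substituting the conic into
    \<open>conic_of_intersection\<close> with a = d = c = 1 yields a product of two factors in u +
    v: one gives u + v = 1, the other u + v = 1 / n.\<close>
  define n where "n = w + R w + w * R w"
  have Y2: "Y\<^sup>2 + Y = y + S y"
  proof -
    have "Y\<^sup>2 + y = (\<Sum>i<e+1. y ^ (2 ^ Suc i)) + y"
      using frobenius_sum[of "\<lambda>i. y ^ 2 ^ i" "{..<e+1}" 1]
      by (simp add: Y_def mult.commute flip: power_mult)
    also have "\<dots> = (\<Sum>i<Suc (e+1). y ^ (2 ^ i))"
      by (simp only: sum.lessThan_Suc_shift) simp
    also have "\<dots> = Y + S y" by (simp add: Y_def S_def)
    finally have "Y\<^sup>2 + y + y + Y = Y + S y + y + Y" by simp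
    then show ?thesis by (simp add: expand)
  qed
  have SY: "S Y = 1 + Y + y"
  proof -
    have "S Y = (\<Sum>i<e+1. y ^ (2 ^ (i + (e + 1))))"
      unfolding Y_def S_def frobenius_sum
      by (simp add: power_add mult.commute mult.left_commute flip: power_mult)
    also have "\<dots> = (\<Sum>i=e+1..<2*e+2. y ^ (2 ^ i))"
      by (rule sum.reindex_bij_witness[where i = "\<lambda>i. i - (e+1)" and j = "\<lambda>i. i + (e+1)"]) auto
    also have "\<dots> + Y = (\<Sum>i<2*e+2. y ^ (2 ^ i))"
      unfolding Y_def lessThan_atLeast0 add.commute[of "sum _ {e+1..<2*e+2}"]
      by (rule sum.atLeastLessThan_concat) auto
    also have "\<dots> = Tr y + y" using power_q[of y] by (simp add: Tr_def)
    finally have "S Y + Y + Y = 1 + y + Y" using w by (simp add: y_def)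
    then show ?thesis by (simp add: expand)
  qed
  have n2: "n\<^sup>2 = w\<^sup>2 + S w + w\<^sup>2 * S w"
    unfolding n_def by (simp only: square_add power_mult_distrib) (simp add: power2_eq_square R_R)
  have n0: "n \<noteq> 0"
  proof
    assume "n = 0"
    then have "w\<^sup>2 + S w + w\<^sup>2 * S w = 0" using n2 by simp
    \<comment> \<open>Divided by w^2 S w, the square of n takes the form S z + z + 1 with z = 1 / S
      w, which never vanishes.\<close>
    moreover have "S (1 / S w) + 1 / S w + 1 = (w\<^sup>2 + S w + w\<^sup>2 * S w) / (w\<^sup>2 * S w)"
      using w by (simp add: field_simps power2_eq_square)
    ultimately have "S (1 / S w) + 1 / S w + 1 = 0" by simp
    then show False using S_ne_add_1 by blast
  qed
  have X1: "X\<^sup>2 + X = w * (1 + w) * (1 + S w)"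
  proof -
    have "X\<^sup>2 + X = w\<^sup>2 + w + (Y\<^sup>2 + Y)" by (simp add: X_def square_add add_ac)
    also have "\<dots> = w * (1 + w) * (1 + S w)" unfolding Y2 by (simp add: y_def expand)
    finally show ?thesis .
  qed
  have X2: "S X = X\<^sup>2 + n\<^sup>2 + 1"
  proof -
    have "S X + X\<^sup>2 = S w + w\<^sup>2 + 1 + y + (Y\<^sup>2 + Y)" by (simp add: X_def SY square_add add_ac)
    also have "\<dots> = n\<^sup>2 + 1" unfolding Y2 n2 by (simp add: y_def expand)
    finally have "S X + X\<^sup>2 + X\<^sup>2 = n\<^sup>2 + 1 + X\<^sup>2" by simp
    then show ?thesis by (simp add: expand)
  qed
  have w1: "1 + w \<noteq> 0" "1 + S w \<noteq> 0"
    using w S_inj[of w 1] by (auto simp: add_eq_0)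
  then have "X\<^sup>2 + X \<noteq> 0" using w X1 by simp
  then have X0: "X \<noteq> 0" "X + 1 \<noteq> 0" by (auto simp: power2_eq_square add_eq_0 add_self)
  have f1: "f ((X + 1) / n) (X / n) = 1"
    by (rule f_eq_1_of_param[OF n_def n0 X1 X2])
  have X1': "(X + 1)\<^sup>2 + (X + 1) = w * (1 + w) * (1 + S w)"
    using X1 by (simp add: expand)
  have X2': "S (X + 1) = (X + 1)\<^sup>2 + n\<^sup>2 + 1"
    using X2 by (simp add: expand)
  have f2: "f (X / n) ((X + 1) / n) = 1"
    using f_eq_1_of_param[OF n_def n0 X1' X2'] by (simp add: expand)
  have "((X + 1) / n)\<^sup>2 + (1 + w) / w * ((X + 1) / n * (X / n)) + (X / n)\<^sup>2
    = (1 + (1 + w) / w * (X\<^sup>2 + X)) / n\<^sup>2"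
    using n0 w by (simp add: power_divide square_add power2_eq_square field_simps two_eq_0)
  also have "1 + (1 + w) / w * (X\<^sup>2 + X) = n\<^sup>2"
  proof -
    have "(1 + w) / w * (w * (1 + w) * (1 + S w)) = (1 + w) * ((1 + w) * (1 + S w))"
      using w by simp
    then show ?thesis unfolding X1 n2 by (simp add: expand)
  qed
  finally have "((X + 1) / n)\<^sup>2 + (1 + w) / w * ((X + 1) / n * (X / n)) + (X / n)\<^sup>2 = 1"
    using n0 by simp
  then show ?thesis
    by (intro that[of "(X + 1) / n" "X / n"]) (use f1 f2 n0 X0 in auto)
qed

text \<open>The four points are \<open>(1, 0)\<close>, \<open>(0, 1)\<close> and the two of the previous lemma.\<close>

lemma ex_conic_four_points:
  obtains b where "b \<noteq> 0" "b \<noteq> 1" "\<forall>x. x\<^sup>2 + x \<noteq> 1 / b\<^sup>2"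
    "card {(u, v). u\<^sup>2 + b * (u * v) + v\<^sup>2 = 1 \<and> f u v = 1} = 4"
proof -
  obtain g where g: "g \<noteq> 0" "g \<noteq> 1" "Tr (1 / g) = 0" "Tr (S g * g) = 0"
    by (rule ex_common_Tr_0)
  \<comment> \<open>In terms of g = 1 + w the two requirements, Tr (1 / b^2) = 1 for an anisotropic
    form and Tr (S w w) = 1 for the two extra points, become Tr (1 / g) = 0 and Tr (S g g) =
    0.\<close>
  define w where "w = 1 + g"
  have w: "w \<noteq> 0" "w \<noteq> 1" using g by (auto simp: w_def add_eq_0)
  have gw: "g = 1 + w" by (simp add: w_def add_self_left)
  define b where "b = (1 + w) / w"
  have b: "b \<noteq> 0" "b \<noteq> 1" using g w by (auto simp: b_def field_simps gw add_eq_0)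
  have "S w * w = S g * g + (S g + g) + 1" by (simp add: w_def expand)
  then have "Tr (S w * w) = 1" using g by (simp add: Tr_add add_self)
  then obtain u v where uv: "u \<noteq> v" "u \<noteq> 0" "v \<noteq> 0" "f u v = 1" "f v u = 1"
    "u\<^sup>2 + b * (u * v) + v\<^sup>2 = 1"
    unfolding b_def using oval_points_on_conic[OF w] by metis
  have "1 / b = w / g" by (simp add: b_def gw)
  also have "\<dots> = 1 + 1 / g" using g by (simp add: w_def add_divide_distrib)
  finally have "Tr (1 / b\<^sup>2) = 1"
    using g by (metis Tr_add Tr_1 Tr_frobenius power_divide power_one add_0_right)
  then have irr: "x\<^sup>2 + x \<noteq> 1 / b\<^sup>2" for x
    by (intro no_artin_schreier_root) simp
  let ?A = "{(u, v). u\<^sup>2 + b * (u * v) + v\<^sup>2 = 1 \<and> f u v = 1}"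
  have "{(1, 0), (0, 1), (u, v), (v, u)} \<subseteq> ?A"
    using uv by (auto simp: f_def ac_simps)
  then have "card {(1, 0), (0, 1), (u, v), (v, u)} \<le> card ?A"
    by (rule card_mono[rotated]) simp
  moreover have "card {(1, 0), (0, 1), (u, v), (v, u)} = 4"
    using uv by (auto simp: card_insert_if)
  moreover have "card ?A \<le> 4"
    using card_conic_inter_oval[of b 1 1 1 1] b by simp
  ultimately show ?thesis using that b irr by force
qed

text \<open>For b = 1 the combined equation splits into the lines u = v and u + v = 1; the first
  contributes (1, 1), the second the other two points.\<close>

lemma conic_three_points:
  "{(u, v). u\<^sup>2 + 1 * (u * v) + v\<^sup>2 = 1 \<and> f u v = 1} = {(1, 0), (0, 1), (1, 1)}"
proof -
  have "(u, v) \<in> {(1, 0), (0, 1), (1, 1)}" if Q: "u\<^sup>2 + u * v + v\<^sup>2 = 1" and f: "f u v = 1" for u v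
  proof -
    have "v\<^sup>2 + 1 + (v + 1) * (1 + u) + (1 + u\<^sup>2) = 1 + u * v"
      using conic_of_intersection[of 1 u 1 v 1 1] Q f by simp
    then have *: "(u + v) * (u + v + 1) = 0"
      by (simp add: expand)
    show ?thesis
    proof (cases "u = v")
      case True
      then have "u\<^sup>2 = 1\<^sup>2" using Q by (simp add: expand)
      then show ?thesis using True by (simp only: square_inj) simp
    next
      case False
      then have "u + v + 1 = 0" using * by (metis add_eq_0 mult_eq_0_iff)
      then have "u + v = 1" by (simp only: add_eq_0)
      then have v: "v = u + 1" by (metis add_self_left)
      then have "u * (u + 1) = 0" using Q by (simp add: expand)
      then show ?thesis using v two_eq_0 by (auto simp: add_eq_0)
    qed
  qed
  then show ?thesis by (auto simp: f_def add_self expand)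
qed

text \<open>Two irreducible Artin--Schreier constants have a reducible sum; this yields \<open>s\<close>, the
  parameter by which the choice of a point outside the unital changes the norm form.\<close>

lemma ex_rescaling:
  assumes D: "D \<noteq> 0" and B: "B \<noteq> 0" and irr: "\<And>x. x\<^sup>2 + x \<noteq> N * B / D\<^sup>2"
    and b: "b \<noteq> 0" and irrb: "\<And>x. x\<^sup>2 + x \<noteq> 1 / b\<^sup>2"
  obtains s l k where "l \<noteq> 0" "k \<noteq> 0"
    "\<And>u v. (N + D * s + B * s\<^sup>2) * (l * u)\<^sup>2 + D * ((l * u) * (S l * l * v)) + B * (S l * l * v)\<^sup>2
      = k * (u\<^sup>2 + b * (u * v) + v\<^sup>2)"
proof -
  obtain x where x: "x\<^sup>2 + x = N * B / D\<^sup>2 + 1 / b\<^sup>2"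
    by (rule artin_schreier_sum[OF irr irrb])
  \<comment> \<open>The form with coefficients A, D, B has the Artin-Schreier invariant A B / D^2.
    Replacing N by N + D s + B s^2 adds x^2 + x to it and thereby makes it 1 / b^2.\<close>
  define s where "s = D * x / B"
  \<comment> \<open>With S l = D / (B b) the rescaling makes the coefficients of u^2 and v^2
    equal.\<close>
  define l where "l = R (D / (B * b))"
  define A where "A = D\<^sup>2 / (B * b\<^sup>2)"
  have "(D\<^sup>2 / B) * (x\<^sup>2 + x) = D * s + B * s\<^sup>2"
    using B by (simp add: s_def field_simps power2_eq_square)
  moreover have "(D\<^sup>2 / B) * (x\<^sup>2 + x) = N + A"
    unfolding x using B D by (simp add: A_def distrib_left)
  ultimately have "N + D * s + B * s\<^sup>2 = A"
    by (simp add: add.assoc add_self_left)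
  moreover have Sl: "S l = D / (B * b)" by (simp add: l_def)
  have l: "l \<noteq> 0" using D B b by (simp add: l_def)
  have A: "A \<noteq> 0" using D B b by (simp add: A_def)
  moreover have "A * (l * u)\<^sup>2 + D * ((l * u) * (S l * l * v)) + B * (S l * l * v)\<^sup>2
      = (A * l\<^sup>2) * (u\<^sup>2 + b * (u * v) + v\<^sup>2)" for u v
    unfolding Sl A_def using B b by (simp add: field_simps power2_eq_square)
  ultimately show ?thesis using that[of l "A * l\<^sup>2" s] l by simp
qed

text \<open>The diagonal elements of the Suzuki group; they turn f u v = c with c = S l l^2 into f u
  v = 1.\<close>

lemma f_rescale: "f (l * u) (S l * l * v) = S l * l\<^sup>2 * f u v"
  by (simp add: f_def expand)

end

section \<open>The unital in affine coordinates\<close>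

locale tits_extension = tits_field tp e
  for tp :: "'a::{field,finite} itself" and e :: nat +
  fixes \<iota> :: "'a \<Rightarrow> 'b::{field,finite}"
  assumes iota_1 [simp]: "\<iota> 1 = 1"
    and iota_add: "\<And>x y. \<iota> (x + y) = \<iota> x + \<iota> y"
    and iota_mult: "\<And>x y. \<iota> (x * y) = \<iota> x * \<iota> y"
    and card_ext: "CARD('b) = CARD('a) ^ 2"
begin

sublocale B: char2 "TYPE('b)"
  by unfold_locales (rule finite_field_two_eq_0[where n = "2 * (2 * e + 1)"],
    simp only: card_ext card_field power_even_eq)

lemma iota_0 [simp]: "\<iota> 0 = 0"
  using iota_add[of 0 0] by (metis add_0 add_right_cancel)

lemma iota_eq_0 [simp]: "\<iota> x = 0 \<longleftrightarrow> x = 0"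
proof
  assume "\<iota> x = 0"
  then have "\<iota> (x * (1 / x)) = 0" by (simp only: iota_mult) simp
  then show "x = 0" by (cases "x = 0") auto
qed simp

lemma iota_inj [simp]: "\<iota> x = \<iota> y \<longleftrightarrow> x = y"
proof
  assume "\<iota> x = \<iota> y"
  then have "\<iota> (x + y) = 0" by (simp add: iota_add B.add_self)
  then show "x = y" by (simp add: add_eq_0)
qed simp

lemma iota_power: "\<iota> (x ^ n) = \<iota> x ^ n"
  by (induction n) (auto simp: iota_mult)

lemma iota_divide: "\<iota> (x / y) = \<iota> x / \<iota> y"
proof (cases "y = 0")
  case False
  then have "\<iota> (x / y) * \<iota> y = \<iota> x" by (simp flip: iota_mult)
  then show ?thesis using False by (simp add: eq_divide_eq)
qed simp

section \<open>Conjugation, relative trace and norm of the quadratic extension\<close>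

definition cj :: "'b \<Rightarrow> 'b" where "cj x = x ^ CARD('a)"

lemma cj_add [simp]: "cj (x + y) = cj x + cj y"
  unfolding cj_def card_field by (rule B.frobenius_add)
lemma cj_mult [simp]: "cj (x * y) = cj x * cj y"
  unfolding cj_def by (rule power_mult_distrib)
lemma cj_divide [simp]: "cj (x / y) = cj x / cj y"
  unfolding cj_def by (rule power_divide)
lemma cj_cj [simp]: "cj (cj x) = x"
  using finite_field_power_card[of x] by (simp add: cj_def card_ext power2_eq_square flip: power_mult)
lemma cj_iota [simp]: "cj (\<iota> x) = \<iota> x"
  by (metis cj_def finite_field_power_card iota_power)
lemma cj_eq_0 [simp]: "cj x = 0 \<longleftrightarrow> x = 0"
  by (auto simp: cj_def)
lemma cj_0 [simp]: "cj 0 = 0"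
  by simp

text \<open>The fixed elements are roots of X^q - X, so there are at most q of them, and the range
  of \<iota> already provides q.\<close>

lemma cj_fixed:
  assumes "cj x = x"
  obtains a where "x = \<iota> a"
proof -
  let ?p = "monom 1 CARD('a) - monom 1 1 :: 'b poly"
  have q: "CARD('a) > 1" using card_field_ge by simp
  have p: "?p \<noteq> 0"
    using q by (metis coeff_monom diff_eq_diff_eq eq_iff_diff_eq_0 less_irrefl monom_eq_iff' zero_neq_one)
  have roots: "{x. poly ?p x = 0} = {x. cj x = x}"
    by (auto simp: poly_monom cj_def)
  have "card {x. cj x = x} \<le> degree ?p"
    using card_poly_roots_bound[OF p] roots by simp
  also have "degree ?p \<le> CARD('a)"
    by (rule degree_diff_le) (use q in \<open>auto simp: degree_monom_eq\<close>)
  also have "CARD('a) = card (range \<iota>)"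
    by (rule card_image[symmetric]) (auto intro: injI)
  finally have "range \<iota> = {x. cj x = x}"
    by (intro card_seteq) auto
  then show ?thesis using assms that by blast
qed

text \<open>Relative trace and norm keep their values in the large field; \<open>tr_iota\<close> and
  \<open>nm_iota\<close> bring them back to \<open>'a\<close>.\<close>

definition tr :: "'b \<Rightarrow> 'b" where "tr x = x + cj x"
definition nm :: "'b \<Rightarrow> 'b" where "nm x = x * cj x"

lemma tr_add: "tr (x + y) = tr x + tr y" by (simp add: tr_def)
lemma tr_iota_mult: "tr (\<iota> a * x) = \<iota> a * tr x" by (simp add: tr_def distrib_left)
lemma tr_cj: "tr (cj x) = tr x" by (simp add: tr_def add.commute)
lemma nm_eq_0 [simp]: "nm x = 0 \<longleftrightarrow> x = 0" by (simp add: nm_def)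

lemma tr_nm: "tr (nm x) = 0"
  by (simp add: tr_def nm_def mult.commute B.add_self)

lemma tr_iota: obtains a where "tr x = \<iota> a"
  by (rule cj_fixed[of "tr x"]) (auto simp: tr_def add.commute)

lemma nm_iota: obtains a where "nm x = \<iota> a"
  by (rule cj_fixed[of "nm x"]) (auto simp: nm_def mult.commute)

end

text \<open>The assumption is that the determinant of \<alpha>, \<beta> and their conjugates does
  not vanish, so \<alpha>, \<beta> form a basis over the small field.\<close>

locale tits_plane = tits_extension tp e \<iota>
  for tp :: "'a::{field,finite} itself" and e :: nat and \<iota> :: "'a \<Rightarrow> 'b::{field,finite}" +
  fixes \<alpha> \<beta> :: 'b
  assumes independent: "\<alpha> * \<beta> ^ CARD('a) + \<beta> * \<alpha> ^ CARD('a) \<noteq> 0"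
begin

definition D :: 'b where "D = \<alpha> * cj \<beta> + \<beta> * cj \<alpha>"

lemma D_nonzero [simp]: "D \<noteq> 0"
  using independent by (simp add: D_def cj_def)

lemma cj_D [simp]: "cj D = D"
  by (simp add: D_def ac_simps)

lemma tr_divide_D: "tr (x / D) = tr x / D"
  by (simp add: tr_def add_divide_distrib)

definition d :: 'a where "d = (SOME a. D = \<iota> a)"

lemma iota_d: "\<iota> d = D"
proof -
  have "\<exists>a. D = \<iota> a" using cj_fixed[OF cj_D] by blast
  then show ?thesis unfolding d_def by (metis (mono_tags, lifting) someI_ex)
qed

lemma d_nonzero: "d \<noteq> 0"
  using iota_d by (metis D_nonzero iota_0)

definition pt :: "'a \<Rightarrow> 'a \<Rightarrow> 'b" where "pt s t = \<iota> s * \<alpha> + \<iota> t * \<beta>"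

lemma pt_add: "pt (s + s') (t + t') = pt s t + pt s' t'"
  by (simp add: pt_def iota_add algebra_simps)

lemma pt_eq_0: "pt s t = 0 \<longleftrightarrow> s = 0 \<and> t = 0"
proof
  assume *: "pt s t = 0"
  have "\<iota> s * D = pt s t * cj \<beta> + cj (pt s t) * \<beta>" "\<iota> t * D = pt s t * cj \<alpha> + cj (pt s t) * \<alpha>"
    by (simp_all add: pt_def D_def B.expand)
  then have "\<iota> s * D = 0" "\<iota> t * D = 0" unfolding * by simp_all
  then show "s = 0 \<and> t = 0" by simp
qed (simp add: pt_def)

lemma pt_inj: "pt s t = pt s' t' \<longleftrightarrow> s = s' \<and> t = t'"
proof
  assume "pt s t = pt s' t'"
  then have "pt (s + s') (t + t') = 0" by (simp add: pt_add B.add_self)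
  then show "s = s' \<and> t = t'" by (simp add: pt_eq_0 add_eq_0)
qed simp

text \<open>The basis dual to \<alpha>, \<beta> under the trace form is conj(\<beta>) / D,
  conj(\<alpha>) / D.\<close>

lemma dual_basis: "x = (tr (x * \<beta>) * cj \<alpha> + tr (x * \<alpha>) * cj \<beta>) / D"
proof -
  have "tr (x * \<beta>) * cj \<alpha> + tr (x * \<alpha>) * cj \<beta> = x * D"
    by (simp add: tr_def D_def B.expand)
  then show ?thesis by simp
qed

lemma pt_surj: obtains s t where "x = pt s t"
proof -
  obtain s where s: "tr (x * cj \<beta>) = \<iota> s" by (rule tr_iota)
  obtain t where t: "tr (x * cj \<alpha>) = \<iota> t" by (rule tr_iota)
  have "\<iota> s * \<alpha> + \<iota> t * \<beta> = x * D"
    unfolding s[symmetric] t[symmetric] by (simp add: tr_def D_def B.expand)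
  then have "x = pt (s / d) (t / d)"
    by (simp add: pt_def iota_divide iota_d field_simps)
  then show ?thesis by (rule that)
qed

lemma tr_surj: obtains y where "tr y = \<iota> a"
proof -
  have "tr (\<iota> a * (\<alpha> * cj \<beta> / D)) = \<iota> a * ((\<alpha> * cj \<beta> + \<beta> * cj \<alpha>) / D)"
    unfolding tr_iota_mult by (simp add: tr_def add_divide_distrib ac_simps)
  also have "\<dots> = \<iota> a" by (simp flip: D_def)
  finally show ?thesis by (rule that)
qed

section \<open>The affine part of the unital, its tangents and the feet\<close>

definition UU :: "('b \<times> 'b) set" where
  "UU = {(x, y). \<exists>s t. x = pt s t \<and> tr y = \<iota> (f s t)}"

definition aline :: "'b \<Rightarrow> 'b \<Rightarrow> ('b \<times> 'b) set" where
  "aline m n = {(x, y). y = m * x + n}"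

text \<open>Vertical lines can be left out: each contains an affine point of the unital besides the
  point at infinity of the unital, so none is tangent.\<close>

definition afeet :: "'b \<times> 'b \<Rightarrow> ('b \<times> 'b) set" where
  "afeet P = {X. \<exists>m n. P \<in> aline m n \<and> X \<in> aline m n \<and> aline m n \<inter> UU = {X}}"

lemma UU_iff: "(pt s t, y) \<in> UU \<longleftrightarrow> tr y = \<iota> (f s t)"
  by (auto simp: UU_def pt_inj)

lemma ex_UU: obtains y where "(x, y) \<in> UU"
  using pt_surj[of x] tr_surj UU_iff by metis

lemma aline_slope:
  assumes "(x0, y0) \<in> aline m n"
  shows "(x, y) \<in> aline m n \<longleftrightarrow> y = y0 + m * (x + x0)"
  using assms by (auto simp: aline_def B.expand)

text \<open>With the point moved to the origin by \<open>f_translate\<close>, the points of the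
  unital on the line correspond to the solutions of f u v = p u + r v. By \<open>f_eq_0_iff\<close>
  and \<open>f_eq_linear\<close> the origin is the only one exactly if p = r = 0, and this condition
  determines the slope by means of the dual basis.\<close>

lemma aline_inter_UU_eq_single:
  assumes X: "(pt s0 t0, y0) \<in> UU" "(pt s0 t0, y0) \<in> aline m n"
  shows "aline m n \<inter> UU = {(pt s0 t0, y0)} \<longleftrightarrow> m = cj (pt s0 t0) / D"
proof -
  obtain m1 where m1: "tr (m * \<alpha>) = \<iota> m1" by (rule tr_iota)
  obtain m2 where m2: "tr (m * \<beta>) = \<iota> m2" by (rule tr_iota)
  define p where "p = m1 + t0 + (m2 + s0) * S s0"
  define r where "r = m2 + s0"
  have y0: "tr y0 = \<iota> (f s0 t0)" using X by (simp add: UU_iff)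
  have tr_m: "tr (m * pt u v) = \<iota> (m1 * u + m2 * v)" for u v
  proof -
    have "tr (m * pt u v) = tr (\<iota> u * (m * \<alpha>)) + tr (\<iota> v * (m * \<beta>))"
      by (simp add: pt_def tr_add[symmetric] algebra_simps)
    also have "\<dots> = \<iota> u * \<iota> m1 + \<iota> v * \<iota> m2" by (simp only: tr_iota_mult m1 m2)
    finally show ?thesis by (simp add: iota_add iota_mult mult.commute)
  qed
  have meet: "(pt (s0 + u) (t0 + (v + S s0 * u)), y) \<in> aline m n \<inter> UU \<longleftrightarrow>
      y = y0 + m * pt u (v + S s0 * u) \<and> f u v = p * u + r * v" for u v y
  proof -
    define s where "s = s0 + u"
    define t where "t = t0 + (v + S s0 * u)"
    have uv: "u = s + s0" "v = t + t0 + S s0 * (s + s0)" by (simp_all add: s_def t_def expand)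
    have dir: "pt s t + pt s0 t0 = pt u (v + S s0 * u)"
      by (simp add: s_def t_def pt_add B.expand)
    have F: "f u v = f s t + f s0 t0 + t0 * s + s0 * t"
      unfolding uv by (rule f_translate[symmetric])
    have "tr (y0 + m * pt u (v + S s0 * u)) = \<iota> (f s t) \<longleftrightarrow>
        f s0 t0 + (m1 * u + m2 * (v + S s0 * u)) = f s t"
      by (simp add: tr_add y0 tr_m iota_add[symmetric])
    also have "\<dots> \<longleftrightarrow> f s0 t0 + (m1 * u + m2 * (v + S s0 * u)) + f s t = 0"
      by (simp only: add_eq_0)
    also have "f s0 t0 + (m1 * u + m2 * (v + S s0 * u)) + f s t = f u v + (p * u + r * v)"
      unfolding F p_def r_def by (simp add: s_def t_def expand)
    also have "\<dots> = 0 \<longleftrightarrow> f u v = p * u + r * v"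
      by (simp only: add_eq_0)
    finally show ?thesis
      using aline_slope[OF X(2), of "pt s t" y] UU_iff[of s t y]
      by (auto simp: dir simp flip: s_def t_def)
  qed
  have mD: "m = (\<iota> m2 * cj \<alpha> + \<iota> m1 * cj \<beta>) / D"
    using dual_basis[of m] by (simp add: m1 m2)
  have slope: "m = cj (pt s0 t0) / D \<longleftrightarrow> p = 0 \<and> r = 0"
  proof
    assume "p = 0 \<and> r = 0"
    then have "m2 = s0" "m1 = t0" by (auto simp: p_def r_def add_eq_0 two_eq_0)
    then show "m = cj (pt s0 t0) / D" using mD by (simp add: pt_def)
  next
    assume m: "m = cj (pt s0 t0) / D"
    have "tr (cj (pt s0 t0) * \<alpha>) = \<iota> t0 * D" "tr (cj (pt s0 t0) * \<beta>) = \<iota> s0 * D"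
      by (simp_all add: tr_def pt_def D_def B.expand)
    then have "tr (m * \<alpha>) = \<iota> t0" "tr (m * \<beta>) = \<iota> s0"
      unfolding m by (simp_all add: tr_divide_D)
    then have "m1 = t0" "m2 = s0" by (simp_all add: m1 m2)
    then show "p = 0 \<and> r = 0" by (simp add: p_def r_def add_self)
  qed
  show ?thesis
  proof
    assume single: "aline m n \<inter> UU = {(pt s0 t0, y0)}"
    have "p = 0 \<and> r = 0"
    proof (rule ccontr)
      assume "\<not> (p = 0 \<and> r = 0)"
      then obtain u v where uv: "u \<noteq> 0 \<or> v \<noteq> 0" "f u v = p * u + r * v"
        using f_eq_linear by metis
      then have "(pt (s0 + u) (t0 + (v + S s0 * u)), y0 + m * pt u (v + S s0 * u)) = (pt s0 t0, y0)"
        using meet[of u v] single by blast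
      then show False using uv by (auto simp: pt_inj)
    qed
    then show "m = cj (pt s0 t0) / D" using slope by simp
  next
    assume "m = cj (pt s0 t0) / D"
    then have pr: "p = 0" "r = 0" using slope by auto
    have "X = (pt s0 t0, y0)" if "X \<in> aline m n \<inter> UU" for X
    proof -
      obtain x y where xy: "X = (x, y)" by fastforce
      obtain s t where x: "x = pt s t" by (rule pt_surj)
      define u where "u = s + s0"
      define v where "v = t + t0 + S s0 * u"
      have st: "s = s0 + u" "t = t0 + (v + S s0 * u)" by (simp_all add: u_def v_def expand)
      have "y = y0 + m * pt u (v + S s0 * u) \<and> f u v = 0"
        using meet[of u v y] that pr unfolding xy x st by simp
      then have "u = 0" "v = 0" "y = y0" by (auto simp: f_eq_0_iff pt_eq_0)
      then show ?thesis unfolding xy x st by simp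
    qed
    then show "aline m n \<inter> UU = {(pt s0 t0, y0)}" using X by blast
  qed
qed

text \<open>The parameters \<open>u, v\<close> are the coordinates relative to \<open>(sP, tP)\<close> in which, by \<open>f_translate\<close>, the
  section of the ovoid by the polar plane of the point becomes \<open>f u v = c\<close>.\<close>

definition foot :: "'a \<Rightarrow> 'a \<Rightarrow> 'b \<Rightarrow> 'a \<Rightarrow> 'a \<Rightarrow> 'b \<times> 'b" where
  "foot sP tP yP u v = (let x = pt sP tP + pt u (v + S sP * u) in
     (x, yP + cj x / D * (x + pt sP tP)))"

text \<open>The tangent at (x, y) passes through P exactly if y = yP + conj(x) (x + xP) / D. The
  trace annihilates the norm of x and leaves the alternating form s tP + sP t, so membership in the
  unital becomes the equation of the polar plane, rewritten by \<open>f_translate\<close>.\<close>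

lemma afeet_eq:
  assumes P: "(pt sP tP, yP) \<notin> UU" and c: "tr yP + \<iota> (f sP tP) = \<iota> c"
  shows "afeet (pt sP tP, yP) = (\<lambda>(u, v). foot sP tP yP u v) ` {(u, v). f u v = c}"
proof -
  have mem: "(pt s t, y) \<in> afeet (pt sP tP, yP) \<longleftrightarrow>
      y = yP + cj (pt s t) / D * (pt s t + pt sP tP) \<and> tr y = \<iota> (f s t)" for s t y
  proof
    assume "(pt s t, y) \<in> afeet (pt sP tP, yP)"
    then obtain m n where mn: "(pt sP tP, yP) \<in> aline m n" "(pt s t, y) \<in> aline m n"
      "aline m n \<inter> UU = {(pt s t, y)}" by (auto simp: afeet_def)
    then have "(pt s t, y) \<in> UU" by blast
    then have "m = cj (pt s t) / D" "tr y = \<iota> (f s t)"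
      using aline_inter_UU_eq_single mn by (auto simp: UU_iff)
    then show "y = yP + cj (pt s t) / D * (pt s t + pt sP tP) \<and> tr y = \<iota> (f s t)"
      using aline_slope[OF mn(1)] mn(2) by simp
  next
    assume y: "y = yP + cj (pt s t) / D * (pt s t + pt sP tP) \<and> tr y = \<iota> (f s t)"
    define m where "m = cj (pt s t) / D"
    define n where "n = yP + m * pt sP tP"
    have "(pt sP tP, yP) \<in> aline m n" "(pt s t, y) \<in> aline m n"
      using y by (auto simp: aline_def n_def m_def[symmetric] B.expand)
    moreover have "(pt s t, y) \<in> UU" using y by (metis UU_iff)
    ultimately show "(pt s t, y) \<in> afeet (pt sP tP, yP)"
      using aline_inter_UU_eq_single[of s t y m n] m_def unfolding afeet_def by blast
  qed
  have tr_yP: "tr yP = \<iota> (c + f sP tP)"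
    using c by (metis B.add_self_left add.commute iota_add)
  have tr_y: "tr (yP + cj (pt s t) / D * (pt s t + pt sP tP)) = \<iota> (f s t) \<longleftrightarrow>
      f (s + sP) (t + tP + S sP * (s + sP)) = c" for s t
  proof -
    have "tr (cj (pt s t) / D * (pt s t + pt sP tP)) =
        (cj (pt s t) * pt sP tP + pt s t * cj (pt sP tP)) / D"
    proof -
      have "tr (cj (pt s t) * (pt s t + pt sP tP)) = cj (pt s t) * pt sP tP + pt s t * cj (pt sP tP)"
        by (simp add: tr_def B.expand)
      then show ?thesis by (simp add: tr_divide_D)
    qed
    also have "\<dots> = (\<iota> (s * tP + sP * t) * D) / D"
      by (simp add: pt_def D_def iota_add iota_mult B.expand)
    finally have "tr (yP + cj (pt s t) / D * (pt s t + pt sP tP)) = \<iota> (c + f sP tP + (s * tP + sP * t))"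
      using tr_yP by (simp only: tr_add iota_add) simp
    then have "tr (yP + cj (pt s t) / D * (pt s t + pt sP tP)) = \<iota> (f s t) \<longleftrightarrow>
        c + f sP tP + (s * tP + sP * t) = f s t" by simp
    also have "\<dots> \<longleftrightarrow> c + f sP tP + (s * tP + sP * t) + f s t = 0" by (simp only: add_eq_0)
    also have "c + f sP tP + (s * tP + sP * t) + f s t = f (s + sP) (t + tP + S sP * (s + sP)) + c"
      by (subst f_translate[symmetric]) (simp add: expand)
    finally show ?thesis by (simp only: add_eq_0)
  qed
  show ?thesis
  proof (rule set_eqI, rule iffI)
    fix X assume X: "X \<in> afeet (pt sP tP, yP)"
    obtain x y where xy: "X = (x, y)" by fastforce
    obtain s t where x: "x = pt s t" by (rule pt_surj)
    define u where "u = s + sP"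
    define v where "v = t + tP + S sP * u"
    have st: "pt sP tP + pt u (v + S sP * u) = pt s t"
      by (simp add: u_def v_def expand flip: pt_add)
    have "foot sP tP yP u v = X"
      using X mem[of s t y] unfolding xy x by (simp add: foot_def Let_def st)
    moreover have "f u v = c"
    proof -
      have y: "y = yP + cj (pt s t) / D * (pt s t + pt sP tP)" "tr y = \<iota> (f s t)"
        using X mem[of s t y] unfolding xy x by blast+
      then show ?thesis
        using tr_y[of s t] unfolding y(1)[symmetric] u_def v_def by blast
    qed
    ultimately show "X \<in> (\<lambda>(u, v). foot sP tP yP u v) ` {(u, v). f u v = c}" by force
  next
    fix X assume "X \<in> (\<lambda>(u, v). foot sP tP yP u v) ` {(u, v). f u v = c}"
    then obtain u v where X: "X = foot sP tP yP u v" "f u v = c" by auto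
    define s where "s = sP + u"
    define t where "t = tP + (v + S sP * u)"
    have st: "pt sP tP + pt u (v + S sP * u) = pt s t"
      by (simp add: s_def t_def flip: pt_add)
    have "u = s + sP" "v = t + tP + S sP * (s + sP)" by (simp_all add: s_def t_def expand)
    then have "f (s + sP) (t + tP + S sP * (s + sP)) = c" using X by simp
    then show "X \<in> afeet (pt sP tP, yP)"
      using mem[of s t] tr_y[of s t] by (simp add: X foot_def Let_def st)
  qed
qed

lemma foot_inj: "foot sP tP yP u v = foot sP tP yP u' v' \<longleftrightarrow> u = u' \<and> v = v'"
  by (auto simp: foot_def Let_def pt_inj)

lemma fst_foot_inj: "fst (foot sP tP yP u v) = fst (foot sP tP yP u' v') \<longleftrightarrow> u = u' \<and> v = v'"
  by (auto simp: foot_def Let_def pt_inj)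

text \<open>For this slope the terms linear in w = x + xP on the two sides of the incidence
  condition cancel, and only the norm of w is left.\<close>

lemma foot_special_line:
  "foot sP tP yP u v \<in> aline (cj (pt sP tP) / D) k \<longleftrightarrow>
    nm (pt u (v + S sP * u)) = nm (pt sP tP) + D * (yP + k)"
proof -
  define w where "w = pt u (v + S sP * u)"
  define x where "x = pt sP tP"
  have "foot sP tP yP u v \<in> aline (cj x / D) k \<longleftrightarrow>
      yP + cj (x + w) / D * (x + w + x) = cj x / D * (x + w) + k"
    by (simp add: foot_def Let_def aline_def flip: x_def w_def)
  also have "x + w + x = w" by (simp add: B.expand)
  also have "yP + cj (x + w) / D * w = cj x / D * (x + w) + k \<longleftrightarrow>
      D * (yP + cj (x + w) / D * w) = D * (cj x / D * (x + w) + k)"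
    by (simp only: mult_cancel_left D_nonzero simp_thms)
  also have "D * (yP + cj (x + w) / D * w) = D * yP + cj (x + w) * w"
    by (simp add: distrib_left)
  also have "D * (cj x / D * (x + w) + k) = cj x * (x + w) + D * k"
    by (simp add: distrib_left)
  also have "D * yP + cj (x + w) * w = cj x * (x + w) + D * k \<longleftrightarrow>
      D * yP + cj (x + w) * w + (cj x * (x + w) + D * k) = 0"
    by (simp only: B.add_eq_0)
  also have "D * yP + cj (x + w) * w + (cj x * (x + w) + D * k) = nm w + (nm x + D * (yP + k))"
    by (simp add: nm_def B.expand)
  also have "\<dots> = 0 \<longleftrightarrow> nm w = nm x + D * (yP + k)" by (simp only: B.add_eq_0)
  finally show ?thesis by (simp only: x_def w_def)
qed

text \<open>The shear by s comes from \<open>f_translate\<close>, with s = S sP in the applications.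
  It changes only the coefficient of u^2, and this is how the position of P affects the
  conic.\<close>

lemma nm_pt:
  assumes "nm \<alpha> = \<iota> a" "nm \<beta> = \<iota> b"
  shows "nm (pt u (v + s * u)) = \<iota> ((a + d * s + b * s\<^sup>2) * u\<^sup>2 + d * (u * v) + b * v\<^sup>2)"
proof -
  have "nm (pt u (v + s * u)) = \<iota> u * \<iota> u * nm \<alpha> + (\<iota> u * \<iota> v + \<iota> s * \<iota> u * \<iota> u) * D
      + (\<iota> v * \<iota> v + \<iota> s * \<iota> s * \<iota> u * \<iota> u) * nm \<beta>"
    by (simp add: nm_def pt_def D_def iota_add iota_mult B.expand)
  also have "\<dots> = \<iota> ((a + d * s + b * s\<^sup>2) * u\<^sup>2 + d * (u * v) + b * v\<^sup>2)"
    by (simp add: assms iota_d[symmetric] iota_add iota_mult power2_eq_square algebra_simps)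
  finally show ?thesis .
qed

lemma not_UU_constant:
  assumes "(pt sP tP, yP) \<notin> UU"
  obtains c where "tr yP + \<iota> (f sP tP) = \<iota> c" "c \<noteq> 0"
proof -
  obtain a where a: "tr yP = \<iota> a" by (rule tr_iota)
  have "a \<noteq> f sP tP" using assms a by (auto simp: UU_iff)
  then show ?thesis using that[of "a + f sP tP"] a by (simp add: iota_add add_eq_0)
qed

lemma card_afeet_special_line:
  assumes P: "(pt sP tP, yP) \<notin> UU"
  shows "card (afeet (pt sP tP, yP) \<inter> aline (cj (pt sP tP) / D) k) \<le> 4"
proof -
  obtain c where c: "tr yP + \<iota> (f sP tP) = \<iota> c" "c \<noteq> 0" by (rule not_UU_constant[OF P])
  obtain a where a: "nm \<alpha> = \<iota> a" by (rule nm_iota)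
  obtain b where b: "nm \<beta> = \<iota> b" by (rule nm_iota)
  define A where "A = a + d * S sP + b * (S sP)\<^sup>2"
  define Z where "Z = {(u, v). f u v = c \<and> \<iota> (A * u\<^sup>2 + d * (u * v) + b * v\<^sup>2) = nm (pt sP tP) + D * (yP + k)}"
  have eq: "afeet (pt sP tP, yP) \<inter> aline (cj (pt sP tP) / D) k = (\<lambda>(u, v). foot sP tP yP u v) ` Z"
    unfolding afeet_eq[OF P c(1)] using foot_special_line nm_pt[OF a b]
    by (auto simp: Z_def A_def)
  have "card Z \<le> 4"
  \<comment> \<open>The prescribed norm need not lie in the small field. If a foot exists, its own
    norm supplies the value \<open>r\<close>, and r \<noteq> 0 because c \<noteq> 0 excludes u = v =
    0.\<close>
  proof (cases "Z = {}")
    case False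
    then obtain u v where uv: "f u v = c"
      "\<iota> (A * u\<^sup>2 + d * (u * v) + b * v\<^sup>2) = nm (pt sP tP) + D * (yP + k)"
      by (auto simp: Z_def)
    define r where "r = A * u\<^sup>2 + d * (u * v) + b * v\<^sup>2"
    have "nm (pt u (v + S sP * u)) = \<iota> r" using nm_pt[OF a b] by (simp add: r_def A_def)
    moreover have "pt u (v + S sP * u) \<noteq> 0" using uv(1) c(2) by (auto simp: pt_eq_0)
    ultimately have "r \<noteq> 0" by (metis iota_0 nm_eq_0)
    moreover have "Z = {(u, v). A * u\<^sup>2 + d * (u * v) + b * v\<^sup>2 = r \<and> f u v = c}"
      unfolding Z_def uv(2)[symmetric] by (auto simp: r_def)
    ultimately show ?thesis using card_conic_inter_oval[OF d_nonzero c(2)] by simp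
  qed simp
  then show ?thesis unfolding eq using card_image_le[of Z] by (meson finite le_trans)
qed

text \<open>Multiplying the incidence condition by D and taking traces removes the norm of x and
  leaves tr (g x) = const with g = conj(xP) + n D. As g \<noteq> 0, this is a nontrivial linear
  equation in s, t.\<close>

lemma card_afeet_general_line:
  assumes P: "(pt sP tP, yP) \<notin> UU" and n: "n \<noteq> cj (pt sP tP) / D"
  shows "card (afeet (pt sP tP, yP) \<inter> aline n k) \<le> 2"
proof -
  define xP where "xP = pt sP tP"
  obtain c where c: "tr yP + \<iota> (f sP tP) = \<iota> c" "c \<noteq> 0" by (rule not_UU_constant[OF P])
  define g where "g = cj xP + n * D"
  have "g \<noteq> 0"
    using n by (auto simp: g_def xP_def B.add_eq_0 field_simps)
  obtain l where l: "tr (g * \<alpha>) = \<iota> l" by (rule tr_iota)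
  obtain m where m: "tr (g * \<beta>) = \<iota> m" by (rule tr_iota)
  obtain r where r: "tr (D * (k + yP)) = \<iota> r" by (rule tr_iota)
  have lm: "l \<noteq> 0 \<or> m \<noteq> 0"
    using dual_basis[of g] \<open>g \<noteq> 0\<close> by (auto simp: l m)
  define Z where "Z = {(s, t). l * s + m * t = r \<and> f s t = tP * s + sP * t + (c + f sP tP)}"
  have "afeet (pt sP tP, yP) \<inter> aline n k \<subseteq> (\<lambda>(s, t). (pt s t, n * pt s t + k)) ` Z"
  proof
    fix X assume X: "X \<in> afeet (pt sP tP, yP) \<inter> aline n k"
    then obtain u v where uv: "X = foot sP tP yP u v" "f u v = c"
      using afeet_eq[OF P c(1)] by auto
    define s where "s = sP + u"
    define t where "t = tP + (v + S sP * u)"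
    have x: "pt sP tP + pt u (v + S sP * u) = pt s t" by (simp add: s_def t_def pt_add)
    have "X = (pt s t, yP + cj (pt s t) / D * (pt s t + xP))"
      by (simp add: uv foot_def Let_def x xP_def)
    then have Xl: "X = (pt s t, n * pt s t + k)" and
      y: "yP + cj (pt s t) / D * (pt s t + xP) = n * pt s t + k"
      using X by (auto simp: aline_def)
    have "D * (yP + cj (pt s t) / D * (pt s t + xP)) = D * (n * pt s t + k)"
      by (simp only: y)
    moreover have "D * (yP + cj (pt s t) / D * (pt s t + xP)) = D * yP + (nm (pt s t) + cj (pt s t) * xP)"
    proof -
      have "D * (cj (pt s t) / D * (pt s t + xP)) = cj (pt s t) * (pt s t + xP)" by simp
      then show ?thesis by (simp only: distrib_left nm_def mult.commute[of "pt s t"])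
    qed
    ultimately have "D * yP + (nm (pt s t) + cj (pt s t) * xP) = D * (n * pt s t) + D * k"
      by (simp only: distrib_left)
    then have "tr (D * yP + (nm (pt s t) + cj (pt s t) * xP)) = tr (D * (n * pt s t) + D * k)"
      by simp
    then have "tr (D * yP) + tr (cj (pt s t) * xP) = tr (D * (n * pt s t)) + tr (D * k)"
      by (simp add: tr_add tr_nm)
    moreover have "tr (cj (pt s t) * xP) = tr (cj xP * pt s t)"
      using tr_cj[of "cj (pt s t) * xP"] by (simp add: mult.commute)
    ultimately have "tr (D * yP) + tr (cj xP * pt s t) + (tr (D * (n * pt s t)) + tr (D * k)) = 0"
      by (simp only: B.add_eq_0)
    moreover have "tr (D * yP) + tr (cj xP * pt s t) + (tr (D * (n * pt s t)) + tr (D * k))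
        = tr (g * pt s t) + \<iota> r"
      by (simp add: r[symmetric] tr_add[symmetric] g_def algebra_simps)
    ultimately have "tr (g * pt s t) = \<iota> r" by (simp only: B.add_eq_0)
    moreover have "tr (g * pt s t) = tr (\<iota> s * (g * \<alpha>)) + tr (\<iota> t * (g * \<beta>))"
      by (simp add: pt_def tr_add[symmetric] algebra_simps)
    ultimately have "\<iota> s * \<iota> l + \<iota> t * \<iota> m = \<iota> r" by (simp only: tr_iota_mult l m)
    then have "\<iota> (l * s + m * t) = \<iota> r" by (simp add: iota_add iota_mult mult.commute)
    then have lin: "l * s + m * t = r" by simp
    have "f s t + f sP tP + tP * s + sP * t = f (s + sP) (t + tP + S sP * (s + sP))"
      by (rule f_translate)
    also have "\<dots> = c" using uv(2) by (simp add: s_def t_def expand)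
    finally have "f s t + (tP * s + sP * t + (c + f sP tP)) = 0"
      by (auto simp: expand)
    then have "f s t = tP * s + sP * t + (c + f sP tP)" by (simp only: add_eq_0)
    then show "X \<in> (\<lambda>(s, t). (pt s t, n * pt s t + k)) ` Z"
      using Xl lin by (auto simp: Z_def)
  qed
  then have "card (afeet (pt sP tP, yP) \<inter> aline n k) \<le> card ((\<lambda>(s, t). (pt s t, n * pt s t + k)) ` Z)"
    by (rule card_mono[rotated]) simp
  also have "\<dots> \<le> card Z" by (rule card_image_le) simp
  also have "\<dots> \<le> 2" unfolding Z_def by (rule card_line_plane_section[OF lm])
  finally show ?thesis .
qed

lemma card_afeet_aline:
  assumes "P \<notin> UU"
  shows "card (afeet P \<inter> aline n k) \<le> 4"
proof -
  obtain x y where P: "P = (x, y)" by fastforce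
  obtain s t where "x = pt s t" by (rule pt_surj)
  with assms P card_afeet_special_line[of s t y k] card_afeet_general_line[of s t y n k]
  show ?thesis by (cases "n = cj (pt s t) / D") auto
qed

lemma afeet_unique_fst:
  assumes "P \<notin> UU" "(x, y) \<in> afeet P" "(x, y') \<in> afeet P"
  shows "y = y'"
proof -
  obtain xP yP where P: "P = (xP, yP)" by fastforce
  obtain sP tP where x: "xP = pt sP tP" by (rule pt_surj)
  have nU: "(pt sP tP, yP) \<notin> UU" using assms P x by simp
  obtain c where c: "tr yP + \<iota> (f sP tP) = \<iota> c" "c \<noteq> 0" by (rule not_UU_constant[OF nU])
  show ?thesis
    using assms(2,3) unfolding P x afeet_eq[OF nU c(1)]
    by clarsimp (metis fst_conv fst_foot_inj snd_conv)
qed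

text \<open>A solution would give a nonzero element of the large field with norm 0.\<close>

lemma no_artin_schreier_norm:
  assumes "nm \<alpha> = \<iota> a" "nm \<beta> = \<iota> b"
  shows "x\<^sup>2 + x \<noteq> a * b / d\<^sup>2"
proof
  assume x: "x\<^sup>2 + x = a * b / d\<^sup>2"
  have b: "b \<noteq> 0"
  proof
    assume "b = 0"
    then have "\<beta> = 0" using assms nm_eq_0 by simp
    then have "D = 0" unfolding D_def by simp
    then show False by simp
  qed
  have "nm (pt 1 (x * d / b)) = \<iota> (a + d * (x * d / b) + b * (x * d / b)\<^sup>2)"
    using nm_pt[OF assms, of 1 "x * d / b" 0] by simp
  also have "a + d * (x * d / b) + b * (x * d / b)\<^sup>2 = a + d\<^sup>2 / b * (x\<^sup>2 + x)"
    using b by (simp add: field_simps power2_eq_square)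
  also have "\<dots> = 0" unfolding x using b d_nonzero by (simp add: add_self)
  finally show False by (simp add: pt_eq_0)
qed

lemma ex_feet_conic:
  assumes b: "b \<noteq> 0" "\<And>x. x\<^sup>2 + x \<noteq> 1 / b\<^sup>2"
  obtains P F n k0 k where "P \<notin> UU" "afeet P = F ` {(u, v). f u v = 1}" "inj F"
    "inj (fst \<circ> F)" "\<And>m l. m \<noteq> n \<Longrightarrow> card (afeet P \<inter> aline m l) \<le> 2"
    "\<And>l u v. F (u, v) \<in> aline n l \<longleftrightarrow> l = k0 + k * \<iota> (u\<^sup>2 + b * (u * v) + v\<^sup>2)" "k \<noteq> 0"
proof -
  obtain na where na: "nm \<alpha> = \<iota> na" by (rule nm_iota)
  obtain nb where nb: "nm \<beta> = \<iota> nb" by (rule nm_iota)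
  have "nb \<noteq> 0"
  proof
    assume "nb = 0"
    then have "\<beta> = 0" using nb nm_eq_0 by simp
    then have "D = 0" unfolding D_def by simp
    then show False by simp
  qed
  then obtain s l k where l: "l \<noteq> 0" and k: "k \<noteq> 0" and resc:
    "\<And>u v. (na + d * s + nb * s\<^sup>2) * (l * u)\<^sup>2 + d * ((l * u) * (S l * l * v)) + nb * (S l * l * v)\<^sup>2
      = k * (u\<^sup>2 + b * (u * v) + v\<^sup>2)"
    using ex_rescaling[OF d_nonzero _ no_artin_schreier_norm[OF na nb] b] by metis
  \<comment> \<open>Chosen because the shear in \<open>foot\<close> is by S sP.\<close>
  define sP where "sP = R s"
  have sP: "S sP = s" by (simp add: sP_def)
  define c where "c = S l * l\<^sup>2"
  have c: "c \<noteq> 0" using l by (simp add: c_def)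
  \<comment> \<open>The second coordinate of P is still free and the trace is onto, so any nonzero
    constant c can be prescribed.\<close>
  obtain yP where "tr yP = \<iota> (c + f sP 0)" by (rule tr_surj)
  then have yP: "tr yP + \<iota> (f sP 0) = \<iota> c"
    by (simp add: iota_add add.assoc B.add_self)
  have nU: "(pt sP 0, yP) \<notin> UU"
    using yP c by (auto simp: UU_iff B.add_self)
  define F where "F = (\<lambda>(u, v). foot sP 0 yP (l * u) (S l * l * v))"
  define n where "n = cj (pt sP 0) / D"
  define k0 where "k0 = nm (pt sP 0) / D + yP"
  have "afeet (pt sP 0, yP) = F ` {(u, v). f u v = 1}"
  proof -
    have "{(u, v). f u v = c} = (\<lambda>(u, v). (l * u, S l * l * v)) ` {(u, v). f u v = 1}"
    proof (rule set_eqI, rule iffI)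
      fix z assume "z \<in> {(u, v). f u v = c}"
      then obtain u v where z: "z = (u, v)" "f u v = c" by auto
      have uv: "u = l * (u / l)" "v = S l * l * (v / (S l * l))" using l by auto
      have "c * f (u / l) (v / (S l * l)) = c"
        using f_rescale[of l "u / l" "v / (S l * l)"] z(2) l by (simp add: c_def)
      then have "f (u / l) (v / (S l * l)) = 1" using c by simp
      then show "z \<in> (\<lambda>(u, v). (l * u, S l * l * v)) ` {(u, v). f u v = 1}"
        using uv z(1) by (intro image_eqI[of _ _ "(u / l, v / (S l * l))"]) auto
    qed (auto simp: f_rescale c_def)
    then show ?thesis unfolding afeet_eq[OF nU yP] by (simp add: image_image F_def case_prod_unfold)
  qed
  moreover have "inj F" using l by (auto simp: inj_def F_def foot_inj)
  moreover have "inj (fst \<circ> F)" using l by (auto simp: inj_def F_def fst_foot_inj)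
  moreover have "card (afeet (pt sP 0, yP) \<inter> aline m r) \<le> 2" if "m \<noteq> n" for m r
    using card_afeet_general_line[OF nU] that by (simp add: n_def)
  moreover have "F (u, v) \<in> aline n r \<longleftrightarrow> r = k0 + \<iota> k / D * \<iota> (u\<^sup>2 + b * (u * v) + v\<^sup>2)" for r u v
  proof -
    have "F (u, v) \<in> aline n r \<longleftrightarrow> \<iota> (k * (u\<^sup>2 + b * (u * v) + v\<^sup>2)) = nm (pt sP 0) + D * (yP + r)"
      by (simp add: F_def n_def foot_special_line nm_pt[OF na nb, of _ _ "S sP"] sP resc nm_pt[OF na nb])
    also have "\<dots> \<longleftrightarrow> r = k0 + \<iota> k / D * \<iota> (u\<^sup>2 + b * (u * v) + v\<^sup>2)" (is "?p = ?q \<longleftrightarrow> _")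
    proof
      assume "?p = ?q"
      then have "k0 + ?p / D = k0 + ?q / D" by simp
      also have "\<dots> = r" by (simp add: k0_def add_divide_distrib B.expand)
      finally show "r = k0 + \<iota> k / D * \<iota> (u\<^sup>2 + b * (u * v) + v\<^sup>2)" by (simp add: iota_mult)
    next
      assume r: "r = k0 + \<iota> k / D * \<iota> (u\<^sup>2 + b * (u * v) + v\<^sup>2)"
      have "D * (k0 + x / D) = nm (pt sP 0) + D * yP + x" for x
        by (simp add: k0_def distrib_left)
      then have "D * r = nm (pt sP 0) + D * yP + ?p" unfolding r by (simp add: iota_mult)
      then show "?p = ?q" by (simp add: distrib_left B.expand)
    qed
    finally show ?thesis .
  qed
  ultimately show ?thesis
    using nU k that[of "(pt sP 0, yP)" F n k0 "\<iota> k / D"] by simp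
qed

lemma card_feet_special:
  assumes "afeet P = F ` {(u, v). f u v = 1}" "inj F" "k \<noteq> 0"
    "\<And>l u v. F (u, v) \<in> aline n l \<longleftrightarrow> l = k0 + k * \<iota> (u\<^sup>2 + b * (u * v) + v\<^sup>2)"
  shows "card (afeet P \<inter> aline n (k0 + k)) = card {(u, v). u\<^sup>2 + b * (u * v) + v\<^sup>2 = 1 \<and> f u v = 1}"
proof -
  have "\<iota> x = 1 \<longleftrightarrow> x = 1" for x using iota_inj[of x 1] by simp
  then have "afeet P \<inter> aline n (k0 + k) = F ` {(u, v). u\<^sup>2 + b * (u * v) + v\<^sup>2 = 1 \<and> f u v = 1}"
    using assms(3) unfolding assms(1) by (auto simp: assms(4))
  then show ?thesis using assms(2) by (simp add: card_image inj_on_subset)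
qed

lemma ex_three_feet: obtains P n k where "P \<notin> UU" "card (afeet P \<inter> aline n k) = 3"
proof -
  have "x\<^sup>2 + x \<noteq> 1 / 1\<^sup>2" for x :: 'a using no_artin_schreier_root[of 1 x] by simp
  then obtain P F n k0 k where P: "P \<notin> UU" and F: "afeet P = F ` {(u, v). f u v = 1}" "inj F"
    "\<And>l u v. F (u, v) \<in> aline n l \<longleftrightarrow> l = k0 + k * \<iota> (u\<^sup>2 + 1 * (u * v) + v\<^sup>2)" "k \<noteq> 0"
    by (rule ex_feet_conic[of 1, OF one_neq_zero]) blast
  have "card (afeet P \<inter> aline n (k0 + k)) = 3"
    unfolding card_feet_special[OF F(1,2,4,3)] conic_three_points by simp
  then show ?thesis using that P by blast
qed

lemma ex_four_and_two_feet:
  obtains P X n k n' k' where "P \<notin> UU" "X \<in> afeet P" "card (afeet P \<inter> aline n k) = 4"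
    "card (afeet P \<inter> aline n' k') = 2"
proof -
  obtain b where b: "b \<noteq> 0" "b \<noteq> 1" "\<forall>x. x\<^sup>2 + x \<noteq> 1 / b\<^sup>2"
    "card {(u, v). u\<^sup>2 + b * (u * v) + v\<^sup>2 = 1 \<and> f u v = 1} = 4"
    by (rule ex_conic_four_points)
  obtain P F n k0 k where P: "P \<notin> UU" and F: "afeet P = F ` {(u, v). f u v = 1}" "inj F"
    "\<And>l u v. F (u, v) \<in> aline n l \<longleftrightarrow> l = k0 + k * \<iota> (u\<^sup>2 + b * (u * v) + v\<^sup>2)" "k \<noteq> 0"
    and inj: "inj (fst \<circ> F)" and le2: "\<And>m l. m \<noteq> n \<Longrightarrow> card (afeet P \<inter> aline m l) \<le> 2"
    by (rule ex_feet_conic[OF b(1) b(3)[rule_format]]) blast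
  have four: "card (afeet P \<inter> aline n (k0 + k)) = 4"
    unfolding card_feet_special[OF F(1,2,4,3)] by (rule b(4))
  obtain x y where X: "F (1, 0) = (x, y)" by fastforce
  obtain x' y' where X': "F (1, 1) = (x', y')" by fastforce
  have feet: "(x, y) \<in> afeet P" "(x', y') \<in> afeet P"
    unfolding F(1) X[symmetric] X'[symmetric] by (auto simp: f_def add_self)
  have "x \<noteq> x'"
    using injD[OF inj, of "(1, 0)" "(1, 1)"] X X' by auto
  then have nz: "x + x' \<noteq> 0" by (simp add: B.add_eq_0)
  define m where "m = (y + y') / (x + x')"
  define r where "r = y + m * x"
  have m: "m * (x + x') = y + y'" using nz by (simp add: m_def)
  have on: "(x, y) \<in> aline m r" "(x', y') \<in> aline m r"
  proof -
    show "(x, y) \<in> aline m r" by (simp add: aline_def r_def B.expand)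
    have "m * x' + r = y + m * (x + x')" by (simp add: r_def algebra_simps)
    also have "\<dots> = y'" unfolding m by (simp add: B.expand)
    finally show "(x', y') \<in> aline m r" by (simp add: aline_def)
  qed
  \<comment> \<open>The form u^2 + b u v + v^2 takes the value 1 at (1, 0) and b at (1, 1). As b
    \<noteq> 1, no line of the special slope contains both feet, and the secant through them
    contains no third one.\<close>
  have "m \<noteq> n"
  proof
    assume "m = n"
    then have "r = k0 + k * \<iota> (1\<^sup>2 + b * (1 * 0) + 0\<^sup>2)" "r = k0 + k * \<iota> (1\<^sup>2 + b * (1 * 1) + 1\<^sup>2)"
      using on F(3)[of 1 0 r] F(3)[of 1 1 r] X X' by simp_all
    then have "\<iota> 1 = \<iota> b" using F(4) by (simp add: expand)
    then show False using b(2) by (metis iota_inj)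
  qed
  then have "card (afeet P \<inter> aline m r) \<le> 2" by (rule le2)
  moreover have "card {(x, y), (x', y')} \<le> card (afeet P \<inter> aline m r)"
    by (rule card_mono) (use feet on in auto)
  moreover have "card {(x, y), (x', y')} = 2" using \<open>x \<noteq> x'\<close> by simp
  ultimately have "card (afeet P \<inter> aline m r) = 2" by linarith
  then show ?thesis using that P feet(1) four by blast
qed

text \<open>The trace form is nondegenerate; \<mu> is built in the dual basis from the values at
  \<alpha> and \<beta>. This is what turns a coordinate over the small field into the trace of one
  over the large field.\<close>

lemma functional_eq_tr:
  fixes g :: "'b \<Rightarrow> 'a"
  assumes add: "\<And>x y. g (x + y) = g x + g y" and scale: "\<And>c x. g (\<iota> c * x) = c * g x"
  obtains \<mu> where "\<And>x. tr (\<mu> * x) = \<iota> (g x)"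
proof -
  define \<mu> where "\<mu> = (\<iota> (g \<alpha>) * cj \<beta> + \<iota> (g \<beta>) * cj \<alpha>) / D"
  have "tr ((\<iota> (g \<alpha>) * cj \<beta> + \<iota> (g \<beta>) * cj \<alpha>) * \<alpha>) = \<iota> (g \<alpha>) * D"
    "tr ((\<iota> (g \<alpha>) * cj \<beta> + \<iota> (g \<beta>) * cj \<alpha>) * \<beta>) = \<iota> (g \<beta>) * D"
    by (simp_all add: tr_def D_def B.expand)
  then have \<mu>: "tr (\<mu> * \<alpha>) = \<iota> (g \<alpha>)" "tr (\<mu> * \<beta>) = \<iota> (g \<beta>)"
    by (simp_all add: \<mu>_def tr_divide_D)
  have "tr (\<mu> * x) = \<iota> (g x)" for x
  proof -
    obtain s t where x: "x = pt s t" by (rule pt_surj)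
    have "tr (\<mu> * x) = tr (\<iota> s * (\<mu> * \<alpha>)) + tr (\<iota> t * (\<mu> * \<beta>))"
      by (simp add: x pt_def tr_add[symmetric] algebra_simps)
    also have "\<dots> = \<iota> (g x)"
      by (simp add: tr_iota_mult \<mu> x pt_def add scale iota_add iota_mult)
    finally show ?thesis .
  qed
  then show ?thesis by (rule that)
qed

section \<open>From affine coordinates to the projective plane\<close>

definition vline :: "'b \<Rightarrow> ('b \<times> 'b) set" where
  "vline c = {(x, y). x = c}"

lemma card_vline_afeet:
  assumes "P \<notin> UU"
  shows "card (vline c \<inter> afeet P) \<le> 1"
  using afeet_unique_fst[OF assms]
  by (subst One_nat_def, subst card_le_Suc0_iff_eq) (auto simp: vline_def)

text \<open>\<open>pinf\<close> and \<open>dir m\<close> are the points at infinity of the vertical lines and of the lines of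
  slope \<open>m\<close>.\<close>

lemma feet_of_coordinates:
  fixes A :: "'b \<times> 'b \<Rightarrow> ('b ^ 3) set" and pinf :: "('b ^ 3) set" and dir :: "'b \<Rightarrow> ('b ^ 3) set"
  assumes inj: "inj A" and disj: "range A \<inter> linf = {}" and pts: "pg_points = range A \<union> linf"
    and inf: "pinf \<in> linf" "\<And>m. dir m \<in> linf" "\<And>m. dir m \<noteq> pinf"
    and U: "U = insert pinf (A ` UU)"
    and lines: "pg_lines = insert linf (range (\<lambda>c. insert pinf (A ` vline c))
      \<union> {insert (dir m) (A ` aline m n) | m n. True})"
  shows "(\<forall>P \<in> pg_points - (linf \<union> U). \<forall>l \<in> pg_lines. card (l \<inter> feet U P) \<le> 4) \<and>
    (\<forall>k \<in> {0, 1, 2, 3, 4}. \<exists>l \<in> pg_lines. \<exists>P \<in> pg_points - (linf \<union> U). card (l \<inter> feet U P) = k)"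
proof -
  have "A z \<notin> linf" for z
    using disj by auto
  then have notinf: "A z \<noteq> pinf" "A z \<noteq> dir m" "A z \<notin> linf" for z m
    using inf(1) inf(2)[of m] by metis+
  have notin3: "linf \<inter> A ` Z = {}" for Z
    using notinf(3) by blast
  have notin: "pinf \<notin> A ` Z" "dir m \<notin> A ` Z" "linf \<inter> A ` Z = {}" for m Z
    using notin3[of Z] inf(1) inf(2)[of m] by blast+
  have A_iff: "A z \<in> A ` Z \<longleftrightarrow> z \<in> Z" for z Z
    using inj by (rule inj_image_mem_iff)
  have vertical: "insert pinf (A ` vline c) \<inter> U = insert pinf (A ` (vline c \<inter> UU))" for c
    unfolding U image_Int[OF inj] by (simp add: Int_insert_left Int_insert_right notin)
  have slanted: "insert (dir m) (A ` aline m n) \<inter> U = A ` (aline m n \<inter> UU)" for m n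
    unfolding U image_Int[OF inj] by (simp add: Int_insert_left Int_insert_right notin inf(3) inf(3)[symmetric])
  have linf_U: "linf \<inter> U = {pinf}"
    unfolding U by (simp add: notin inf(1))
  have card_A: "card (A ` Z) = card Z" for Z
    by (rule card_image) (rule inj_on_subset[OF inj subset_UNIV])
  have feet: "feet U (A p) = A ` afeet p" if p: "p \<notin> UU" for p
  proof (rule set_eqI, rule iffI)
    fix X assume "X \<in> feet U (A p)"
    then obtain l where l: "X \<in> U" "l \<in> pg_lines" "card (l \<inter> U) = 1" "X \<in> l" "A p \<in> l"
      by (auto simp: feet_def tangent_line_def)
    have "l \<noteq> linf" using l(5) notinf(3)[of p] by blast
    moreover have "l \<noteq> insert pinf (A ` vline c)" for c
    proof
      assume lc: "l = insert pinf (A ` vline c)"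
      obtain y where y: "(c, y) \<in> UU" by (rule ex_UU)
      have "{pinf, A (c, y)} \<subseteq> l \<inter> U"
        unfolding lc vertical using y by (auto simp: vline_def)
      then have "card {pinf, A (c, y)} \<le> 1"
        unfolding l(3)[symmetric] by (rule card_mono[rotated]) simp
      then show False using notinf(1)[of "(c, y)"] by (simp add: card_insert_if)
    qed
    ultimately obtain m n where lm: "l = insert (dir m) (A ` aline m n)"
      using l(2) unfolding lines by auto
    have "card (aline m n \<inter> UU) = 1" using l(3) unfolding lm slanted card_A .
    then obtain z where z: "aline m n \<inter> UU = {z}" by (auto simp: card_1_singleton_iff)
    have "X \<in> A ` (aline m n \<inter> UU)" using l unfolding lm slanted[symmetric] by auto
    then have X: "X = A z" unfolding z by simp
    moreover have "p \<in> aline m n" using l(5) notinf(2)[of p m] unfolding lm by (simp add: A_iff)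
    ultimately have "z \<in> afeet p" using z unfolding afeet_def by blast
    then show "X \<in> A ` afeet p" using X by simp
  next
    fix X assume "X \<in> A ` afeet p"
    then obtain z m n where z: "X = A z" "p \<in> aline m n" "z \<in> aline m n" "aline m n \<inter> UU = {z}"
      by (auto simp: afeet_def)
    define l where "l = insert (dir m) (A ` aline m n)"
    have "l \<inter> U = {A z}" unfolding l_def slanted z(4) by simp
    moreover have "l \<in> pg_lines" unfolding lines l_def by auto
    ultimately show "X \<in> feet U (A p)"
      using z by (auto simp: feet_def tangent_line_def l_def)
  qed
  have notU: "A p \<in> U \<longleftrightarrow> p \<in> UU" for p
    by (simp add: U A_iff notinf(1))
  have P_iff: "P \<in> pg_points - (linf \<union> U) \<longleftrightarrow> (\<exists>p. P = A p \<and> p \<notin> UU)" for P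
    unfolding pts using notinf(3) notU by blast
  have int_linf: "card (linf \<inter> feet U (A p)) = 0" if "p \<notin> UU" for p
    unfolding feet[OF that] using notin by simp
  have int_vline: "card (insert pinf (A ` vline c) \<inter> feet U (A p)) = card (vline c \<inter> afeet p)" if "p \<notin> UU" for c p
  proof -
    have "insert pinf (A ` vline c) \<inter> feet U (A p) = A ` (vline c \<inter> afeet p)"
      unfolding feet[OF that] image_Int[OF inj] by (simp add: Int_insert_left notin Int_commute)
    then show ?thesis by (simp add: card_A)
  qed
  have int_aline: "card (insert (dir m) (A ` aline m n) \<inter> feet U (A p)) = card (afeet p \<inter> aline m n)" if "p \<notin> UU" for m n p
  proof -
    have "insert (dir m) (A ` aline m n) \<inter> feet U (A p) = A ` (afeet p \<inter> aline m n)"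
      unfolding feet[OF that] image_Int[OF inj] by (simp add: Int_insert_left notin Int_commute)
    then show ?thesis by (simp add: card_A)
  qed
  have "card (l \<inter> feet U (A p)) \<le> 4" if p: "p \<notin> UU" and l: "l \<in> pg_lines" for p l
  proof -
    consider "l = linf" | c where "l = insert pinf (A ` vline c)" | m n where "l = insert (dir m) (A ` aline m n)"
      using l unfolding lines by auto
    then show ?thesis
    proof cases
      case 1
      then show ?thesis using int_linf[OF p] by simp
    next
      case 2
      then show ?thesis using int_vline[OF p] card_vline_afeet[OF p, of c] by simp
    next
      case 3
      then show ?thesis using int_aline[OF p] card_afeet_aline[OF p] by simp
    qed
  qed
  moreover have "\<exists>l\<in>pg_lines. \<exists>P\<in>pg_points - (linf \<union> U). card (l \<inter> feet U P) = k"
    if "k \<in> {0, 1, 2, 3, 4}" for k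
  proof -
    obtain p X m n m' n' where p: "p \<notin> UU" "X \<in> afeet p" "card (afeet p \<inter> aline m n) = 4"
      "card (afeet p \<inter> aline m' n') = 2" by (rule ex_four_and_two_feet)
    obtain p3 m3 n3 where p3: "p3 \<notin> UU" "card (afeet p3 \<inter> aline m3 n3) = 3" by (rule ex_three_feet)
    obtain x y where X: "X = (x, y)" by fastforce
    have "vline x \<inter> afeet p = {X}"
      using p(2) afeet_unique_fst[OF p(1)] by (auto simp: X vline_def)
    then have "card (vline x \<inter> afeet p) = 1" by simp
    have in_lines: "linf \<in> pg_lines" "insert pinf (A ` vline c) \<in> pg_lines"
      "insert (dir i) (A ` aline i j) \<in> pg_lines" for c i j
      unfolding lines by auto
    \<comment> \<open>The line at infinity contains no feet, and the vertical line through a foot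
      exactly one, as feet have distinct first coordinates.\<close>
    consider "k = 0" | "k = 1" | "k = 2" | "k = 3" | "k = 4" using \<open>k \<in> _\<close> by auto
    then show ?thesis
    proof cases
      case 1
      then show ?thesis using int_linf[OF p(1)] in_lines(1) P_iff p(1) by blast
    next
      case 2
      then show ?thesis using int_vline[OF p(1)] in_lines(2) P_iff p(1) \<open>card (vline x \<inter> afeet p) = 1\<close> by metis
    next
      case 3
      then show ?thesis using int_aline[OF p(1)] in_lines(3) P_iff p(1,4) by metis
    next
      case 4
      then show ?thesis using int_aline[OF p3(1)] in_lines(3) P_iff p3 by metis
    next
      case 5
      then show ?thesis using int_aline[OF p(1)] in_lines(3) P_iff p(1,3) by metis
    qed
  qed
  ultimately show ?thesis using P_iff by (intro conjI ballI) metis+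
qed

end

section \<open>From the cone to affine coordinates\<close>

lemma pg_points_iff: "p \<in> pg_points \<longleftrightarrow> (\<exists>w. w \<noteq> 0 \<and> p = vec.span {w})"
proof
  assume "p \<in> pg_points"
  then have p: "vec.subspace p" "vec.dim p = 1" by (auto simp: pg_points_def)
  then have "\<not> p \<subseteq> {0}" using vec.dim_eq_0[of p] by auto
  then obtain w where w: "w \<in> p" "w \<noteq> 0" by blast
  have "vec.span {w} \<subseteq> p" using w p by (simp add: vec.span_minimal)
  moreover have "vec.dim (vec.span {w}) = 1" using w by (simp add: vec.dim_span)
  ultimately have "vec.span {w} = p"
    using vec.subspace_dim_equal[of "vec.span {w}" p] p by (simp add: vec.subspace_span)
  then show "\<exists>w. w \<noteq> 0 \<and> p = vec.span {w}" using w by blast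
next
  assume "\<exists>w. w \<noteq> 0 \<and> p = vec.span {w}"
  then show "p \<in> pg_points"
    by (auto simp: pg_points_def vec.subspace_span vec.dim_span)
qed

lemma span_singleton_iff: "x \<in> vec.span {w} \<longleftrightarrow> (\<exists>c. x = c *s w)"
  by (auto simp: vec.span_singleton)

lemma span_singleton_subset: "vec.subspace W \<Longrightarrow> vec.span {w} \<subseteq> W \<longleftrightarrow> w \<in> W"
  by (metis insert_subset empty_subsetI vec.span_minimal vec.span_superset subset_trans)

lemma points_on_span_iff:
  assumes "vec.subspace W"
  shows "vec.span {w} \<in> points_on W \<longleftrightarrow> w \<noteq> 0 \<and> w \<in> W"
proof -
  have "vec.span {w} \<in> pg_points \<longleftrightarrow> w \<noteq> 0"
    by (auto simp: pg_points_def vec.subspace_span vec.dim_span)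
  then show ?thesis using span_singleton_subset[OF assms] by (auto simp: points_on_def)
qed

lemma vector_4 [simp]:
  fixes w x y z :: "'k::zero"
  shows "(vector [w, x, y, z] :: 'k ^ 4) $ 1 = w" "(vector [w, x, y, z] :: 'k ^ 4) $ 2 = x"
    "(vector [w, x, y, z] :: 'k ^ 4) $ 3 = y" "(vector [w, x, y, z] :: 'k ^ 4) $ 4 = z"
  unfolding vector_def by simp_all

lemma hyperplane_complement:
  fixes \<Sigma> :: "('a::field ^ 5) set"
  assumes "hyperplane_in_PG4 \<Sigma>" "v \<notin> \<Sigma>"
  obtains k where "w - k *s v \<in> \<Sigma>"
proof -
  have S: "vec.subspace \<Sigma>" "vec.dim \<Sigma> = 4" using assms by (auto simp: hyperplane_in_PG4_def)
  then have "v \<notin> vec.span \<Sigma>" using assms vec.span_eq_iff[of \<Sigma>] by metis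
  then have "vec.dim (insert v \<Sigma>) = 5" using S by (simp add: vec.dim_insert)
  then have "vec.span (insert v \<Sigma>) = UNIV"
    by (intro vec.subspace_dim_equal) (simp_all add: vec_dim_card card_cart_basis)
  then have "w \<in> vec.span (insert v \<Sigma>)" by simp
  moreover have "vec.span \<Sigma> = \<Sigma>" using S by simp
  ultimately show ?thesis using that unfolding vec.span_breakdown_eq by auto
qed

section \<open>The cone over the Tits ovoid in homogeneous coordinates\<close>

context tits_field begin

text \<open>Membership of a vector in the cone over the standard ovoid, including the zero vector.\<close>

definition Ov :: "'a ^ 4 \<Rightarrow> bool" where
  "Ov x \<longleftrightarrow> (x $ 1 = 0 \<and> x $ 2 = 0 \<and> x $ 3 = 0) \<or>
    (x $ 1 \<noteq> 0 \<and> x $ 4 / x $ 1 = f (x $ 2 / x $ 1) (x $ 3 / x $ 1))"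

lemma Ov_affine: "x $ 1 \<noteq> 0 \<Longrightarrow> Ov x \<longleftrightarrow> x $ 4 = x $ 1 * f (x $ 2 / x $ 1) (x $ 3 / x $ 1)"
  by (auto simp: Ov_def field_simps)

lemma Ov_iff: "(\<exists>X\<in>standard_tits_ovoid (2 ^ (e + 1)). x \<in> X) \<longleftrightarrow> Ov x"
proof -
  have "(\<exists>X\<in>standard_tits_ovoid (2 ^ (e + 1)). x \<in> X) \<longleftrightarrow>
      (\<exists>c. x = c *s vector [0, 0, 0, 1]) \<or> (\<exists>c s t. x = c *s vector [1, s, t, f s t])"
  proof -
    have std: "standard_tits_ovoid (2 ^ (e + 1)) = insert (vec.span {vector [0, 0, 0, 1]})
        {vec.span {vector [1, s, t, f s t :: 'a]} | s t. True}"
      unfolding standard_tits_ovoid_def f_eq ..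
    have "(\<exists>X\<in>standard_tits_ovoid (2 ^ (e + 1)). x \<in> X) \<longleftrightarrow>
        x \<in> vec.span {vector [0, 0, 0, 1]} \<or> (\<exists>s t. x \<in> vec.span {vector [1, s, t, f s t]})"
      unfolding std by blast
    then show ?thesis unfolding span_singleton_iff by blast
  qed
  also have "(\<exists>c. x = c *s vector [0, 0, 0, 1]) \<longleftrightarrow> x $ 1 = 0 \<and> x $ 2 = 0 \<and> x $ 3 = 0"
    by (auto simp: vec_eq_iff forall_4)
  also have "(\<exists>c s t. x = c *s vector [1, s, t, f s t]) \<longleftrightarrow>
      x = 0 \<or> (x $ 1 \<noteq> 0 \<and> x $ 4 / x $ 1 = f (x $ 2 / x $ 1) (x $ 3 / x $ 1))"
  proof
    assume "\<exists>c s t. x = c *s vector [1, s, t, f s t]"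
    then obtain c s t where x: "x = c *s vector [1, s, t, f s t]" by blast
    show "x = 0 \<or> (x $ 1 \<noteq> 0 \<and> x $ 4 / x $ 1 = f (x $ 2 / x $ 1) (x $ 3 / x $ 1))"
      by (cases "c = 0") (simp_all add: x)
  next
    assume *: "x = 0 \<or> (x $ 1 \<noteq> 0 \<and> x $ 4 / x $ 1 = f (x $ 2 / x $ 1) (x $ 3 / x $ 1))"
    have "x = x $ 1 *s vector [1, x $ 2 / x $ 1, x $ 3 / x $ 1, f (x $ 2 / x $ 1) (x $ 3 / x $ 1)]"
      using * by (auto simp: vec_eq_iff forall_4 field_simps)
    then show "\<exists>c s t. x = c *s vector [1, s, t, f s t]" by blast
  qed
  finally show ?thesis by (auto simp: Ov_def)
qed

lemma Ov_swap:
  assumes "Ov x"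
  shows "Ov (vector [x $ 4, x $ 3, x $ 2, x $ 1])"
proof (cases "x $ 1 = 0")
  case True
  then have "x $ 2 = 0" "x $ 3 = 0" using assms by (auto simp: Ov_def)
  then show ?thesis using True by (auto simp: Ov_def)
next
  case False
  define u where "u = x $ 2 / x $ 1"
  define v where "v = x $ 3 / x $ 1"
  have x: "x $ 2 = u * x $ 1" "x $ 3 = v * x $ 1" "x $ 4 = f u v * x $ 1"
    using False assms by (auto simp: u_def v_def Ov_def field_simps)
  show ?thesis
  proof (cases "f u v = 0")
    case True
    then show ?thesis using x by (auto simp: Ov_def f_eq_0_iff)
  next
    case f0: False
    then show ?thesis using x False f_swap[OF f0] by (simp add: Ov_def)
  qed
qed

text \<open>\<open>f_translate\<close> as a linear map: the Suzuki group element moving the point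
  over (s, t) to (1, 0, 0, 0).\<close>

definition translation :: "'a \<Rightarrow> 'a \<Rightarrow> 'a ^ 4 \<Rightarrow> 'a ^ 4" where
  "translation s t x = vector [x $ 1, x $ 2 + s * x $ 1, x $ 3 + t * x $ 1 + S s * (x $ 2 + s * x $ 1),
     x $ 4 + f s t * x $ 1 + t * x $ 2 + s * x $ 3]"

lemma Ov_translation: "Ov (translation s t x) \<longleftrightarrow> Ov x"
proof (cases "x $ 1 = 0")
  case True
  then show ?thesis by (auto simp: Ov_def translation_def)
next
  case False
  define u where "u = x $ 2 / x $ 1"
  define v where "v = x $ 3 / x $ 1"
  define z where "z = x $ 4 / x $ 1"
  have x: "x $ 2 = u * x $ 1" "x $ 3 = v * x $ 1" "x $ 4 = z * x $ 1"
    using False by (auto simp: u_def v_def z_def)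
  have "translation s t x $ 2 / x $ 1 = u + s" "translation s t x $ 3 / x $ 1 = v + t + S s * (u + s)"
    "translation s t x $ 4 / x $ 1 = z + (f s t + t * u + s * v)" "translation s t x $ 1 = x $ 1"
    using False by (simp_all add: translation_def x field_simps)
  then have "Ov (translation s t x) \<longleftrightarrow> z + (f s t + t * u + s * v) = f u v + (f s t + t * u + s * v)"
    using False f_translate[of u v s t] by (simp add: Ov_def add.assoc)
  then show ?thesis using False by (simp add: Ov_def u_def v_def z_def)
qed

text \<open>A point with nonzero first coordinate goes to (1, 0, 0, 0) by a translation and then to
  (0, 0, 0, 1) by the reversal of coordinates.\<close>

lemma Ov_normalize:
  assumes x: "Ov x" "x \<noteq> 0"
  obtains g :: "'a ^ 4 \<Rightarrow> 'a ^ 4" where "\<And>y z. g (y + z) = g y + g z" "\<And>c y. g (c *s y) = c *s g y"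
    "surj g" "\<And>y. Ov (g y) \<longleftrightarrow> Ov y" "g x $ 1 = 0" "g x $ 2 = 0" "g x $ 3 = 0" "g x $ 4 \<noteq> 0"
proof (cases "x $ 1 = 0")
  case True
  then have "x $ 2 = 0" "x $ 3 = 0" "x $ 4 \<noteq> 0" using x by (auto simp: Ov_def vec_eq_iff forall_4)
  with True show ?thesis by (intro that[of "\<lambda>y. y"]) auto
next
  case False
  define s where "s = x $ 2 / x $ 1"
  define t where "t = x $ 3 / x $ 1"
  have xs: "x $ 2 = s * x $ 1" "x $ 3 = t * x $ 1" "x $ 4 = f s t * x $ 1"
    using False x by (auto simp: s_def t_def Ov_def field_simps)
  define swap :: "'a ^ 4 \<Rightarrow> 'a ^ 4" where "swap = (\<lambda>y. vector [y $ 4, y $ 3, y $ 2, y $ 1])"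
  define g where "g = (\<lambda>y. swap (translation s t y))"
  have swap2: "swap (swap y) = y" for y by (simp add: swap_def vec_eq_iff forall_4)
  have Ov_swap_iff: "Ov (swap y) \<longleftrightarrow> Ov y" for y
    using Ov_swap[of y] Ov_swap[of "swap y"] swap2[of y] unfolding swap_def by metis
  have "inj g"
  proof (rule injI)
    fix y z assume "g y = g z"
    then have "translation s t y = translation s t z" unfolding g_def using swap2 by metis
    then show "y = z" by (auto simp: translation_def vec_eq_iff forall_4)
  qed
  then have "surj g" by (simp add: finite_UNIV_inj_surj)
  show ?thesis
  proof (rule that[of g])
    show "g (y + z) = g y + g z" "g (c *s y) = c *s g y" for y z c
      by (simp_all add: g_def swap_def translation_def vec_eq_iff forall_4 algebra_simps)
    show "Ov (g y) \<longleftrightarrow> Ov y" for y by (simp add: g_def Ov_swap_iff Ov_translation)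
    show "g x $ 1 = 0" "g x $ 2 = 0" "g x $ 3 = 0" "g x $ 4 \<noteq> 0"
      using False by (simp_all add: g_def swap_def translation_def xs expand)
  qed fact
qed

text \<open>\<open>X\<close> is the projection from the vertex of the cone, spanned by \<open>v0\<close>.\<close>

lemma cone_projection:
  assumes "tits_cone (2 ^ (e + 1)) C"
  obtains X :: "'a ^ 5 \<Rightarrow> 'a ^ 4" and v0 where
    "\<And>v w. X (v + w) = X v + X w" "\<And>c v. X (c *s v) = c *s X v" "surj X"
    "v0 \<noteq> 0" "X v0 = 0" "\<And>w. X w = 0 \<Longrightarrow> w \<in> vec.span {v0}" "\<And>w. w \<noteq> 0 \<Longrightarrow> vec.span {w} \<in> C \<longleftrightarrow> Ov (X w)"
proof -
  obtain V H \<O> g where V: "V \<in> pg_points" and H: "hyperplane_in_PG4 H" and VH: "\<not> V \<subseteq> H"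
    and g: "Vector_Spaces.linear (*s) (*s) g" "inj g" "range g = H"
    and O: "\<O> = (\<lambda>p. g ` p) ` standard_tits_ovoid (2 ^ (e + 1))" and C: "C = ovoidal_cone V \<O>"
    using assms unfolding tits_cone_def tits_ovoid_in_def by blast
  interpret g: Vector_Spaces.linear "(*s)" "(*s)" g by (rule g(1))
  obtain v0 where v0: "v0 \<noteq> 0" "V = vec.span {v0}" using V by (auto simp: pg_points_iff)
  have subH: "vec.subspace H" using H by (simp add: hyperplane_in_PG4_def)
  have v0H: "v0 \<notin> H" using VH span_singleton_subset[OF subH] v0 by simp
  have uniq: "x = y" if "w = g x + r *s v0" "w = g y + k *s v0" for x y r k w
  proof -
    have "g (x - y) = (k - r) *s v0" using that by (simp add: g.diff vec.scale_left_diff_distrib algebra_simps)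
    moreover have "g (x - y) \<in> H" using g(3) by blast
    ultimately have H': "(k - r) *s v0 \<in> H" by simp
    have "k = r"
    proof (rule ccontr)
      assume "k \<noteq> r"
      have "(1 / (k - r)) *s ((k - r) *s v0) = (1 / (k - r) * (k - r)) *s v0"
        by (rule vec.scale_scale)
      also have "\<dots> = v0" using \<open>k \<noteq> r\<close> by simp
      finally have "(1 / (k - r)) *s ((k - r) *s v0) = v0" .
      then show False using vec.subspace_scale[OF subH H', of "1 / (k - r)"] v0H by metis
    qed
    then have "g x = g y" using that by simp
    then show ?thesis using g(2) by (simp add: inj_eq)
  qed
  have ex: "\<exists>x r. w = g x + r *s v0" for w
  proof -
    obtain k where "w - k *s v0 \<in> H" by (rule hyperplane_complement[OF H v0H])
    then obtain x where "w - k *s v0 = g x" using g(3) by blast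
    then have "w = g x + k *s v0" by (simp add: algebra_simps)
    then show ?thesis by blast
  qed
  \<comment> \<open>Every vector is uniquely g x + r v0, and \<open>X\<close> extracts x.\<close>
  define X where "X = (\<lambda>w. SOME x. \<exists>r. w = g x + r *s v0)"
  have X: "\<exists>r. w = g (X w) + r *s v0" for w
    unfolding X_def using ex by (rule someI_ex)
  have X_eq: "X (g x + r *s v0) = x" for x r
    using X[of "g x + r *s v0"] uniq by metis
  have add: "X (v + w) = X v + X w" for v w
  proof -
    obtain r k where "v = g (X v) + r *s v0" "w = g (X w) + k *s v0" using X by metis
    then have "v + w = g (X v + X w) + (r + k) *s v0"
      by (metis (no_types, lifting) g.add add.assoc add.left_commute vec.scale_left_distrib)
    then show ?thesis using X_eq by metis
  qed
  have scale: "X (c *s v) = c *s X v" for c v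
  proof -
    obtain r where "v = g (X v) + r *s v0" using X by metis
    then have "c *s v = g (c *s X v) + (c * r) *s v0"
      by (metis g.scale vec.scale_right_distrib vec.scale_scale)
    then show ?thesis using X_eq by metis
  qed
  have Xv0: "X v0 = 0" using X_eq[of 0 1] by (simp add: g.zero)
  have ker: "w \<in> vec.span {v0}" if "X w = 0" for w
    using X[of w] that by (auto simp: g.zero span_singleton_iff)
  have Xg: "X (g x) = x" for x using X_eq[of x 0] by simp
  have surj: "surj X" using Xg by (metis surjI)
  have sub: "vec.subspace {w. X w \<in> Y}" if Y: "vec.subspace Y" for Y
    using Y add scale X_eq[of 0 0] by (auto simp: vec.subspace_def g.zero)
  have span: "w \<in> vec.span (V \<union> g ` Y) \<longleftrightarrow> X w \<in> Y" if Y: "vec.subspace Y" for w Y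
  proof
    have "V \<subseteq> {w. X w \<in> Y}"
      using span_singleton_subset[OF sub[OF Y]] Xv0 vec.subspace_0[OF Y] by (simp add: v0)
    moreover have "g ` Y \<subseteq> {w. X w \<in> Y}" by (auto simp: Xg)
    ultimately have "vec.span (V \<union> g ` Y) \<subseteq> {w. X w \<in> Y}"
      by (intro vec.span_minimal sub Y) auto
    then show "X w \<in> Y" if "w \<in> vec.span (V \<union> g ` Y)" using that by blast
  next
    assume "X w \<in> Y"
    moreover obtain r where "w = g (X w) + r *s v0" using X by metis
    moreover have "v0 \<in> V" by (simp add: v0 vec.span_base)
    ultimately show "w \<in> vec.span (V \<union> g ` Y)"
      by (metis UnI1 UnI2 imageI vec.span_add vec.span_base vec.span_scale)
  qed
  have std: "vec.subspace Y" if "Y \<in> standard_tits_ovoid (2 ^ (e + 1))" for Y :: "('a ^ 4) set"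
    using that by (auto simp: standard_tits_ovoid_def vec.subspace_span)
  have cone: "vec.span {w} \<in> C \<longleftrightarrow> Ov (X w)" if "w \<noteq> 0" for w
  proof -
    have "vec.span {w} \<in> C \<longleftrightarrow>
        (\<exists>Y\<in>standard_tits_ovoid (2 ^ (e + 1)). w \<in> vec.span (V \<union> g ` Y))"
      unfolding C O ovoidal_cone_def using that
      by (simp add: points_on_span_iff vec.subspace_span)
    also have "\<dots> \<longleftrightarrow> (\<exists>Y\<in>standard_tits_ovoid (2 ^ (e + 1)). X w \<in> Y)"
      using span std by blast
    also have "\<dots> \<longleftrightarrow> Ov (X w)" by (rule Ov_iff)
    finally show ?thesis .
  qed
  show ?thesis by (rule that[of X v0]) (use add scale surj v0 Xv0 ker cone in auto)
qed

text \<open>The vertex must lie in \<Sigma>, for otherwise \<Sigma> would project onto the whole of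
  PG(3,q) and the line L onto the ovoid. Hence L projects to a single point of the ovoid, which
  \<open>Ov_normalize\<close> moves to (0, 0, 0, 1), and \<Sigma> to a plane meeting the ovoid only
  there, the tangent plane.\<close>

lemma cone_at_infinity:
  assumes \<Sigma>: "hyperplane_in_PG4 \<Sigma>" and L: "vec.subspace L" "vec.dim L = 2" "L \<subseteq> \<Sigma>"
    and C: "tits_cone (2 ^ (e + 1)) C" "C \<inter> points_on \<Sigma> = points_on L"
  obtains X :: "'a ^ 5 \<Rightarrow> 'a ^ 4" where
    "\<And>v w. X (v + w) = X v + X w" "\<And>c v. X (c *s v) = c *s X v" "surj X"
    "\<Sigma> = {w. X w $ 1 = 0}" "L = {w. X w $ 1 = 0 \<and> X w $ 2 = 0 \<and> X w $ 3 = 0}"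
    "\<And>w. w \<noteq> 0 \<Longrightarrow> vec.span {w} \<in> C \<longleftrightarrow> Ov (X w)"
proof -
  obtain X0 :: "'a ^ 5 \<Rightarrow> 'a ^ 4" and v0 where X0: "\<And>v w. X0 (v + w) = X0 v + X0 w" "\<And>c v. X0 (c *s v) = c *s X0 v"
    "surj X0" and v0: "v0 \<noteq> 0" "X0 v0 = 0" and ker: "\<And>w. X0 w = 0 \<Longrightarrow> w \<in> vec.span {v0}"
    and cone0: "\<And>w. w \<noteq> 0 \<Longrightarrow> vec.span {w} \<in> C \<longleftrightarrow> Ov (X0 w)"
    by (rule cone_projection[OF C(1)]) blast
  have subS: "vec.subspace \<Sigma>" using \<Sigma> by (simp add: hyperplane_in_PG4_def)
  have L_iff: "w \<in> L \<longleftrightarrow> Ov (X0 w)" if "w \<in> \<Sigma>" for w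
  proof (cases "w = 0")
    case True
    have "X0 0 = 0" using X0(2)[of 0 0] by simp
    then show ?thesis using True vec.subspace_0[OF L(1)] by (simp add: Ov_def)
  next
    case False
    have "vec.span {w} \<in> C \<inter> points_on \<Sigma> \<longleftrightarrow> Ov (X0 w)"
      using that False cone0 by (simp add: points_on_span_iff[OF subS])
    then show ?thesis unfolding C(2) using False by (simp add: points_on_span_iff[OF L(1)])
  qed
  have "v0 \<in> \<Sigma>"
  proof (rule ccontr)
    assume "v0 \<notin> \<Sigma>"
    have onto: "\<exists>w\<in>\<Sigma>. X0 w = x" for x
    proof -
      obtain w where w: "X0 w = x" using X0(3) by (metis surjD)
      obtain k where k: "w - k *s v0 \<in> \<Sigma>" by (rule hyperplane_complement[OF \<Sigma> \<open>v0 \<notin> \<Sigma>\<close>])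
      have "X0 (w - k *s v0) = x"
        using X0(1)[of "w - k *s v0" "k *s v0"] by (simp add: X0(2) v0 w)
      then show ?thesis using k by blast
    qed
    \<comment> \<open>Both images lie on the ovoid but their sum does not, whereas L is closed under
      addition.\<close>
    obtain w1 where w1: "w1 \<in> \<Sigma>" "X0 w1 = vector [1, 0, 0, 0]" using onto by blast
    obtain w2 where w2: "w2 \<in> \<Sigma>" "X0 w2 = vector [0, 0, 0, 1]" using onto by blast
    have "w1 \<in> L" "w2 \<in> L" using L_iff w1 w2 by (auto simp: Ov_def)
    then have "w1 + w2 \<in> L" by (rule vec.subspace_add[OF L(1)])
    then have "Ov (X0 (w1 + w2))" using L_iff L(3) by blast
    then show False by (simp add: X0(1) w1 w2 Ov_def)
  qed
  then have "v0 \<in> L" using L_iff by (simp add: v0 Ov_def)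
  have "\<not> L \<subseteq> vec.span {v0}"
  proof
    assume "L \<subseteq> vec.span {v0}"
    then have "vec.dim L \<le> vec.dim {v0}" by (rule vec.dim_mono)
    then show False using L(2) v0 by simp
  qed
  then obtain w0 where w0: "w0 \<in> L" "w0 \<notin> vec.span {v0}" by blast
  have "X0 w0 \<noteq> 0" using w0(2) ker by blast
  moreover have "Ov (X0 w0)" using w0(1) L(3) L_iff by blast
  ultimately obtain g :: "'a ^ 4 \<Rightarrow> 'a ^ 4" where g: "\<And>y z. g (y + z) = g y + g z" "\<And>c y. g (c *s y) = c *s g y"
    "surj g" "\<And>y. Ov (g y) \<longleftrightarrow> Ov y" and gw0: "g (X0 w0) $ 1 = 0" "g (X0 w0) $ 2 = 0" "g (X0 w0) $ 3 = 0"
    "g (X0 w0) $ 4 \<noteq> 0"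
    using Ov_normalize by metis
  define X where "X = g \<circ> X0"
  have add: "X (v + w) = X v + X w" and scale: "X (c *s v) = c *s X v" for v w c
    by (simp_all add: X_def g X0)
  have surj: "surj X" unfolding X_def using g(3) X0(3) by (rule comp_surj[rotated])
  have L_iff': "w \<in> L \<longleftrightarrow> Ov (X w)" if "w \<in> \<Sigma>" for w
    using L_iff[OF that] by (simp add: X_def g)
  have Xw0: "X w0 $ 1 = 0" "X w0 $ 2 = 0" "X w0 $ 3 = 0" "X w0 $ 4 \<noteq> 0"
    using gw0 by (simp_all add: X_def)
  have in_kernel: "X w $ 1 = 0" if w: "w \<in> \<Sigma>" for w
  proof (rule ccontr)
    assume nz: "X w $ 1 \<noteq> 0"
    define z where "z = X w $ 1 * f (X w $ 2 / X w $ 1) (X w $ 3 / X w $ 1)"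
    define j where "j = (z - X w $ 4) / X w0 $ 4"
    \<comment> \<open>Adding multiples of \<open>w0\<close> changes only the last coordinate, so
      exactly one k gives a point of the cone. If this point were in L, adding \<open>w0\<close>
      would give a second one.\<close>
    have Ov_line: "Ov (X (w + k *s w0)) \<longleftrightarrow> X w $ 4 + k * X w0 $ 4 = z" for k
      using nz by (simp add: Ov_affine add scale Xw0 z_def)
    have inS: "w + k *s w0 \<in> \<Sigma>" for k
      using w w0(1) L(3) by (metis subS subsetD vec.subspace_add vec.subspace_scale)
    have j: "X w $ 4 + j * X w0 $ 4 = z" using Xw0 by (simp add: j_def)
    then have "w + j *s w0 \<in> L" using L_iff'[OF inS] Ov_line by simp
    then have "(w + j *s w0) + w0 \<in> L" using w0(1) by (rule vec.subspace_add[OF L(1)])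
    moreover have "(w + j *s w0) + w0 = w + (j + 1) *s w0"
      by (simp add: vec.scale_left_distrib add.assoc)
    ultimately have "w + (j + 1) *s w0 \<in> L" by simp
    then have "X w $ 4 + (j + 1) * X w0 $ 4 = z"
      using L_iff'[OF inS[of "j + 1"]] Ov_line[of "j + 1"] by blast
    then show False using j Xw0(4) by (simp add: distrib_right flip: add.assoc)
  qed
  have \<Sigma>_eq: "\<Sigma> = {w. X w $ 1 = 0}"
  proof (intro set_eqI iffI)
    fix w assume "w \<in> {w. X w $ 1 = 0}"
    then have w: "X w $ 1 = 0" by simp
    have "\<Sigma> \<noteq> UNIV"
    proof
      assume "\<Sigma> = UNIV"
      obtain v where "X v = vector [1, 0, 0, 0]" using surj by (metis surjD)
      then show False using in_kernel[of v] \<open>\<Sigma> = UNIV\<close> by simp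
    qed
    then obtain v where v: "v \<notin> \<Sigma>" by blast
    have "X v $ 1 \<noteq> 0"
    proof
      assume v1: "X v $ 1 = 0"
      have "X u $ 1 = 0" for u
      proof -
        obtain k where "u - k *s v \<in> \<Sigma>" by (rule hyperplane_complement[OF \<Sigma> v])
        then have "X (u - k *s v) $ 1 = 0" by (rule in_kernel)
        then show ?thesis using add[of "u - k *s v" "k *s v"] v1 by (simp add: scale)
      qed
      moreover obtain u where "X u = vector [1, 0, 0, 0]" using surj by (metis surjD)
      ultimately show False by (metis vector_4(1) zero_neq_one)
    qed
    moreover obtain k where k: "w - k *s v \<in> \<Sigma>" by (rule hyperplane_complement[OF \<Sigma> v])
    moreover have "X (w - k *s v) $ 1 + k * X v $ 1 = 0"
      using add[of "w - k *s v" "k *s v"] w by (simp add: scale)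
    ultimately have "k = 0" using in_kernel[OF k] by simp
    then show "w \<in> \<Sigma>" using k by simp
  qed (use in_kernel in simp)
  have "w \<in> L \<longleftrightarrow> X w $ 1 = 0 \<and> X w $ 2 = 0 \<and> X w $ 3 = 0" for w
    using L(3) L_iff'[of w] \<Sigma>_eq by (auto simp: Ov_def)
  then have "L = {w. X w $ 1 = 0 \<and> X w $ 2 = 0 \<and> X w $ 3 = 0}" by blast
  moreover have "vec.span {w} \<in> C \<longleftrightarrow> Ov (X w)" if "w \<noteq> 0" for w
    using cone0[OF that] by (simp add: X_def g)
  ultimately show ?thesis
    using that[of X] add scale surj \<Sigma>_eq by simp
qed

end

section \<open>The affine part of the Andre/Bruck-Bose plane\<close>

lemma affine_points:
  fixes \<Sigma> :: "('a::field ^ 5) set"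
  assumes \<Sigma>: "hyperplane_in_PG4 \<Sigma>" and b0: "b0 \<notin> \<Sigma>"
  shows "bij_betw (\<lambda>v. vec.span {b0 + v}) \<Sigma> (pg_points - points_on \<Sigma>)"
proof -
  have sub: "vec.subspace \<Sigma>" using \<Sigma> by (simp add: hyperplane_in_PG4_def)
  have notin: "b0 + v \<notin> \<Sigma>" if "v \<in> \<Sigma>" for v
    using vec.subspace_diff[OF sub, of "b0 + v" v] that b0 by auto
  have inj: "v = w" if vw: "v \<in> \<Sigma>" "w \<in> \<Sigma>" "vec.span {b0 + v} = vec.span {b0 + w}" for v w
  proof -
    have "b0 + v \<in> vec.span {b0 + w}" unfolding vw(3)[symmetric] by (simp add: vec.span_base)
    then obtain c where c: "b0 + v = c *s (b0 + w)" by (auto simp: span_singleton_iff)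
    have "(1 - c) *s b0 = c *s w - v"
      using c by (simp add: vec.scale_left_diff_distrib vec.scale_right_distrib algebra_simps)
    then have *: "(1 - c) *s b0 \<in> \<Sigma>"
      using vw by (simp add: vec.subspace_diff[OF sub] vec.subspace_scale[OF sub])
    have "c = 1"
    proof (rule ccontr)
      assume "c \<noteq> 1"
      have "(1 / (1 - c)) *s ((1 - c) *s b0) = (1 / (1 - c) * (1 - c)) *s b0"
        by (rule vec.scale_scale)
      also have "\<dots> = b0" using \<open>c \<noteq> 1\<close> by simp
      finally show False using vec.subspace_scale[OF sub *, of "1 / (1 - c)"] b0 by metis
    qed
    then show ?thesis using c by simp
  qed
  have "(\<lambda>v. vec.span {b0 + v}) ` \<Sigma> = pg_points - points_on \<Sigma>"
  proof (intro set_eqI iffI)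
    fix p assume "p \<in> (\<lambda>v. vec.span {b0 + v}) ` \<Sigma>"
    then obtain v where v: "v \<in> \<Sigma>" "p = vec.span {b0 + v}" by auto
    have "b0 + v \<noteq> 0" using notin[OF v(1)] vec.subspace_0[OF sub] by metis
    then show "p \<in> pg_points - points_on \<Sigma>"
      using notin[OF v(1)] points_on_span_iff[OF sub] by (auto simp: v pg_points_iff)
  next
    fix p assume p: "p \<in> pg_points - points_on \<Sigma>"
    then obtain w where w: "w \<noteq> 0" "p = vec.span {w}" by (auto simp: pg_points_iff)
    then have wS: "w \<notin> \<Sigma>" using p points_on_span_iff[OF sub] by auto
    obtain k where k: "w - k *s b0 \<in> \<Sigma>" by (rule hyperplane_complement[OF \<Sigma> b0])
    have "k \<noteq> 0" using k wS by auto
    define v where "v = (1 / k) *s (w - k *s b0)"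
    have "k *s v = (k * (1 / k)) *s (w - k *s b0)" unfolding v_def by (rule vec.scale_scale)
    then have kv: "w = k *s (b0 + v)"
      using \<open>k \<noteq> 0\<close> by (simp add: vec.scale_right_distrib)
    have "w \<in> vec.span {b0 + v}" unfolding kv by (intro vec.span_scale vec.span_base) simp
    moreover have "b0 + v = (1 / k) *s w"
    proof -
      have "(1 / k) *s w = (1 / k * k) *s (b0 + v)" unfolding kv by (rule vec.scale_scale)
      then show ?thesis using \<open>k \<noteq> 0\<close> by simp
    qed
    then have "b0 + v \<in> vec.span {w}" using vec.span_scale[OF vec.span_base[of w "{w}"]] by simp
    ultimately have "p = vec.span {b0 + v}"
      unfolding w(2) using span_singleton_subset[OF vec.subspace_span] by (intro subset_antisym) blast+
    moreover have "v \<in> \<Sigma>" unfolding v_def by (rule vec.subspace_scale[OF sub k])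
    ultimately show "p \<in> (\<lambda>v. vec.span {b0 + v}) ` \<Sigma>" by blast
  qed
  then show ?thesis using inj by (auto simp: bij_betw_def inj_on_def)
qed

text \<open>Once the affine points are identified with \<Sigma> through b0 + v, a plane meeting
  \<Sigma> in W becomes a coset of W: this is the translation plane of the spread.\<close>

lemma abb_lines_affine:
  fixes \<Sigma> :: "('a::field ^ 5) set"
  assumes \<Sigma>: "hyperplane_in_PG4 \<Sigma>" and b0: "b0 \<notin> \<Sigma>" and S: "line_spread \<Sigma> S"
  shows "abb_lines \<Sigma> S = insert S {insert W ((\<lambda>v. vec.span {b0 + v}) ` {v \<in> \<Sigma>. v - v0 \<in> W}) | W v0.
    W \<in> S \<and> v0 \<in> \<Sigma>}"
proof -
  have sub: "vec.subspace \<Sigma>" using \<Sigma> by (simp add: hyperplane_in_PG4_def)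
  have spread: "vec.subspace W" "vec.dim W = 2" "W \<subseteq> \<Sigma>" if "W \<in> S" for W
    using S that by (auto simp: line_spread_def)
  have points: "{p \<in> abb_points \<Sigma> S. p \<subseteq> E} =
      insert (E \<inter> \<Sigma>) ((\<lambda>v. vec.span {b0 + v}) ` {v \<in> \<Sigma>. v - v0 \<in> E \<inter> \<Sigma>})"
    if E: "vec.subspace E" "E \<inter> \<Sigma> \<in> S" and v0: "v0 \<in> \<Sigma>" "b0 + v0 \<in> E" for E v0
  proof -
    have "{p \<in> S. p \<subseteq> E} = {E \<inter> \<Sigma>}"
    proof -
      have "W = E \<inter> \<Sigma>" if W: "W \<in> S" "W \<subseteq> E" for W
      proof (rule vec.subspace_dim_equal[OF spread(1)[OF W(1)] spread(1)[OF E(2)]])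
        show "W \<subseteq> E \<inter> \<Sigma>" using W(2) spread(3)[OF W(1)] by blast
        show "vec.dim (E \<inter> \<Sigma>) \<le> vec.dim W" using spread(2)[OF W(1)] spread(2)[OF E(2)] by simp
      qed
      moreover have "E \<inter> \<Sigma> \<subseteq> E" by blast
      ultimately show ?thesis using E(2) by blast
    qed
    moreover have "{p \<in> pg_points - points_on \<Sigma>. p \<subseteq> E} =
        (\<lambda>v. vec.span {b0 + v}) ` {v \<in> \<Sigma>. v - v0 \<in> E \<inter> \<Sigma>}"
    proof -
      have "b0 + v \<in> E \<longleftrightarrow> v - v0 \<in> E \<inter> \<Sigma>" if "v \<in> \<Sigma>" for v
      proof
        assume "b0 + v \<in> E"
        then have "(b0 + v) - (b0 + v0) \<in> E" using v0(2) by (rule vec.subspace_diff[OF E(1)])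
        then show "v - v0 \<in> E \<inter> \<Sigma>" using vec.subspace_diff[OF sub that v0(1)] by simp
      next
        assume "v - v0 \<in> E \<inter> \<Sigma>"
        then have "v - v0 \<in> E" by blast
        then have "(v - v0) + (b0 + v0) \<in> E" using v0(2) by (rule vec.subspace_add[OF E(1)])
        then show "b0 + v \<in> E" by (simp add: add.commute)
      qed
      then have "{v \<in> \<Sigma>. vec.span {b0 + v} \<subseteq> E} = {v \<in> \<Sigma>. v - v0 \<in> E \<inter> \<Sigma>}"
        using span_singleton_subset[OF E(1)] by blast
      moreover have "pg_points - points_on \<Sigma> = (\<lambda>v. vec.span {b0 + v}) ` \<Sigma>"
        using affine_points[OF \<Sigma> b0] by (simp add: bij_betw_def)
      moreover have "{p \<in> (\<lambda>v. vec.span {b0 + v}) ` \<Sigma>. p \<subseteq> E} =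
          (\<lambda>v. vec.span {b0 + v}) ` {v \<in> \<Sigma>. vec.span {b0 + v} \<subseteq> E}"
        by (rule Compr_image_eq)
      ultimately show ?thesis by simp
    qed
    moreover have "{p \<in> abb_points \<Sigma> S. p \<subseteq> E} =
        {p \<in> pg_points - points_on \<Sigma>. p \<subseteq> E} \<union> {p \<in> S. p \<subseteq> E}"
      unfolding abb_points_def by blast
    ultimately show ?thesis by simp
  qed
  have exE: "\<exists>v0\<in>\<Sigma>. b0 + v0 \<in> E" if E: "vec.subspace E" "\<not> E \<subseteq> \<Sigma>" for E
  proof -
    obtain w where w: "w \<in> E" "w \<notin> \<Sigma>" using E by blast
    then have "w \<noteq> 0" using vec.subspace_0[OF sub] by metis
    then have "vec.span {w} \<in> pg_points - points_on \<Sigma>"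
      using w points_on_span_iff[OF sub] by (auto simp: pg_points_iff)
    then obtain v where v: "v \<in> \<Sigma>" "vec.span {w} = vec.span {b0 + v}"
      using affine_points[OF \<Sigma> b0] by (auto simp: bij_betw_def)
    have "b0 + v \<in> vec.span {w}" unfolding v(2) by (simp add: vec.span_base)
    moreover have "vec.span {w} \<subseteq> E" using w(1) span_singleton_subset[OF E(1)] by blast
    ultimately show ?thesis using v(1) by blast
  qed
  have plane: "vec.subspace E" "vec.dim E = 3" "\<not> E \<subseteq> \<Sigma>" "E \<inter> \<Sigma> = W" "b0 + v0 \<in> E"
    if W: "W \<in> S" and v0: "v0 \<in> \<Sigma>" and E: "E = vec.span (insert (b0 + v0) W)" for W v0 E
  proof -
    have WW: "vec.span W = W" using spread[OF W] by simp
    have b0v0: "b0 + v0 \<notin> \<Sigma>" using vec.subspace_diff[OF sub, of "b0 + v0" v0] v0 b0 by auto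
    then have "b0 + v0 \<notin> vec.span W" using spread(3)[OF W] WW by blast
    then show "vec.dim E = 3" using spread[OF W] by (simp add: E vec.dim_insert vec.dim_span)
    show "vec.subspace E" by (simp add: E vec.subspace_span)
    show bE: "b0 + v0 \<in> E" by (simp add: E vec.span_base)
    then show "\<not> E \<subseteq> \<Sigma>" using b0v0 by blast
    show "E \<inter> \<Sigma> = W"
    proof (intro set_eqI iffI)
      fix x assume x: "x \<in> E \<inter> \<Sigma>"
      then obtain k where k: "x - k *s (b0 + v0) \<in> W"
        using WW by (auto simp: E vec.span_breakdown_eq)
      have "k = 0"
      proof (rule ccontr)
        assume "k \<noteq> 0"
        have "x \<in> \<Sigma>" "x - k *s (b0 + v0) \<in> \<Sigma>" using x k spread(3)[OF W] by blast+
        then have "x - (x - k *s (b0 + v0)) \<in> \<Sigma>" by (rule vec.subspace_diff[OF sub])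
        then have *: "k *s (b0 + v0) \<in> \<Sigma>" by (simp only: diff_diff_eq2 add_diff_cancel_left')
        have "(1 / k) *s (k *s (b0 + v0)) = (1 / k * k) *s (b0 + v0)" by (rule vec.scale_scale)
        also have "\<dots> = b0 + v0" using \<open>k \<noteq> 0\<close> by simp
        finally have "b0 + v0 \<in> \<Sigma>" using vec.subspace_scale[OF sub *, of "1 / k"] by metis
        then show False using b0v0 by simp
      qed
      then show "x \<in> W" using k by simp
    next
      fix x assume "x \<in> W"
      then show "x \<in> E \<inter> \<Sigma>" using spread(3)[OF W] by (auto simp: E vec.span_base)
    qed
  qed
  have "{{p \<in> abb_points \<Sigma> S. p \<subseteq> E} | E. vec.subspace E \<and> vec.dim E = 3 \<and> \<not> E \<subseteq> \<Sigma> \<and> E \<inter> \<Sigma> \<in> S} =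
    {insert W ((\<lambda>v. vec.span {b0 + v}) ` {v \<in> \<Sigma>. v - v0 \<in> W}) | W v0. W \<in> S \<and> v0 \<in> \<Sigma>}" (is "?l = ?r")
  proof (intro set_eqI iffI)
    fix l assume "l \<in> ?l"
    then obtain E where E: "vec.subspace E" "\<not> E \<subseteq> \<Sigma>" "E \<inter> \<Sigma> \<in> S" "l = {p \<in> abb_points \<Sigma> S. p \<subseteq> E}"
      by blast
    obtain v0 where v0: "v0 \<in> \<Sigma>" "b0 + v0 \<in> E" using exE[OF E(1,2)] by blast
    have "l = insert (E \<inter> \<Sigma>) ((\<lambda>v. vec.span {b0 + v}) ` {v \<in> \<Sigma>. v - v0 \<in> E \<inter> \<Sigma>})"
      unfolding E(4) by (rule points[OF E(1,3) v0])
    then show "l \<in> ?r" using E(3) v0(1) by blast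
  next
    fix l assume "l \<in> ?r"
    then obtain W v0 where W: "W \<in> S" "v0 \<in> \<Sigma>"
      "l = insert W ((\<lambda>v. vec.span {b0 + v}) ` {v \<in> \<Sigma>. v - v0 \<in> W})" by blast
    define E where "E = vec.span (insert (b0 + v0) W)"
    note E = plane[OF W(1,2) E_def]
    have "l = {p \<in> abb_points \<Sigma> S. p \<subseteq> E}"
      using points[OF E(1) _ W(2) E(5)] W(1) by (simp add: E(4) W(3))
    then show "l \<in> ?l" using E W(1) by auto
  qed
  then show ?thesis unfolding abb_lines_def by (rule arg_cong)
qed

section \<open>Coordinates over the quadratic extension\<close>

context tits_field begin

lemma affine_coordinates:
  fixes \<Sigma> :: "('a ^ 5) set"
  assumes card_ext: "CARD('b::{field,finite}) = CARD('a) ^ 2" and \<Sigma>: "hyperplane_in_PG4 \<Sigma>"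
    and S: "desarguesian_spread TYPE('b::{field,finite}) \<Sigma> \<S>" and C: "tits_cone (2 ^ (e + 1)) C"
    and L: "L \<in> \<S>" "C \<inter> points_on \<Sigma> = points_on L"
  obtains \<iota> :: "'a \<Rightarrow> 'b::{field,finite}" and \<alpha> \<beta> xc yc b0 where
    "tits_plane e \<iota> \<alpha> \<beta>" "b0 \<notin> \<Sigma>" "bij_betw (\<lambda>v. (xc v, yc v)) \<Sigma> UNIV"
    "\<And>v w. v \<in> \<Sigma> \<Longrightarrow> w \<in> \<Sigma> \<Longrightarrow> xc (v - w) = xc v - xc w"
    "\<And>v w. v \<in> \<Sigma> \<Longrightarrow> w \<in> \<Sigma> \<Longrightarrow> yc (v - w) = yc v - yc w"
    "L = {v \<in> \<Sigma>. xc v = 0}" "\<S> = insert L (range (\<lambda>m. {v \<in> \<Sigma>. yc v = m * xc v}))"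
    "\<And>v. v \<in> \<Sigma> \<Longrightarrow> vec.span {b0 + v} \<in> C \<longleftrightarrow> (xc v, yc v) \<in> tits_plane.UU e \<iota> \<alpha> \<beta>"
proof -
  have sub: "vec.subspace \<Sigma>" using \<Sigma> by (simp add: hyperplane_in_PG4_def)
  note sub_ops = vec.subspace_add[OF sub] vec.subspace_diff[OF sub] vec.subspace_scale[OF sub]
  have spread: "line_spread \<Sigma> \<S>" using S by (simp add: desarguesian_spread_def)
  have L': "vec.subspace L" "vec.dim L = 2" "L \<subseteq> \<Sigma>" using spread L(1) by (auto simp: line_spread_def)
  obtain \<iota> :: "'a \<Rightarrow> 'b" and \<phi> :: "'a ^ 5 \<Rightarrow> 'b ^ 2" where \<iota>': "\<iota> 1 = 1" "\<forall>x y. \<iota> (x + y) = \<iota> x + \<iota> y"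
    "\<forall>x y. \<iota> (x * y) = \<iota> x * \<iota> y" and \<phi>: "bij_betw \<phi> \<Sigma> UNIV"
    and \<phi>_hom: "\<forall>v\<in>\<Sigma>. \<forall>w\<in>\<Sigma>. \<phi> (v + w) = \<phi> v + \<phi> w" "\<forall>c. \<forall>v\<in>\<Sigma>. \<phi> (c *s v) = \<iota> c *s \<phi> v"
    and S_eq: "\<S> = {{v \<in> \<Sigma>. \<phi> v \<in> W} | W. W \<in> pg_points}"
    using S unfolding desarguesian_spread_def by (elim conjE exE) (rule that)
  note \<iota> = \<iota>'(1) \<iota>'(2)[rule_format] \<iota>'(3)[rule_format]
  note \<phi>_add = \<phi>_hom(1)[rule_format] and \<phi>_scale = \<phi>_hom(2)[rule_format]
  interpret E: tits_extension tp e \<iota>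
    by unfold_locales (use \<iota> card_ext in auto)
  have \<phi>_diff: "\<phi> (v - w) = \<phi> v - \<phi> w" if "v \<in> \<Sigma>" "w \<in> \<Sigma>" for v w
    using \<phi>_add[of "v - w" w] that sub_ops by (simp add: algebra_simps)
  obtain w where w: "w \<noteq> 0" and L_eq: "L = {v \<in> \<Sigma>. \<phi> v \<in> vec.span {w}}"
    using L(1) unfolding S_eq pg_points_iff by blast
  obtain X :: "'a ^ 5 \<Rightarrow> 'a ^ 4" where
    X: "\<And>v w. X (v + w) = X v + X w" "\<And>c v. X (c *s v) = c *s X v" "surj X"
      "\<Sigma> = {w. X w $ 1 = 0}" "L = {w. X w $ 1 = 0 \<and> X w $ 2 = 0 \<and> X w $ 3 = 0}"
      "\<And>w. w \<noteq> 0 \<Longrightarrow> vec.span {w} \<in> C \<longleftrightarrow> Ov (X w)"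
    by (rule cone_at_infinity[OF \<Sigma> L' C L(2)]) blast
  have X_diff: "X (v - w) = X v - X w" for v w
    using X(1)[of "v - w" w] by (simp add: algebra_simps)
  \<comment> \<open>A linear form over the large field whose kernel is spanned by w, the spread
    element L; the first coordinate xc is h \<circ> \<phi>.\<close>
  define h :: "'b ^ 2 \<Rightarrow> 'b" where "h = (\<lambda>p. w $ 2 * p $ 1 - w $ 1 * p $ 2)"
  have h_lin: "h (p + q) = h p + h q" "h (p - q) = h p - h q" "h (c *s p) = c * h p" for p q c
    by (simp_all add: h_def algebra_simps)
  have h_0: "h p = 0 \<longleftrightarrow> p \<in> vec.span {w}" for p
  proof
    assume hp: "h p = 0"
    show "p \<in> vec.span {w}"
    proof (cases "w $ 1 = 0")
      case True
      then have "w $ 2 \<noteq> 0" using w by (auto simp: vec_eq_iff forall_2)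
      then have "p = (p $ 2 / w $ 2) *s w" using hp True by (auto simp: h_def vec_eq_iff forall_2)
      then show ?thesis by (auto simp: span_singleton_iff)
    next
      case False
      then have "p = (p $ 1 / w $ 1) *s w" using hp by (auto simp: h_def vec_eq_iff forall_2 field_simps)
      then show ?thesis by (auto simp: span_singleton_iff)
    qed
  qed (auto simp: span_singleton_iff h_lin(3), simp add: h_def)
  have L_h: "v \<in> L \<longleftrightarrow> h (\<phi> v) = 0" if "v \<in> \<Sigma>" for v
    using that by (simp add: L_eq h_0)
  obtain b0 where b0: "X b0 = vector [1, 0, 0, 0]" using X(3) by (metis surjD)
  obtain a1 where a1: "X a1 = vector [0, 1, 0, 0]" using X(3) by (metis surjD)
  obtain a2 where a2: "X a2 = vector [0, 0, 1, 0]" using X(3) by (metis surjD)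
  obtain a3 where a3: "X a3 = vector [0, 0, 0, 1]" using X(3) by (metis surjD)
  have aS: "a1 \<in> \<Sigma>" "a2 \<in> \<Sigma>" "a3 \<in> \<Sigma>" "b0 \<notin> \<Sigma>" by (auto simp: X(4) a1 a2 a3 b0)
  define \<alpha> where "\<alpha> = h (\<phi> a1)"
  define \<beta> where "\<beta> = h (\<phi> a2)"
  have comb: "h (\<phi> (s *s a1 + t *s a2)) = \<iota> s * \<alpha> + \<iota> t * \<beta>" for s t
    using aS sub_ops by (simp add: \<phi>_add \<phi>_scale h_lin \<alpha>_def \<beta>_def)
  have xc: "h (\<phi> v) = \<iota> (X v $ 2) * \<alpha> + \<iota> (X v $ 3) * \<beta>" if v: "v \<in> \<Sigma>" for v
  proof -
    define u where "u = X v $ 2 *s a1 + X v $ 3 *s a2"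
    have u: "u \<in> \<Sigma>" using aS sub_ops by (simp add: u_def)
    have "v - u \<in> L"
      using v by (simp add: X(5) X_diff u_def X(1,2) a1 a2) (simp add: X(4))
    then have "h (\<phi> (v - u)) = 0" using L_h[of "v - u"] v u sub_ops by simp
    then have "h (\<phi> v) = h (\<phi> u)" using v u by (simp add: \<phi>_diff h_lin)
    then show ?thesis by (simp add: u_def comb)
  qed
  \<comment> \<open>If the determinant vanished, \<alpha> / \<beta> would be fixed by conjugation
    and some a1 + c a2 would lie in L, on which the third coordinate of X is 0 and so is the
    second.\<close>
  have "\<alpha> * \<beta> ^ CARD('a) + \<beta> * \<alpha> ^ CARD('a) \<noteq> 0"
  proof
    assume "\<alpha> * \<beta> ^ CARD('a) + \<beta> * \<alpha> ^ CARD('a) = 0"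
    then have *: "\<alpha> * E.cj \<beta> = \<beta> * E.cj \<alpha>" by (simp only: E.cj_def E.B.add_eq_0)
    have "\<beta> \<noteq> 0" using L_h[OF aS(2)] by (auto simp: \<beta>_def X(5) a2)
    then have "E.cj (\<alpha> / \<beta>) = \<alpha> / \<beta>" using * by (simp add: field_simps)
    then obtain c where "\<alpha> / \<beta> = \<iota> c" by (rule E.cj_fixed)
    then have "\<alpha> = \<iota> c * \<beta>" using \<open>\<beta> \<noteq> 0\<close> by (simp add: field_simps)
    then have "h (\<phi> (1 *s a1 + c *s a2)) = 0" unfolding comb by (simp add: E.B.add_self \<iota>)
    moreover have "1 *s a1 + c *s a2 \<in> \<Sigma>" using aS sub_ops by simp
    ultimately have "1 *s a1 + c *s a2 \<in> L" using L_h by blast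
    then show False by (simp add: X(5) X(1,2) a1 a2)
  qed
  then have plane: "tits_plane e \<iota> \<alpha> \<beta>"
    using E.tits_extension_axioms by (simp add: tits_plane_def tits_plane_axioms_def)
  interpret T: tits_plane tp e \<iota> \<alpha> \<beta> by (rule plane)
  define \<psi> where "\<psi> = inv_into \<Sigma> \<phi>"
  have \<psi>: "\<psi> p \<in> \<Sigma>" "\<phi> (\<psi> p) = p" for p
    using \<phi> by (auto simp: \<psi>_def bij_betw_def inv_into_into f_inv_into_f)
  have \<psi>\<phi>: "\<psi> (\<phi> v) = v" if "v \<in> \<Sigma>" for v
    using \<phi> that by (simp add: \<psi>_def bij_betw_def)
  have \<psi>_add: "\<psi> (p + q) = \<psi> p + \<psi> q" for p q
    using \<psi>\<phi>[of "\<psi> p + \<psi> q"] \<psi> sub_ops \<phi>_add by simp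
  have \<psi>_scale: "\<psi> (\<iota> c *s p) = c *s \<psi> p" for p c
    using \<psi>\<phi>[of "c *s \<psi> p"] \<psi> sub_ops \<phi>_scale by simp
  have v2: "vector [x + y, 0] = vector [x, 0] + (vector [y, 0] :: 'b ^ 2)"
    "vector [0, x + y] = vector [0, x] + (vector [0, y] :: 'b ^ 2)"
    "vector [c * x, 0] = c *s (vector [x, 0] :: 'b ^ 2)"
    "vector [0, c * x] = c *s (vector [0, x] :: 'b ^ 2)" for x y c :: 'b
    by (simp_all add: vec_eq_iff forall_2)
  obtain \<mu>1 where \<mu>1: "\<And>x. E.tr (\<mu>1 * x) = \<iota> (X (\<psi> (vector [x, 0])) $ 4)"
    using T.functional_eq_tr[of "\<lambda>x. X (\<psi> (vector [x, 0])) $ 4"]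
    by (simp add: v2 \<psi>_add \<psi>_scale X(1,2)) blast
  obtain \<mu>2 where \<mu>2: "\<And>x. E.tr (\<mu>2 * x) = \<iota> (X (\<psi> (vector [0, x])) $ 4)"
    using T.functional_eq_tr[of "\<lambda>x. X (\<psi> (vector [0, x])) $ 4"]
    by (simp add: v2 \<psi>_add \<psi>_scale X(1,2)) blast
  \<comment> \<open>The form linear over the large field whose trace is the last coordinate of the
    cone; it provides the second coordinate yc.\<close>
  define \<kappa> :: "'b ^ 2 \<Rightarrow> 'b" where "\<kappa> = (\<lambda>p. \<mu>1 * p $ 1 + \<mu>2 * p $ 2)"
  have \<kappa>_lin: "\<kappa> (p + q) = \<kappa> p + \<kappa> q" "\<kappa> (p - q) = \<kappa> p - \<kappa> q" "\<kappa> (c *s p) = c * \<kappa> p" for p q c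
    by (simp_all add: \<kappa>_def algebra_simps)
  have tr_\<kappa>: "E.tr (\<kappa> (\<phi> v)) = \<iota> (X v $ 4)" if v: "v \<in> \<Sigma>" for v
  proof -
    define p where "p = \<phi> v"
    have "p = vector [p $ 1, 0] + vector [0, p $ 2]" by (simp add: vec_eq_iff forall_2)
    then have "v = \<psi> (vector [p $ 1, 0]) + \<psi> (vector [0, p $ 2])"
      using \<psi>\<phi>[OF v] \<psi>_add by (metis p_def)
    then have "X v $ 4 = X (\<psi> (vector [p $ 1, 0])) $ 4 + X (\<psi> (vector [0, p $ 2])) $ 4"
      by (metis X(1) vector_add_component)
    then show ?thesis by (simp add: \<kappa>_def E.tr_add \<mu>1 \<mu>2 \<iota>(2) flip: p_def)
  qed
  \<comment> \<open>On the kernel of h, the line spanned by w, \<kappa> cannot vanish: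
    \<open>a3\<close> lies in L and has last coordinate 1.\<close>
  have h\<kappa>_0: "p = 0" if hp: "h p = 0" "\<kappa> p = 0" for p
  proof (rule ccontr)
    assume "p \<noteq> 0"
    obtain c where c: "p = c *s w" using hp(1) by (auto simp: h_0 span_singleton_iff)
    then have "\<kappa> w = 0" using hp(2) \<open>p \<noteq> 0\<close> by (auto simp: \<kappa>_lin)
    have "a3 \<in> L" by (simp add: X(5) a3)
    then obtain k where "\<phi> a3 = k *s w" by (auto simp: L_eq span_singleton_iff)
    then have "\<kappa> (\<phi> a3) = 0" using \<open>\<kappa> w = 0\<close> by (simp add: \<kappa>_lin)
    then have "E.tr 0 = \<iota> 1" using tr_\<kappa>[OF aS(3)] by (simp add: a3)
    then show False by (simp add: E.tr_def)
  qed
  have inj_h\<kappa>: "inj (\<lambda>p. (h p, \<kappa> p))"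
  proof (rule injI)
    fix p q assume "(h p, \<kappa> p) = (h q, \<kappa> q)"
    then have "p - q = 0" by (intro h\<kappa>_0) (simp_all add: h_lin \<kappa>_lin)
    then show "p = q" by simp
  qed
  have bij_h\<kappa>: "bij (\<lambda>p. (h p, \<kappa> p))"
  proof -
    have "card (range (\<lambda>p. (h p, \<kappa> p))) = CARD('b ^ 2)" by (rule card_image[OF inj_h\<kappa>])
    then have "card (range (\<lambda>p. (h p, \<kappa> p))) = CARD('b \<times> 'b)"
      by (simp add: CARD_vec power2_eq_square)
    then have "range (\<lambda>p. (h p, \<kappa> p)) = UNIV" by (intro card_subset_eq) auto
    then show ?thesis using inj_h\<kappa> by (simp add: bij_def)
  qed
  define xc where "xc = (\<lambda>v. h (\<phi> v))"
  define yc where "yc = (\<lambda>v. \<kappa> (\<phi> v))"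
  have bij: "bij_betw (\<lambda>v. (xc v, yc v)) \<Sigma> UNIV"
    using bij_betw_trans[OF \<phi> bij_h\<kappa>] by (simp add: xc_def yc_def comp_def)
  have diff: "xc (v - w) = xc v - xc w" "yc (v - w) = yc v - yc w" if "v \<in> \<Sigma>" "w \<in> \<Sigma>" for v w
    using that by (simp_all add: xc_def yc_def \<phi>_diff h_lin \<kappa>_lin)
  have L_xc: "L = {v \<in> \<Sigma>. xc v = 0}" using L_h L'(3) by (auto simp: xc_def)
  have span_slope: "p \<in> vec.span {u} \<longleftrightarrow> \<kappa> p = \<kappa> u / h u * h p" if u: "h u \<noteq> 0" for u p
  proof
    assume "p \<in> vec.span {u}"
    then show "\<kappa> p = \<kappa> u / h u * h p" using u by (auto simp: span_singleton_iff h_lin \<kappa>_lin)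
  next
    assume p: "\<kappa> p = \<kappa> u / h u * h p"
    have "p - (h p / h u) *s u = 0"
      by (rule h\<kappa>_0) (use u p in \<open>simp_all add: h_lin \<kappa>_lin\<close>)
    then show "p \<in> vec.span {u}" by (auto simp: span_singleton_iff)
  qed
  have span_L: "{v \<in> \<Sigma>. \<phi> v \<in> vec.span {u}} = L" if u: "u \<noteq> 0" "h u = 0" for u
  proof -
    obtain c where c: "u = c *s w" using u(2) by (auto simp: h_0 span_singleton_iff)
    then have "c \<noteq> 0" using u(1) by auto
    have "vec.span {u} = vec.span {w}"
    proof (rule subset_antisym)
      show "vec.span {u} \<subseteq> vec.span {w}"
        using c by (simp add: span_singleton_subset vec.subspace_span vec.span_scale vec.span_base)
      have "w = (1 / c) *s u" using \<open>c \<noteq> 0\<close> by (simp add: c)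
      then show "vec.span {w} \<subseteq> vec.span {u}"
        using span_singleton_subset[OF vec.subspace_span, of w "{u}"] span_singleton_iff[of w u] by blast
    qed
    then show ?thesis by (simp add: L_eq)
  qed
  have S_slopes: "\<S> = insert L (range (\<lambda>m. {v \<in> \<Sigma>. yc v = m * xc v}))"
  proof (intro set_eqI iffI)
    fix W assume "W \<in> \<S>"
    then obtain u where u: "u \<noteq> 0" "W = {v \<in> \<Sigma>. \<phi> v \<in> vec.span {u}}"
      by (auto simp: S_eq pg_points_iff)
    show "W \<in> insert L (range (\<lambda>m. {v \<in> \<Sigma>. yc v = m * xc v}))"
    proof (cases "h u = 0")
      case True
      then show ?thesis using span_L[OF u(1)] by (simp add: u(2))
    next
      case False
      have "W = {v \<in> \<Sigma>. yc v = (\<kappa> u / h u) * xc v}"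
        unfolding u(2) span_slope[OF False] xc_def yc_def ..
      then show ?thesis by blast
    qed
  next
    fix W assume W: "W \<in> insert L (range (\<lambda>m. {v \<in> \<Sigma>. yc v = m * xc v}))"
    show "W \<in> \<S>"
    proof (cases "W = L")
      case False
      then obtain m where m: "W = {v \<in> \<Sigma>. yc v = m * xc v}" using W by blast
      obtain u where "(1, m) = (h u, \<kappa> u)"
        using surjD[OF bij_is_surj[OF bij_h\<kappa>], of "(1, m)"] by blast
      then have u: "h u = 1" "\<kappa> u = m" by auto
      have "u \<noteq> 0" using u(1) h_lin(3)[of 0 u] by auto
      have "W = {v \<in> \<Sigma>. \<phi> v \<in> vec.span {u}}"
        unfolding m using span_slope[of u] u by (simp add: xc_def yc_def)
      then show ?thesis using \<open>u \<noteq> 0\<close> unfolding S_eq pg_points_iff by blast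
    qed (use L(1) in simp)
  qed
  have cone: "vec.span {b0 + v} \<in> C \<longleftrightarrow> (xc v, yc v) \<in> T.UU" if v: "v \<in> \<Sigma>" for v
  proof -
    have "0 - v \<in> \<Sigma>" using vec.subspace_0[OF sub] v by (rule vec.subspace_diff[OF sub])
    moreover have "b0 = 0 - v" if "b0 + v = 0" using that by (simp add: eq_neg_iff_add_eq_0)
    ultimately have "b0 + v \<noteq> 0" using aS(4) by metis
    then have "vec.span {b0 + v} \<in> C \<longleftrightarrow> Ov (X (b0 + v))" by (rule X(6))
    also have "\<dots> \<longleftrightarrow> X v $ 4 = f (X v $ 2) (X v $ 3)"
      using v by (simp add: Ov_def X(1) b0) (simp add: X(4))
    also have "\<dots> \<longleftrightarrow> E.tr (yc v) = \<iota> (f (X v $ 2) (X v $ 3))"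
      by (simp add: yc_def tr_\<kappa>[OF v])
    also have "\<dots> \<longleftrightarrow> (xc v, yc v) \<in> T.UU"
      unfolding xc_def xc[OF v] T.pt_def[symmetric] by (rule T.UU_iff[symmetric])
    finally show ?thesis .
  qed
  show ?thesis
    by (rule that[OF plane aS(4) bij diff L_xc S_slopes cone])
qed

end

section \<open>Transport of the coordinates to the given plane\<close>

theorem theorem3:
  fixes e :: nat and U linf :: "('b::{field,finite} ^ 3) set set"
  assumes "e \<ge> 1"
    and "CARD('a::{field,finite}) = 2 ^ (2 * e + 1)"
    and "CARD('b) = CARD('a) ^ 2"
    and "buekenhout_tits_unital TYPE('a) e linf U"
  shows "(\<forall>P \<in> pg_points - (linf \<union> U). \<forall>l \<in> pg_lines. card (l \<inter> feet U P) \<le> 4) \<and>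
    (\<forall>k \<in> {0, 1, 2, 3, 4}. \<exists>l \<in> pg_lines. \<exists>P \<in> pg_points - (linf \<union> U). card (l \<inter> feet U P) = k)"
proof -
  interpret F: tits_field "TYPE('a)" e
    by unfold_locales (use assms in auto)
  obtain \<Sigma> :: "('a ^ 5) set" and \<S> \<psi> C L where U: "U \<subseteq> pg_points" and linf: "linf \<in> pg_lines"
    and \<Sigma>: "hyperplane_in_PG4 \<Sigma>" and S: "desarguesian_spread TYPE('b) \<Sigma> \<S>"
    and \<psi>: "abb_model \<Sigma> \<S> \<psi>" and \<psi>_linf: "\<psi> ` linf = \<S>" and C: "tits_cone (2 ^ (e + 1)) C"
    and L: "L \<in> \<S>" "C \<inter> points_on \<Sigma> = points_on L" and \<psi>_U: "\<psi> ` U = insert L (C - points_on \<Sigma>)"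
    using assms(4) unfolding buekenhout_tits_unital_def unital_def
    by (elim conjE exE bexE) (rule that)
  obtain \<iota> :: "'a \<Rightarrow> 'b" and \<alpha> \<beta> xc yc b0 where
    plane: "tits_plane e \<iota> \<alpha> \<beta>" and b0: "b0 \<notin> \<Sigma>" and bij: "bij_betw (\<lambda>v. (xc v, yc v)) \<Sigma> UNIV"
    and xc_diff: "\<And>v w. v \<in> \<Sigma> \<Longrightarrow> w \<in> \<Sigma> \<Longrightarrow> xc (v - w) = xc v - xc w"
    and yc_diff: "\<And>v w. v \<in> \<Sigma> \<Longrightarrow> w \<in> \<Sigma> \<Longrightarrow> yc (v - w) = yc v - yc w"
    and L_eq: "L = {v \<in> \<Sigma>. xc v = 0}" and S_eq: "\<S> = insert L (range (\<lambda>m. {v \<in> \<Sigma>. yc v = m * xc v}))"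
    and cone: "\<And>v. v \<in> \<Sigma> \<Longrightarrow> vec.span {b0 + v} \<in> C \<longleftrightarrow> (xc v, yc v) \<in> tits_plane.UU e \<iota> \<alpha> \<beta>"
    by (rule F.affine_coordinates[OF assms(3) \<Sigma> S C L]) (rule that)
  interpret T: tits_plane "TYPE('a)" e \<iota> \<alpha> \<beta> by (rule plane)
  have sub: "vec.subspace \<Sigma>" using \<Sigma> by (simp add: hyperplane_in_PG4_def)
  have spread: "line_spread \<Sigma> \<S>" using S by (simp add: desarguesian_spread_def)
  define slope where "slope = (\<lambda>m. {v \<in> \<Sigma>. yc v = m * xc v})"
  define vv where "vv = inv_into \<Sigma> (\<lambda>v. (xc v, yc v))"
  have bij_vv: "bij_betw vv UNIV \<Sigma>" unfolding vv_def by (rule bij_betw_inv_into[OF bij])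
  have vv: "vv z \<in> \<Sigma>" "xc (vv z) = fst z" "yc (vv z) = snd z" for z
  proof -
    show "vv z \<in> \<Sigma>" using bij_vv by (auto simp: bij_betw_def)
    have "(xc (vv z), yc (vv z)) = z"
      using f_inv_into_f[of z "\<lambda>v. (xc v, yc v)" \<Sigma>] bij by (simp add: vv_def bij_betw_def)
    then show "xc (vv z) = fst z" "yc (vv z) = snd z" by (metis fst_conv, metis snd_conv)
  qed
  have vv_inv: "vv (xc v, yc v) = v" if "v \<in> \<Sigma>" for v
    using inv_into_f_f[of "\<lambda>v. (xc v, yc v)" \<Sigma> v] bij that by (simp add: vv_def bij_betw_def)
  have vv_image: "vv ` Z = {v \<in> \<Sigma>. (xc v, yc v) \<in> Z}" for Z
  proof (intro set_eqI iffI)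
    fix v assume "v \<in> vv ` Z"
    then obtain z where "z \<in> Z" "v = vv z" by auto
    then show "v \<in> {v \<in> \<Sigma>. (xc v, yc v) \<in> Z}" using vv[of z] by simp
  next
    fix v assume v: "v \<in> {v \<in> \<Sigma>. (xc v, yc v) \<in> Z}"
    then show "v \<in> vv ` Z" using vv_inv[of v] by (intro image_eqI[of _ _ "(xc v, yc v)"]) auto
  qed
  define af where "af = (\<lambda>v. vec.span {b0 + v})"
  define B where "B = af \<circ> vv"
  have bij_af: "bij_betw af \<Sigma> (pg_points - points_on \<Sigma>)"
    unfolding af_def by (rule affine_points[OF \<Sigma> b0])
  have bij_B: "bij_betw B UNIV (pg_points - points_on \<Sigma>)"
    unfolding B_def by (rule bij_betw_trans[OF bij_vv bij_af])
  have B_image: "B ` Z = af ` {v \<in> \<Sigma>. (xc v, yc v) \<in> Z}" for Z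
    unfolding B_def image_comp[symmetric] vv_image ..
  have lines_abb: "abb_lines \<Sigma> \<S> = insert \<S> (range (\<lambda>c. insert L (B ` T.vline c))
      \<union> {insert (slope m) (B ` T.aline m n) | m n. True})" (is "_ = insert \<S> (?V \<union> ?A)")
  proof -
    have vert: "insert L (af ` {v \<in> \<Sigma>. v - v0 \<in> L}) = insert L (B ` T.vline (xc v0))" if v0: "v0 \<in> \<Sigma>" for v0
    proof -
      have "v - v0 \<in> L \<longleftrightarrow> (xc v, yc v) \<in> T.vline (xc v0)" if "v \<in> \<Sigma>" for v
        using that v0 vec.subspace_diff[OF sub that v0] by (simp add: L_eq T.vline_def xc_diff)
      then have "{v \<in> \<Sigma>. v - v0 \<in> L} = {v \<in> \<Sigma>. (xc v, yc v) \<in> T.vline (xc v0)}" by blast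
      then show ?thesis unfolding B_image by simp
    qed
    have slant: "insert (slope m) (af ` {v \<in> \<Sigma>. v - v0 \<in> slope m}) =
        insert (slope m) (B ` T.aline m (yc v0 - m * xc v0))" if v0: "v0 \<in> \<Sigma>" for m v0
    proof -
      have "v - v0 \<in> slope m \<longleftrightarrow> (xc v, yc v) \<in> T.aline m (yc v0 - m * xc v0)" if "v \<in> \<Sigma>" for v
      proof -
        have "v - v0 \<in> slope m \<longleftrightarrow> yc v - yc v0 = m * (xc v - xc v0)"
          using that v0 vec.subspace_diff[OF sub that v0] by (simp add: slope_def xc_diff yc_diff)
        then show ?thesis by (auto simp: T.aline_def algebra_simps)
      qed
      then have "{v \<in> \<Sigma>. v - v0 \<in> slope m} = {v \<in> \<Sigma>. (xc v, yc v) \<in> T.aline m (yc v0 - m * xc v0)}" by blast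
      then show ?thesis unfolding B_image by simp
    qed
    have "{insert W (af ` {v \<in> \<Sigma>. v - v0 \<in> W}) | W v0. W \<in> \<S> \<and> v0 \<in> \<Sigma>} = ?V \<union> ?A" (is "?M = _")
    proof (intro set_eqI iffI)
      fix l assume "l \<in> ?M"
      then obtain W v0 where l: "l = insert W (af ` {v \<in> \<Sigma>. v - v0 \<in> W})" "W \<in> \<S>" "v0 \<in> \<Sigma>" by blast
      then consider "W = L" | m where "W = slope m" unfolding S_eq slope_def by blast
      then show "l \<in> ?V \<union> ?A"
      proof cases
        case 1
        then show ?thesis using vert[OF l(3)] l(1) by blast
      next
        case 2
        then show ?thesis using slant[OF l(3), of m] l(1) by blast
      qed
    next
      fix l assume "l \<in> ?V \<union> ?A"
      then consider c where "l = insert L (B ` T.vline c)" | m n where "l = insert (slope m) (B ` T.aline m n)"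
        by blast
      then show "l \<in> ?M"
      proof cases
        case 1
        then have "l = insert L (af ` {v \<in> \<Sigma>. v - vv (c, 0) \<in> L})"
          using vert[OF vv(1)[of "(c, 0)"]] by (simp add: vv)
        then show ?thesis using L(1) vv(1)[of "(c, 0)"] by blast
      next
        case 2
        then have "l = insert (slope m) (af ` {v \<in> \<Sigma>. v - vv (0, n) \<in> slope m})"
          using slant[OF vv(1)[of "(0, n)"], of m] by (simp add: vv)
        moreover have "slope m \<in> \<S>" unfolding S_eq slope_def by blast
        ultimately show ?thesis using vv(1)[of "(0, n)"] by blast
      qed
    qed
    then show ?thesis unfolding abb_lines_affine[OF \<Sigma> b0 spread] af_def by (rule arg_cong)
  qed
  have bij_\<psi>: "bij_betw \<psi> pg_points (abb_points \<Sigma> \<S>)" and \<psi>_lines: "(\<lambda>l. \<psi> ` l) ` pg_lines = abb_lines \<Sigma> \<S>"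
    using \<psi> by (auto simp: abb_model_def)
  define \<theta> where "\<theta> = inv_into pg_points \<psi>"
  have \<theta>: "bij_betw \<theta> (abb_points \<Sigma> \<S>) pg_points"
    unfolding \<theta>_def by (rule bij_betw_inv_into[OF bij_\<psi>])
  have \<theta>\<psi>: "\<theta> ` \<psi> ` Z = Z" if "Z \<subseteq> pg_points" for Z
    unfolding \<theta>_def using bij_\<psi> that by (simp add: bij_betw_def inv_into_image_cancel)
  have lines_sub: "l \<subseteq> pg_points" if "l \<in> pg_lines" for l :: "('b ^ 3) set set"
    using that by (auto simp: pg_lines_def points_on_def)
  have \<theta>_S: "\<theta> ` \<S> = linf" using \<theta>\<psi>[OF lines_sub[OF linf]] by (simp add: \<psi>_linf)
  have range_B: "range B = pg_points - points_on \<Sigma>" using bij_B by (simp add: bij_betw_def)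
  have points_abb: "abb_points \<Sigma> \<S> = range B \<union> \<S>" unfolding abb_points_def range_B ..
  \<comment> \<open>Affine points have dimension 1 as subspaces, spread elements dimension
    2.\<close>
  have disj: "range B \<inter> \<S> = {}"
    using spread unfolding range_B line_spread_def pg_points_def by force
  have inj_\<theta>: "inj_on \<theta> (range B \<union> \<S>)" using \<theta> by (simp add: points_abb bij_betw_def)
  have slope_S: "slope m \<in> \<S>" for m unfolding S_eq slope_def by blast
  have slope_L: "slope m \<noteq> L" for m
  proof
    assume "slope m = L"
    moreover have "vv (1, m) \<in> slope m" using vv[of "(1, m)"] by (simp add: slope_def)
    ultimately show False using vv[of "(1, m)"] by (simp add: L_eq)
  qed
  have cone_points: "C \<subseteq> pg_points"
    using C by (auto simp: tits_cone_def ovoidal_cone_def points_on_def)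
  have "C - points_on \<Sigma> = B ` T.UU"
  proof -
    have "C - points_on \<Sigma> = {p \<in> range B. p \<in> C}" using cone_points range_B by blast
    also have "\<dots> = B ` {z. B z \<in> C}" by blast
    also have "{z. B z \<in> C} = T.UU"
      using cone[OF vv(1)] by (auto simp: B_def af_def vv)
    finally show ?thesis .
  qed
  then have U_eq: "U = insert (\<theta> L) ((\<theta> \<circ> B) ` T.UU)"
    using \<theta>\<psi>[OF U] by (simp add: \<psi>_U image_comp)
  have lines_eq: "pg_lines = insert linf (range (\<lambda>c. insert (\<theta> L) ((\<theta> \<circ> B) ` T.vline c))
      \<union> {insert (\<theta> (slope m)) ((\<theta> \<circ> B) ` T.aline m n) | m n. True})"
  proof -
    have "pg_lines = (\<lambda>l. \<theta> ` \<psi> ` l) ` pg_lines"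
      using \<theta>\<psi> lines_sub by simp
    also have "\<dots> = (\<lambda>l. \<theta> ` l) ` abb_lines \<Sigma> \<S>"
      unfolding \<psi>_lines[symmetric] image_image ..
    also have "\<dots> = insert linf (range (\<lambda>c. insert (\<theta> L) ((\<theta> \<circ> B) ` T.vline c))
        \<union> (\<lambda>l. \<theta> ` l) ` {insert (slope m) (B ` T.aline m n) | m n. True})"
      unfolding lines_abb by (simp add: image_Un image_image \<theta>_S comp_def)
    also have "(\<lambda>l. \<theta> ` l) ` {insert (slope m) (B ` T.aline m n) | m n. True} =
        {insert (\<theta> (slope m)) ((\<theta> \<circ> B) ` T.aline m n) | m n. True}"
      unfolding image_comp[symmetric] image_insert[symmetric] by blast
    finally show ?thesis .
  qed
  show ?thesis
  proof (rule T.feet_of_coordinates[of "\<theta> \<circ> B" linf "\<theta> L" "\<lambda>m. \<theta> (slope m)" U])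
    show "inj (\<theta> \<circ> B)"
      by (rule comp_inj_on) (use bij_B inj_\<theta> in \<open>auto simp: bij_betw_def intro: inj_on_subset\<close>)
    show "range (\<theta> \<circ> B) \<inter> linf = {}"
      using inj_on_image_Int[OF inj_\<theta>, of "range B" \<S>] disj by (simp add: image_comp \<theta>_S)
    show "pg_points = range (\<theta> \<circ> B) \<union> linf"
      using \<theta> by (simp add: points_abb bij_betw_def image_Un image_comp \<theta>_S)
    show "\<theta> L \<in> linf" "\<theta> (slope m) \<in> linf" for m
      unfolding \<theta>_S[symmetric] using L(1) slope_S by auto
    show "\<theta> (slope m) \<noteq> \<theta> L" for m
      using inj_onD[OF inj_\<theta>, of "slope m" L] slope_S[of m] L(1) slope_L[of m] by blast
  qed (rule U_eq, rule lines_eq)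
qed

end
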